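(* Let $n,r\ge1$, let $I$ be a composition of $n$, and let $N_I=\mathcal H_{n,r}(0)\otimes_{H_n(0)}P_I$ be the $\mathcal H_{n,r}(0)$-module induced by the indecomposable projective $H_n(0)$-module $P_I$. Then $$N_I\simeq\bigoplus P_{[I,\mathbf c]},$$ where the sum runs over all the anticycloribbons $[I,\mathbf c]$ of shape $I$.
   Context: **The algebras.** Fix the color set $C=\{1,\dots,r\}$ and $r$ distinct complex numbers $u_1,\dots,u_r$. Put $P_k(X)=\prod_{1\le l\le r,\,l\ne k}\frac{X-u_l}{u_k-u_l}$. The $0$-Ariki-Koike-Shoji algebra $\mathcal H_{n,r}(0)$ is the associative unital $\mathbb C$-algebra generated by $T_1,\dots,T_{n-1},\xi_1,\dots,\xi_n$ with relations: $T_i(T_i+1)=0$; $T_iT_{i+1}T_i=T_{i+1}T_iT_{i+1}$; $T_iT_j=T_jT_i$ for $|i-j|\ge2$; $(\xi_j-u_1)\cdots(\xi_j-u_r)=0$; $\xi_i\xi_j=\xi_j\xi_i$; $T_i\xi_i=\xi_{i+1}T_i+\sum_{1\le a<b\le r}(u_b-u_a)P_a(\xi_i)P_b(\xi_{i+1})$; $T_i(\xi_{i+1}+\xi_i)=(\xi_{i+1}+\xi_i)T_i$; $T_i\xi_j=\xi_jT_i$ for $j\ne i,i+1$. The subalgebra generated by the $T_i$ is the $0$-Hecke algebra $H_n(0)$. **Modules.** For a composition $I=(i_1,\dots,i_k)$ of $n$, $\mathrm{Des}(I)=\{i_1,i_1+i_2,\dots,i_1+\cdots+i_{k-1}\}$.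 $P_I$ is the indecomposable projective $H_n(0)$-module whose unique simple quotient is the one-dimensional module on which $T_i$ acts by $-1$ if $i\in\mathrm{Des}(I)$ and by $0$ otherwise. A colored ribbon of size $n$ is a pair $[I,\mathbf c]$, $I$ a composition of $n$ (its shape), $\mathbf c\in C^n$. It is a cycloribbon if $c_j\le c_{j+1}$ for $j\notin\mathrm{Des}(I)$ and $c_j\ge c_{j+1}$ for $j\in\mathrm{Des}(I)$; an anticycloribbon if $c_j\ge c_{j+1}$ for $j\notin\mathrm{Des}(I)$ and $c_j\le c_{j+1}$ for $j\in\mathrm{Des}(I)$. The involution $\phi$ sends $[I,\mathbf c]$ to $[I',\mathbf c]$ where $\mathrm{Des}(I')=\{j\in\mathrm{Des}(I): c_j=c_{j+1}\}\cup\{j\notin\mathrm{Des}(I): c_j\ne c_{j+1}\}$; it exchanges cycloribbons and anticycloribbons. For a cycloribbon $[I,\mathbf c]$, $S_{[I,\mathbf c]}$ is the one-dimensional simple $\mathcal H_{n,r}(0)$-module on which $\xi_i$ acts by $u_{c_i}$ and $T_i$ acts by $-1$ if $i$ is a descent of the shape of $\phi([I,\mathbf c])$ and by $0$ otherwise; these are all the simple modules, without repetition. For an anticycloribbon $[K,\mathbf c]$, $P_{[K,\mathbf c]}$ is the indecomposable projective $\mathcal H_{n,r}(0)$-module whose unique simple quotient is $S_{\phi([K,\mathbf c])}$. All modules are left modules. *)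

theory Defs
  imports "HOL-Algebra.Algebra"
begin

section \<open>Left modules over a not necessarily commutative ring\<close>

text \<open>
  The locale \<^locale>\<open>module\<close> of HOL-Algebra insists on a commutative base ring. We reuse its
  record (in which the fields \<open>mult\<close> and \<open>one\<close> inherited from \<open>ring\<close> play no role for modules)
  and its locale \<^locale>\<open>submodule\<close>, which does not need commutativity.
\<close>

locale left_module = R?: ring R + M?: abelian_group M
  for R :: "('a, 'e) ring_scheme" (structure) and M :: "('a, 'b, 'f) module_scheme" (structure) +
  assumes smult_closed [simp, intro]:
      "\<lbrakk>a \<in> carrier R; x \<in> carrier M\<rbrakk> \<Longrightarrow> a \<odot>\<^bsub>M\<^esub> x \<in> carrier M"
    and smult_l_distr:
      "\<lbrakk>a \<in> carrier R; b \<in> carrier R; x \<in> carrier M\<rbrakk> \<Longrightarrow>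
        (a \<oplus> b) \<odot>\<^bsub>M\<^esub> x = a \<odot>\<^bsub>M\<^esub> x \<oplus>\<^bsub>M\<^esub> b \<odot>\<^bsub>M\<^esub> x"
    and smult_r_distr:
      "\<lbrakk>a \<in> carrier R; x \<in> carrier M; y \<in> carrier M\<rbrakk> \<Longrightarrow>
        a \<odot>\<^bsub>M\<^esub> (x \<oplus>\<^bsub>M\<^esub> y) = a \<odot>\<^bsub>M\<^esub> x \<oplus>\<^bsub>M\<^esub> a \<odot>\<^bsub>M\<^esub> y"
    and smult_assoc1:
      "\<lbrakk>a \<in> carrier R; b \<in> carrier R; x \<in> carrier M\<rbrakk> \<Longrightarrow>
        (a \<otimes> b) \<odot>\<^bsub>M\<^esub> x = a \<odot>\<^bsub>M\<^esub> (b \<odot>\<^bsub>M\<^esub> x)"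
    and smult_one [simp]: "x \<in> carrier M \<Longrightarrow> \<one> \<odot>\<^bsub>M\<^esub> x = x"

definition lmod_hom ::
  "('a, 'e) ring_scheme \<Rightarrow> ('a, 'b) module \<Rightarrow> ('a, 'c) module \<Rightarrow> ('b \<Rightarrow> 'c) set" where
  "lmod_hom R M N = {h \<in> carrier M \<rightarrow> carrier N.
     (\<forall>x\<in>carrier M. \<forall>y\<in>carrier M. h (x \<oplus>\<^bsub>M\<^esub> y) = h x \<oplus>\<^bsub>N\<^esub> h y) \<and>
     (\<forall>a\<in>carrier R. \<forall>x\<in>carrier M. h (a \<odot>\<^bsub>M\<^esub> x) = a \<odot>\<^bsub>N\<^esub> h x)}"

definition lmod_iso :: "('a, 'e) ring_scheme \<Rightarrow> ('a, 'b) module \<Rightarrow> ('a, 'c) module \<Rightarrow> bool" where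
  "lmod_iso R M N \<longleftrightarrow> (\<exists>h\<in>lmod_hom R M N. bij_betw h (carrier M) (carrier N))"

definition quot_module :: "('a, 'b) module \<Rightarrow> 'b set \<Rightarrow> ('a, 'b set) module" where
  "quot_module M U = \<lparr>carrier = a_rcosets\<^bsub>M\<^esub> U, monoid.mult = undefined, one = undefined,
     ring.zero = U, ring.add = set_add M, module.smult = (\<lambda>a Y. \<Union>x\<in>Y. U +>\<^bsub>M\<^esub> (a \<odot>\<^bsub>M\<^esub> x))\<rparr>"

definition simple_module :: "('a, 'e) ring_scheme \<Rightarrow> ('a, 'b) module \<Rightarrow> bool" where
  "simple_module R M \<longleftrightarrow> left_module R M \<and> carrier M \<noteq> {\<zero>\<^bsub>M\<^esub>} \<and>
     (\<forall>U. submodule U R M \<longrightarrow> U = {\<zero>\<^bsub>M\<^esub>} \<or> U = carrier M)"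

definition indecomposable_module :: "('a, 'e) ring_scheme \<Rightarrow> ('a, 'b) module \<Rightarrow> bool" where
  "indecomposable_module R M \<longleftrightarrow> left_module R M \<and> carrier M \<noteq> {\<zero>\<^bsub>M\<^esub>} \<and>
     (\<forall>U V. submodule U R M \<and> submodule V R M \<and> U \<inter> V = {\<zero>\<^bsub>M\<^esub>} \<and> U <+>\<^bsub>M\<^esub> V = carrier M
        \<longrightarrow> U = {\<zero>\<^bsub>M\<^esub>} \<or> V = {\<zero>\<^bsub>M\<^esub>})"

definition direct_sum :: "'i set \<Rightarrow> ('i \<Rightarrow> ('a, 'b) module) \<Rightarrow> ('a, 'i \<Rightarrow> 'b) module" where
  "direct_sum A M =
     \<lparr>carrier = {f \<in> \<Pi>\<^sub>E i\<in>A. carrier (M i). finite {i \<in> A. f i \<noteq> \<zero>\<^bsub>M i\<^esub>}},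
      monoid.mult = undefined, one = undefined,
      ring.zero = (\<lambda>i\<in>A. \<zero>\<^bsub>M i\<^esub>),
      ring.add = (\<lambda>f g. \<lambda>i\<in>A. f i \<oplus>\<^bsub>M i\<^esub> g i),
      module.smult = (\<lambda>a f. \<lambda>i\<in>A. a \<odot>\<^bsub>M i\<^esub> f i)\<rparr>"

definition regular_module :: "('a, 'e) ring_scheme \<Rightarrow> ('a, 'a) module" where
  "regular_module R = \<lparr>carrier = carrier R, monoid.mult = monoid.mult R, one = \<one>\<^bsub>R\<^esub>, ring.zero = \<zero>\<^bsub>R\<^esub>,
     ring.add = ring.add R, module.smult = monoid.mult R\<rparr>"

text \<open>
  Projective means direct summand of a free module. Bases are taken inside the type of elements
  of the module itself; this loses nothing, as a projective module is always a direct summand of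
  the free module on its own carrier.
\<close>

definition projective_module :: "('a, 'e) ring_scheme \<Rightarrow> ('a, 'b) module \<Rightarrow> bool" where
  "projective_module R M \<longleftrightarrow> left_module R M \<and>
     (\<exists>B :: 'b set. let F = direct_sum B (\<lambda>_. regular_module R) in
        \<exists>\<iota>\<in>lmod_hom R M F. \<exists>\<pi>\<in>lmod_hom R F M. \<forall>x\<in>carrier M. \<pi> (\<iota> x) = x)"

text \<open>
  \<open>is_S\<close> is the property singling out, up to isomorphism, the intended simple quotient.
  Uniqueness of the quotient is uniqueness of the submodule by which one divides.
\<close>

definition indec_projective_with_simple_quotient ::
  "('a, 'e) ring_scheme \<Rightarrow> (('a, 'b set) module \<Rightarrow> bool) \<Rightarrow> ('a, 'b) module \<Rightarrow> bool" where
  "indec_projective_with_simple_quotient R is_S M \<longleftrightarrow>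
     left_module R M \<and> projective_module R M \<and> indecomposable_module R M \<and>
     (\<exists>!U. submodule U R M \<and> simple_module R (quot_module M U)) \<and>
     (\<forall>U. submodule U R M \<and> simple_module R (quot_module M U) \<longrightarrow> is_S (quot_module M U))"

text \<open>
  For a subring \<open>A\<close> of \<open>R\<close> and a left \<open>A\<close>-module \<open>P\<close>, the tensor product of \<open>R\<close> and \<open>P\<close> over \<open>A\<close>
  is the free abelian group on the set of pairs \<open>(x, p)\<close>, divided by the usual relations; \<open>R\<close>
  acts by multiplication on the first component. Note that
  \<^const>\<open>free_Abelian_group\<close> is a multiplicatively written group whose operation is addition of
  finitely supported functions.
\<close>

definition tensor_relators ::
  "('a, 'e) ring_scheme \<Rightarrow> 'a set \<Rightarrow> ('a, 'b) module \<Rightarrow> ('a \<times> 'b \<Rightarrow>\<^sub>0 int) set" where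
  "tensor_relators R A P =
     {frag_of (x \<oplus>\<^bsub>R\<^esub> y, p) - frag_of (x, p) - frag_of (y, p) | x y p.
        x \<in> carrier R \<and> y \<in> carrier R \<and> p \<in> carrier P} \<union>
     {frag_of (x, p \<oplus>\<^bsub>P\<^esub> q) - frag_of (x, p) - frag_of (x, q) | x p q.
        x \<in> carrier R \<and> p \<in> carrier P \<and> q \<in> carrier P} \<union>
     {frag_of (x \<otimes>\<^bsub>R\<^esub> a, p) - frag_of (x, a \<odot>\<^bsub>P\<^esub> p) | x a p.
        x \<in> carrier R \<and> a \<in> A \<and> p \<in> carrier P}"

definition induced_module ::
  "('a, 'e) ring_scheme \<Rightarrow> 'a set \<Rightarrow> ('a, 'b) module \<Rightarrow> ('a, ('a \<times> 'b \<Rightarrow>\<^sub>0 int) set) module" where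
  "induced_module R A P =
     (let F = free_Abelian_group (carrier R \<times> carrier P);
          N = generate F (tensor_relators R A P)
      in \<lparr>carrier = rcosets\<^bsub>F\<^esub> N, monoid.mult = undefined, one = undefined,
          ring.zero = N, ring.add = set_mult F,
          module.smult = (\<lambda>h Y. \<Union>f\<in>Y. N #>\<^bsub>F\<^esub> frag_extend (\<lambda>(x, p). frag_of (h \<otimes>\<^bsub>R\<^esub> x, p)) f)\<rparr>)"


section \<open>The 0-Ariki-Koike-Shoji algebra\<close>

text \<open>
  The free algebra is the monoid algebra (convolution product on finitely supported functions)
  of the free monoid of words in the generators. A separate type of words carries the monoid
  structure, written additively because \<^typ>\<open>'a \<Rightarrow>\<^sub>0 'b\<close> convolves along addition.
\<close>

datatype gen = GenT nat | GenXi nat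

datatype word = Word "gen list"

instantiation word :: monoid_add
begin

definition zero_word :: word where "zero_word = Word []"

fun plus_word :: "word \<Rightarrow> word \<Rightarrow> word" where
  "plus_word (Word v) (Word w) = Word (v @ w)"

instance
proof
  fix a b c :: word
  show "a + b + c = a + (b + c)" by (cases a; cases b; cases c) simp
  show "0 + a = a" "a + 0 = a" by (cases a; simp add: zero_word_def)+
qed

end

type_synonym free_elem = "word \<Rightarrow>\<^sub>0 complex"
type_synonym aks_elem = "free_elem set"

definition T :: "nat \<Rightarrow> free_elem" where "T i = Poly_Mapping.single (Word [GenT i]) 1"
definition \<Xi> :: "nat \<Rightarrow> free_elem" where "\<Xi> j = Poly_Mapping.single (Word [GenXi j]) 1"
definition scal :: "complex \<Rightarrow> free_elem" where "scal z = Poly_Mapping.single 0 z"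

definition gens :: "nat \<Rightarrow> gen set" where
  "gens n = GenT ` {1..<n} \<union> GenXi ` {1..n}"

definition free_alg :: "nat \<Rightarrow> free_elem ring" where
  "free_alg n = \<lparr>carrier = {f. Poly_Mapping.keys f \<subseteq> Word ` lists (gens n)},
     monoid.mult = (*), one = 1, ring.zero = 0, ring.add = (+)\<rparr>"

definition lagrange :: "nat \<Rightarrow> (nat \<Rightarrow> complex) \<Rightarrow> nat \<Rightarrow> free_elem \<Rightarrow> free_elem" where
  "lagrange r u k x =
     (\<Prod>l\<leftarrow>filter (\<lambda>l. l \<noteq> k) [1..<Suc r]. scal (1 / (u k - u l)) * (x - scal (u l)))"

definition aks_relators :: "nat \<Rightarrow> nat \<Rightarrow> (nat \<Rightarrow> complex) \<Rightarrow> free_elem set" where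
  "aks_relators n r u =
     {T i * (T i + 1) | i. i \<in> {1..<n}} \<union>
     {T i * T (i+1) * T i - T (i+1) * T i * T (i+1) | i. i \<in> {1..<n} \<and> i + 1 \<in> {1..<n}} \<union>
     {T i * T j - T j * T i | i j. i \<in> {1..<n} \<and> j \<in> {1..<n} \<and> (i + 2 \<le> j \<or> j + 2 \<le> i)} \<union>
     {(\<Prod>l\<leftarrow>[1..<Suc r]. \<Xi> j - scal (u l)) | j. j \<in> {1..n}} \<union>
     {\<Xi> i * \<Xi> j - \<Xi> j * \<Xi> i | i j. i \<in> {1..n} \<and> j \<in> {1..n}} \<union>
     {T i * \<Xi> i - (\<Xi> (i+1) * T i +
        (\<Sum>(a, b)\<in>{(a, b). 1 \<le> a \<and> a < b \<and> b \<le> r}.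
           scal (u b - u a) * lagrange r u a (\<Xi> i) * lagrange r u b (\<Xi> (i+1)))) | i. i \<in> {1..<n}} \<union>
     {T i * (\<Xi> (i+1) + \<Xi> i) - (\<Xi> (i+1) + \<Xi> i) * T i | i. i \<in> {1..<n}} \<union>
     {T i * \<Xi> j - \<Xi> j * T i | i j. i \<in> {1..<n} \<and> j \<in> {1..n} \<and> j \<noteq> i \<and> j \<noteq> i + 1}"

definition aks_ideal :: "nat \<Rightarrow> nat \<Rightarrow> (nat \<Rightarrow> complex) \<Rightarrow> free_elem set" where
  "aks_ideal n r u = Idl\<^bsub>free_alg n\<^esub> (aks_relators n r u)"

definition AKS :: "nat \<Rightarrow> nat \<Rightarrow> (nat \<Rightarrow> complex) \<Rightarrow> aks_elem ring" where
  "AKS n r u = free_alg n Quot aks_ideal n r u"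

definition aks_class :: "nat \<Rightarrow> nat \<Rightarrow> (nat \<Rightarrow> complex) \<Rightarrow> free_elem \<Rightarrow> aks_elem" where
  "aks_class n r u f = aks_ideal n r u +>\<^bsub>free_alg n\<^esub> f"

text \<open>The scalars are included among the generators since the subalgebra is one over
  the complex numbers.\<close>

definition Hecke0 :: "nat \<Rightarrow> nat \<Rightarrow> (nat \<Rightarrow> complex) \<Rightarrow> aks_elem ring" where
  "Hecke0 n r u = (AKS n r u)
     \<lparr>carrier := generate_ring (AKS n r u)
        ((\<lambda>i. aks_class n r u (T i)) ` {1..<n} \<union> range (\<lambda>z. aks_class n r u (scal z)))\<rparr>"


section \<open>Compositions and colored ribbons\<close>

definition composition :: "nat \<Rightarrow> nat list \<Rightarrow> bool" where
  "composition n I \<longleftrightarrow> sum_list I = n \<and> (\<forall>i\<in>set I. i \<ge> 1)"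

definition Des :: "nat list \<Rightarrow> nat set" where
  "Des I = {sum_list (take k I) | k. 1 \<le> k \<and> k < length I}"

text \<open>The coloring \<open>c\<close> in \<open>C^n\<close> is an extensional function on the positions \<open>1, \<dots>, n\<close>.\<close>

type_synonym ribbon = "nat list \<times> (nat \<Rightarrow> nat)"

definition colored_ribbon :: "nat \<Rightarrow> nat \<Rightarrow> ribbon \<Rightarrow> bool" where
  "colored_ribbon n r = (\<lambda>(I, c). composition n I \<and> c \<in> {1..n} \<rightarrow>\<^sub>E {1..r})"

definition cycloribbon :: "nat \<Rightarrow> nat \<Rightarrow> ribbon \<Rightarrow> bool" where
  "cycloribbon n r = (\<lambda>(I, c). colored_ribbon n r (I, c) \<and>
     (\<forall>j\<in>{1..<n}. (j \<notin> Des I \<longrightarrow> c j \<le> c (j+1)) \<and> (j \<in> Des I \<longrightarrow> c j \<ge> c (j+1))))"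

definition anticycloribbon :: "nat \<Rightarrow> nat \<Rightarrow> ribbon \<Rightarrow> bool" where
  "anticycloribbon n r = (\<lambda>(I, c). colored_ribbon n r (I, c) \<and>
     (\<forall>j\<in>{1..<n}. (j \<notin> Des I \<longrightarrow> c j \<ge> c (j+1)) \<and> (j \<in> Des I \<longrightarrow> c j \<le> c (j+1))))"

definition phi :: "nat \<Rightarrow> ribbon \<Rightarrow> ribbon" where
  "phi n = (\<lambda>(I, c). (THE J. composition n J \<and>
     Des J = {j \<in> {1..<n}. j \<in> Des I \<and> c j = c (j+1)} \<union>
             {j \<in> {1..<n}. j \<notin> Des I \<and> c j \<noteq> c (j+1)}, c))"


section \<open>The simple and the indecomposable projective modules\<close>

text \<open>The next two notions are used both for the algebra and for its subalgebra; \<open>\<iota>\<close> is the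
  embedding of the scalars.\<close>

definition one_dimensional ::
  "('a, 'e) ring_scheme \<Rightarrow> (complex \<Rightarrow> 'a) \<Rightarrow> ('a, 'b) module \<Rightarrow> bool" where
  "one_dimensional R \<iota> M \<longleftrightarrow> left_module R M \<and>
     (\<exists>v\<in>carrier M. v \<noteq> \<zero>\<^bsub>M\<^esub> \<and> carrier M = {\<iota> z \<odot>\<^bsub>M\<^esub> v | z. True})"

definition acts_by :: "(complex \<Rightarrow> 'a) \<Rightarrow> ('a, 'b) module \<Rightarrow> 'a \<Rightarrow> complex \<Rightarrow> bool" where
  "acts_by \<iota> M a z \<longleftrightarrow> (\<forall>x\<in>carrier M. a \<odot>\<^bsub>M\<^esub> x = \<iota> z \<odot>\<^bsub>M\<^esub> x)"

definition is_simple_Hecke0 ::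
  "nat \<Rightarrow> nat \<Rightarrow> (nat \<Rightarrow> complex) \<Rightarrow> nat list \<Rightarrow> (aks_elem, 'b) module \<Rightarrow> bool" where
  "is_simple_Hecke0 n r u I M \<longleftrightarrow>
     (let \<iota> = \<lambda>z. aks_class n r u (scal z) in
        one_dimensional (Hecke0 n r u) \<iota> M \<and>
        (\<forall>i\<in>{1..<n}. acts_by \<iota> M (aks_class n r u (T i)) (if i \<in> Des I then - 1 else 0)))"

definition is_P_Hecke0 ::
  "nat \<Rightarrow> nat \<Rightarrow> (nat \<Rightarrow> complex) \<Rightarrow> nat list \<Rightarrow> (aks_elem, 'b) module \<Rightarrow> bool" where
  "is_P_Hecke0 n r u I =
     indec_projective_with_simple_quotient (Hecke0 n r u) (is_simple_Hecke0 n r u I)"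

definition is_simple_AKS ::
  "nat \<Rightarrow> nat \<Rightarrow> (nat \<Rightarrow> complex) \<Rightarrow> ribbon \<Rightarrow> (aks_elem, 'b) module \<Rightarrow> bool" where
  "is_simple_AKS n r u R M \<longleftrightarrow>
     (let \<iota> = \<lambda>z. aks_class n r u (scal z) in
        one_dimensional (AKS n r u) \<iota> M \<and>
        (\<forall>j\<in>{1..n}. acts_by \<iota> M (aks_class n r u (\<Xi> j)) (u (snd R j))) \<and>
        (\<forall>i\<in>{1..<n}. acts_by \<iota> M (aks_class n r u (T i))
           (if i \<in> Des (fst (phi n R)) then - 1 else 0)))"

definition is_P_AKS ::
  "nat \<Rightarrow> nat \<Rightarrow> (nat \<Rightarrow> complex) \<Rightarrow> ribbon \<Rightarrow> (aks_elem, 'b) module \<Rightarrow> bool" where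
  "is_P_AKS n r u K =
     indec_projective_with_simple_quotient (AKS n r u) (is_simple_AKS n r u (phi n K))"


section \<open>The presentation is well formed\<close>

lemma free_alg_mult_closed:
  assumes "f \<in> carrier (free_alg n)" "g \<in> carrier (free_alg n)"
  shows "f * g \<in> carrier (free_alg n)"
proof -
  let ?W = "Word ` lists (gens n)"
  have plus: "a + b \<in> ?W" if "a \<in> ?W" "b \<in> ?W" for a b
    using that by (auto intro!: image_eqI)
  have "Poly_Mapping.keys (f * g) \<subseteq> ?W"
  proof
    fix w assume "w \<in> Poly_Mapping.keys (f * g)"
    then obtain a b where ab: "w = a + b" "a \<in> Poly_Mapping.keys f" "b \<in> Poly_Mapping.keys g"
      using keys_mult[of f g] by auto
    then have "a \<in> ?W" "b \<in> ?W"
      using assms unfolding free_alg_def by auto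
    then show "w \<in> ?W"
      unfolding ab(1) by (rule plus)
  qed
  then show ?thesis
    by (simp add: free_alg_def)
qed

lemma free_alg_add_closed:
  assumes "f \<in> carrier (free_alg n)" "g \<in> carrier (free_alg n)"
  shows "f + g \<in> carrier (free_alg n)" "f - g \<in> carrier (free_alg n)"
  using assms Poly_Mapping.keys_add[of f g] keys_diff[of f g] by (auto simp: free_alg_def)

lemma free_alg_basic:
  "1 \<in> carrier (free_alg n)" "0 \<in> carrier (free_alg n)" "scal z \<in> carrier (free_alg n)"
  "i \<in> {1..<n} \<Longrightarrow> T i \<in> carrier (free_alg n)"
  "j \<in> {1..n} \<Longrightarrow> \<Xi> j \<in> carrier (free_alg n)"
  by (auto simp: free_alg_def T_def \<Xi>_def scal_def zero_word_def gens_def)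

lemma ring_free_alg: "ring (free_alg n)"
proof (rule ringI)
  show "abelian_group (free_alg n)"
  proof (rule abelian_groupI)
    fix f assume "f \<in> carrier (free_alg n)"
    then show "\<exists>g\<in>carrier (free_alg n). g \<oplus>\<^bsub>free_alg n\<^esub> f = \<zero>\<^bsub>free_alg n\<^esub>"
      by (intro bexI[of _ "- f"]) (auto simp: free_alg_def)
  next
    fix f g assume "f \<in> carrier (free_alg n)" "g \<in> carrier (free_alg n)"
    then show "f \<oplus>\<^bsub>free_alg n\<^esub> g \<in> carrier (free_alg n)"
      using free_alg_add_closed(1) by (simp add: free_alg_def)
  next
    show "\<zero>\<^bsub>free_alg n\<^esub> \<in> carrier (free_alg n)"
      by (simp add: free_alg_def)
  qed (simp_all add: free_alg_def ac_simps)
  show "Group.monoid (free_alg n)"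
  proof (rule Group.monoidI)
    fix f g assume "f \<in> carrier (free_alg n)" "g \<in> carrier (free_alg n)"
    then show "f \<otimes>\<^bsub>free_alg n\<^esub> g \<in> carrier (free_alg n)"
      using free_alg_mult_closed by (simp add: free_alg_def)
  next
    show "\<one>\<^bsub>free_alg n\<^esub> \<in> carrier (free_alg n)"
      using free_alg_basic(1) by (simp add: free_alg_def)
  qed (simp_all add: free_alg_def mult.assoc)
qed (simp_all add: free_alg_def distrib_left distrib_right)

lemma free_alg_prod_list:
  "(\<And>x. x \<in> set xs \<Longrightarrow> f x \<in> carrier (free_alg n)) \<Longrightarrow>
    (\<Prod>x\<leftarrow>xs. f x) \<in> carrier (free_alg n)"
  by (induction xs) (auto intro: free_alg_mult_closed free_alg_basic)

lemma free_alg_sum: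
  "(\<And>x. x \<in> A \<Longrightarrow> f x \<in> carrier (free_alg n)) \<Longrightarrow> sum f A \<in> carrier (free_alg n)"
  by (induction A rule: infinite_finite_induct) (auto intro: free_alg_add_closed free_alg_basic)

lemma aks_relators_closed: "aks_relators n r u \<subseteq> carrier (free_alg n)"
proof -
  note closed = free_alg_mult_closed free_alg_add_closed free_alg_basic free_alg_prod_list
    free_alg_sum
  have lag: "lagrange r u k x \<in> carrier (free_alg n)" if "x \<in> carrier (free_alg n)" for k x
    using that unfolding lagrange_def by (intro closed)
  show ?thesis
    unfolding aks_relators_def by (auto intro!: closed lag simp del: One_nat_def)
qed

lemma ring_AKS: "ring (AKS n r u)"
  unfolding AKS_def aks_ideal_def
  by (intro ideal.quotient_is_ring ring.genideal_ideal ring_free_alg aks_relators_closed)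

end

theory Submission
  imports Defs
begin

text \<open>
  Call an additive map from a module to the complex numbers a weight functional for \<open>(D, c)\<close> if
  \<open>T\<^sub>i\<close> acts on it by \<open>-1\<close> or \<open>0\<close>, according to whether \<open>i \<in> D\<close>, and \<open>\<xi>\<^sub>j\<close> by \<open>u (c j)\<close>. The
  key fact is a Nakayama lemma: every proper submodule of a module over the
  algebra is killed by a nonzero weight functional, for some \<open>(D, c)\<close> that is an anticycloribbon.
  Indeed, on a functional of \<open>\<xi>\<close>-weight \<open>c\<close> put \<open>\<tau>\<^sub>i = T\<^sub>i + [c\<^sub>i < c\<^sub>i\<^sub>+\<^sub>1]\<close>. The \<open>\<tau>\<^sub>i\<close> permute the weight
  spaces, satisfy the braid relations exactly, and \<open>\<tau>\<^sub>i\<tau>\<^sub>i\<close> is \<open>-\<tau>\<^sub>i\<close> or \<open>0\<close>. Hence applying a normal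
  word of maximal length that does not kill all weight vectors produces a joint eigenvector.

  A projective module with a unique simple quotient has, up to scalars, only one weight functional.
  For \<open>P\<close> it has descent set \<open>Des I\<close>; so the weight functionals of the induced module \<open>N\<close> are, up to
  scalars, one for each anticycloribbon of shape \<open>I\<close>, exactly as for the direct sum. Lifting them
  through the projective modules \<open>P\<close> and \<open>Q K\<close> gives maps \<open>f\<close> from \<open>N\<close> to the direct sum and \<open>s\<close> back
  with \<open>f s = 1\<close>; both are onto by the Nakayama lemma, as they match the weight functionals.
\<close>

section \<open>Left modules and their homomorphisms\<close>

text \<open>Everything takes place in the dual, where the algebra acts from the right by
  \<open>(\<theta> a) x = \<theta> (a x)\<close>. A proper submodule of a module of arbitrary
  dimension is separated from a vector by Zorn's lemma; the finiteness needed afterwards comes from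
  the words, since only finitely many are normal.

  The constant in \<open>\<tau>_i\<close> comes from the relation for \<open>T_i \<xi>_i\<close>: on
  weight \<open>c\<close>, Lagrange interpolation leaves of the sum over \<open>a < b\<close> only
  the pair \<open>(c_i, c_(i+1))\<close>, which occurs in the sum just when
  \<open>c_i < c_(i+1)\<close>. The constant absorbs this term. Conversely \<open>T_i\<close> is
  \<open>\<tau>_i\<close> minus the constant, and where the two colors differ the final eigenvector
  is killed by \<open>\<tau>_i\<close>. So a strict rise of the colors forces a descent, a strict
  fall forbids one, and equal colors leave both possible: this is the anticycloribbon condition.

  The two maps have different roles: \<open>f\<close> must be onto before the inclusions of the
  summands can be lifted through it to give \<open>s\<close>. Then \<open>f s = 1\<close>, together
  with \<open>s\<close> being onto, makes \<open>f\<close> injective.\<close>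

lemma left_moduleD:
  assumes "left_module R M"
  shows "ring R" "abelian_group M"
  using assms by (auto simp: left_module_def)

context left_module
begin

lemma smult_r_null: "a \<in> carrier R \<Longrightarrow> a \<odot>\<^bsub>M\<^esub> \<zero>\<^bsub>M\<^esub> = \<zero>\<^bsub>M\<^esub>"
  using smult_r_distr[of a "\<zero>\<^bsub>M\<^esub>" "\<zero>\<^bsub>M\<^esub>"] M.add.l_cancel_one[of "a \<odot>\<^bsub>M\<^esub> \<zero>\<^bsub>M\<^esub>" "a \<odot>\<^bsub>M\<^esub> \<zero>\<^bsub>M\<^esub>"]
  by simp

lemma smult_l_null: "x \<in> carrier M \<Longrightarrow> \<zero> \<odot>\<^bsub>M\<^esub> x = \<zero>\<^bsub>M\<^esub>"
  using smult_l_distr[of "\<zero>" "\<zero>" x] M.add.l_cancel_one[of "\<zero> \<odot>\<^bsub>M\<^esub> x" "\<zero> \<odot>\<^bsub>M\<^esub> x"]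
  by simp

lemma smult_l_minus:
  assumes "a \<in> carrier R" "x \<in> carrier M"
  shows "(\<ominus> a) \<odot>\<^bsub>M\<^esub> x = \<ominus>\<^bsub>M\<^esub> (a \<odot>\<^bsub>M\<^esub> x)"
proof -
  have "(\<ominus> a) \<odot>\<^bsub>M\<^esub> x \<oplus>\<^bsub>M\<^esub> a \<odot>\<^bsub>M\<^esub> x = \<zero>\<^bsub>M\<^esub>"
    using assms smult_l_distr[of "\<ominus> a" a x] by (simp add: R.l_neg smult_l_null)
  then show ?thesis using assms by (metis M.minus_equality R.a_inv_closed smult_closed)
qed

lemma smult_r_minus:
  assumes "a \<in> carrier R" "x \<in> carrier M"
  shows "a \<odot>\<^bsub>M\<^esub> (\<ominus>\<^bsub>M\<^esub> x) = \<ominus>\<^bsub>M\<^esub> (a \<odot>\<^bsub>M\<^esub> x)"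
proof -
  have "a \<odot>\<^bsub>M\<^esub> (\<ominus>\<^bsub>M\<^esub> x) \<oplus>\<^bsub>M\<^esub> a \<odot>\<^bsub>M\<^esub> x = \<zero>\<^bsub>M\<^esub>"
    using assms smult_r_distr[of a "\<ominus>\<^bsub>M\<^esub> x" x] by (simp add: M.l_neg smult_r_null)
  then show ?thesis using assms by (metis M.minus_equality M.a_inv_closed smult_closed)
qed

lemma submoduleI:
  assumes "U \<subseteq> carrier M" "\<zero>\<^bsub>M\<^esub> \<in> U"
    and add: "\<And>x y. x \<in> U \<Longrightarrow> y \<in> U \<Longrightarrow> x \<oplus>\<^bsub>M\<^esub> y \<in> U"
    and smult: "\<And>a x. a \<in> carrier R \<Longrightarrow> x \<in> U \<Longrightarrow> a \<odot>\<^bsub>M\<^esub> x \<in> U"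
  shows "submodule U R M"
proof -
  have "\<ominus>\<^bsub>M\<^esub> x \<in> U" if "x \<in> U" for x
  proof -
    have "(\<ominus> \<one>) \<odot>\<^bsub>M\<^esub> x \<in> U" using that smult by blast
    moreover have "x \<in> carrier M" using that assms by blast
    ultimately show ?thesis by (simp add: smult_l_minus)
  qed
  then show ?thesis
    using assms
    by (intro submodule.intro M.add.subgroupI submodule_axioms.intro) (auto simp: a_inv_def)
qed

lemma submoduleD:
  assumes "submodule U R M"
  shows "U \<subseteq> carrier M" "\<zero>\<^bsub>M\<^esub> \<in> U"
    "\<And>x y. x \<in> U \<Longrightarrow> y \<in> U \<Longrightarrow> x \<oplus>\<^bsub>M\<^esub> y \<in> U"
    "\<And>x. x \<in> U \<Longrightarrow> \<ominus>\<^bsub>M\<^esub> x \<in> U"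
    "\<And>a x. a \<in> carrier R \<Longrightarrow> x \<in> U \<Longrightarrow> a \<odot>\<^bsub>M\<^esub> x \<in> U"
proof -
  interpret submodule U R M by fact
  show "U \<subseteq> carrier M" "\<zero>\<^bsub>M\<^esub> \<in> U"
    "\<And>x y. x \<in> U \<Longrightarrow> y \<in> U \<Longrightarrow> x \<oplus>\<^bsub>M\<^esub> y \<in> U"
    "\<And>x. x \<in> U \<Longrightarrow> \<ominus>\<^bsub>M\<^esub> x \<in> U"
    "\<And>a x. a \<in> carrier R \<Longrightarrow> x \<in> U \<Longrightarrow> a \<odot>\<^bsub>M\<^esub> x \<in> U"
    using subset one_closed m_closed m_inv_closed by (auto simp: a_inv_def)
qed

lemma left_module_restrict:
  assumes "subring H R"
  shows "left_module (R\<lparr>carrier := H\<rparr>) M"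
proof -
  have "H \<subseteq> carrier R" using assms by (simp add: subringE(1))
  moreover have "ring (R\<lparr>carrier := H\<rparr>)"
    using assms R.subring_is_ring by blast
  ultimately show ?thesis
    by (intro left_module.intro left_module_axioms.intro M.abelian_group_axioms)
      (auto intro: smult_l_distr smult_r_distr smult_assoc1)
qed

end

lemma left_moduleI:
  assumes "ring R" "abelian_group M"
    and "\<And>a x. a \<in> carrier R \<Longrightarrow> x \<in> carrier M \<Longrightarrow> a \<odot>\<^bsub>M\<^esub> x \<in> carrier M"
    and "\<And>a b x. a \<in> carrier R \<Longrightarrow> b \<in> carrier R \<Longrightarrow> x \<in> carrier M \<Longrightarrow>
        (a \<oplus>\<^bsub>R\<^esub> b) \<odot>\<^bsub>M\<^esub> x = a \<odot>\<^bsub>M\<^esub> x \<oplus>\<^bsub>M\<^esub> b \<odot>\<^bsub>M\<^esub> x"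
    and "\<And>a x y. a \<in> carrier R \<Longrightarrow> x \<in> carrier M \<Longrightarrow> y \<in> carrier M \<Longrightarrow>
        a \<odot>\<^bsub>M\<^esub> (x \<oplus>\<^bsub>M\<^esub> y) = a \<odot>\<^bsub>M\<^esub> x \<oplus>\<^bsub>M\<^esub> a \<odot>\<^bsub>M\<^esub> y"
    and "\<And>a b x. a \<in> carrier R \<Longrightarrow> b \<in> carrier R \<Longrightarrow> x \<in> carrier M \<Longrightarrow>
        (a \<otimes>\<^bsub>R\<^esub> b) \<odot>\<^bsub>M\<^esub> x = a \<odot>\<^bsub>M\<^esub> (b \<odot>\<^bsub>M\<^esub> x)"
    and "\<And>x. x \<in> carrier M \<Longrightarrow> \<one>\<^bsub>R\<^esub> \<odot>\<^bsub>M\<^esub> x = x"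
  shows "left_module R M"
  using assms by (simp add: left_module_def left_module_axioms_def)

lemma lmod_homD:
  assumes "h \<in> lmod_hom R M N"
  shows "\<And>x. x \<in> carrier M \<Longrightarrow> h x \<in> carrier N"
    and "\<And>x y. x \<in> carrier M \<Longrightarrow> y \<in> carrier M \<Longrightarrow> h (x \<oplus>\<^bsub>M\<^esub> y) = h x \<oplus>\<^bsub>N\<^esub> h y"
    and "\<And>a x. a \<in> carrier R \<Longrightarrow> x \<in> carrier M \<Longrightarrow> h (a \<odot>\<^bsub>M\<^esub> x) = a \<odot>\<^bsub>N\<^esub> h x"
  using assms by (auto simp: lmod_hom_def)

lemma lmod_hom_zero:
  assumes "h \<in> lmod_hom R M N" "left_module R M" "left_module R N"
  shows "h \<zero>\<^bsub>M\<^esub> = \<zero>\<^bsub>N\<^esub>"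
proof -
  interpret M: left_module R M by fact
  interpret N: left_module R N by fact
  have "h \<zero>\<^bsub>M\<^esub> = h \<zero>\<^bsub>M\<^esub> \<oplus>\<^bsub>N\<^esub> h \<zero>\<^bsub>M\<^esub>"
    using lmod_homD(2)[OF assms(1), of "\<zero>\<^bsub>M\<^esub>" "\<zero>\<^bsub>M\<^esub>"] by simp
  then show ?thesis using lmod_homD(1)[OF assms(1)] by (metis M.M.zero_closed N.M.add.l_cancel_one')
qed

lemma lmod_hom_comp:
  assumes "g \<in> lmod_hom R M N" "h \<in> lmod_hom R N L"
  shows "(\<lambda>x. h (g x)) \<in> lmod_hom R M L"
  using lmod_homD[OF assms(1)] lmod_homD[OF assms(2)] by (auto simp: lmod_hom_def)

lemma lmod_hom_image_submodule:
  assumes "h \<in> lmod_hom R M N" "left_module R M" "left_module R N"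
  shows "submodule (h ` carrier M) R N"
proof -
  interpret M: left_module R M by fact
  interpret N: left_module R N by fact
  note h = lmod_homD[OF assms(1)]
  show ?thesis
  proof (rule N.submoduleI)
    show "\<zero>\<^bsub>N\<^esub> \<in> h ` carrier M"
      using lmod_hom_zero[OF assms] by (metis M.M.zero_closed imageI)
    fix x y assume "x \<in> h ` carrier M" "y \<in> h ` carrier M"
    then show "x \<oplus>\<^bsub>N\<^esub> y \<in> h ` carrier M"
      using h(2) by (auto simp flip: h(2))
  next
    fix a x assume "a \<in> carrier R" "x \<in> h ` carrier M"
    then show "a \<odot>\<^bsub>N\<^esub> x \<in> h ` carrier M"
      by (auto simp flip: h(3))
  qed (use h in auto)
qed

lemma left_module_regular:
  assumes "ring R"
  shows "left_module R (regular_module R)"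
proof -
  interpret ring R by fact
  have "abelian_group (regular_module R)"
    by (rule abelian_groupI) (auto simp: regular_module_def a_ac intro!: bexI[of _ "\<ominus>\<^bsub>R\<^esub> _"] l_neg)
  then show ?thesis
    by (intro left_moduleI ring_axioms) (auto simp: regular_module_def l_distr r_distr m_assoc)
qed

section \<open>Direct sums of left modules and their universal property\<close>

lemma carrier_direct_sum:
  "f \<in> carrier (direct_sum A M) \<longleftrightarrow>
    f \<in> (\<Pi>\<^sub>E i\<in>A. carrier (M i)) \<and> finite {i \<in> A. f i \<noteq> \<zero>\<^bsub>M i\<^esub>}"
  by (simp add: direct_sum_def)

lemma direct_sum_simps:
  "\<zero>\<^bsub>direct_sum A M\<^esub> = (\<lambda>i\<in>A. \<zero>\<^bsub>M i\<^esub>)"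
  "f \<oplus>\<^bsub>direct_sum A M\<^esub> g = (\<lambda>i\<in>A. f i \<oplus>\<^bsub>M i\<^esub> g i)"
  "a \<odot>\<^bsub>direct_sum A M\<^esub> f = (\<lambda>i\<in>A. a \<odot>\<^bsub>M i\<^esub> f i)"
  by (simp_all add: direct_sum_def)

lemma left_module_direct_sum:
  assumes "ring R" and "\<And>i. i \<in> A \<Longrightarrow> left_module R (M i)"
  shows "left_module R (direct_sum A M)"
proof -
  let ?S = "direct_sum A M"
  have M: "abelian_group (M i)" if "i \<in> A" for i
    using left_moduleD[OF assms(2)[OF that]] by simp
  note agr = abelian_groupE[OF M]
  have add: "f \<oplus>\<^bsub>?S\<^esub> g \<in> carrier ?S" if "f \<in> carrier ?S" "g \<in> carrier ?S" for f g
  proof -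
    have "{i \<in> A. f i \<oplus>\<^bsub>M i\<^esub> g i \<noteq> \<zero>\<^bsub>M i\<^esub>} \<subseteq> {i \<in> A. f i \<noteq> \<zero>\<^bsub>M i\<^esub>} \<union> {i \<in> A. g i \<noteq> \<zero>\<^bsub>M i\<^esub>}"
      using agr(2,5) by auto
    then have "finite {i \<in> A. f i \<oplus>\<^bsub>M i\<^esub> g i \<noteq> \<zero>\<^bsub>M i\<^esub>}"
      using that by (auto simp: carrier_direct_sum intro: finite_subset)
    moreover have "{i \<in> A. (f \<oplus>\<^bsub>?S\<^esub> g) i \<noteq> \<zero>\<^bsub>M i\<^esub>} = {i \<in> A. f i \<oplus>\<^bsub>M i\<^esub> g i \<noteq> \<zero>\<^bsub>M i\<^esub>}"
      by (auto simp: direct_sum_simps)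
    moreover have "(f \<oplus>\<^bsub>?S\<^esub> g) \<in> (\<Pi>\<^sub>E i\<in>A. carrier (M i))"
      using that agr(1) by (auto simp: carrier_direct_sum direct_sum_simps PiE_def Pi_def)
    ultimately show ?thesis by (simp add: carrier_direct_sum)
  qed
  have smult: "a \<odot>\<^bsub>?S\<^esub> f \<in> carrier ?S" if "f \<in> carrier ?S" "a \<in> carrier R" for f a
  proof -
    have "{i \<in> A. (a \<odot>\<^bsub>?S\<^esub> f) i \<noteq> \<zero>\<^bsub>M i\<^esub>} \<subseteq> {i \<in> A. f i \<noteq> \<zero>\<^bsub>M i\<^esub>}"
      using left_module.smult_r_null[OF assms(2)] that by (auto simp: direct_sum_simps)
    then have "finite {i \<in> A. (a \<odot>\<^bsub>?S\<^esub> f) i \<noteq> \<zero>\<^bsub>M i\<^esub>}"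
      using that by (auto simp: carrier_direct_sum intro: finite_subset)
    then show ?thesis
      using left_module.smult_closed[OF assms(2)] that by (auto simp: carrier_direct_sum direct_sum_simps)
  qed
  have neg: "(\<lambda>i\<in>A. \<ominus>\<^bsub>M i\<^esub> f i) \<in> carrier ?S" if "f \<in> carrier ?S" for f
  proof -
    have "{i \<in> A. (\<lambda>i\<in>A. \<ominus>\<^bsub>M i\<^esub> f i) i \<noteq> \<zero>\<^bsub>M i\<^esub>} \<subseteq> {i \<in> A. f i \<noteq> \<zero>\<^bsub>M i\<^esub>}"
      using abelian_group.minus_equality[OF M] agr(2,5) by auto
    then have "finite {i \<in> A. (\<lambda>i\<in>A. \<ominus>\<^bsub>M i\<^esub> f i) i \<noteq> \<zero>\<^bsub>M i\<^esub>}"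
      by (rule finite_subset) (use that in \<open>simp add: carrier_direct_sum\<close>)
    then show ?thesis
      using abelian_group.a_inv_closed[OF M] that by (auto simp: carrier_direct_sum)
  qed
  have mem: "f i \<in> carrier (M i)" if "f \<in> carrier ?S" "i \<in> A" for f i
    using that by (auto simp: carrier_direct_sum)
  have ext: "f = restrict f A" if "f \<in> carrier ?S" for f
    using that by (auto simp: carrier_direct_sum PiE_def extensional_restrict)
  have "abelian_group ?S"
  proof (rule abelian_groupI)
    show "\<zero>\<^bsub>?S\<^esub> \<in> carrier ?S"
      using agr(2) by (auto simp: carrier_direct_sum direct_sum_simps cong: conj_cong)
    fix f assume f: "f \<in> carrier ?S"
    show "\<exists>g\<in>carrier ?S. g \<oplus>\<^bsub>?S\<^esub> f = \<zero>\<^bsub>?S\<^esub>"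
      using neg[OF f] mem[OF f] abelian_group.l_neg[OF M]
      by (intro bexI[of _ "\<lambda>i\<in>A. \<ominus>\<^bsub>M i\<^esub> f i"]) (auto simp: direct_sum_simps intro!: restrict_ext)
    show "\<zero>\<^bsub>?S\<^esub> \<oplus>\<^bsub>?S\<^esub> f = f"
      by (subst (2) ext[OF f]) (auto simp: direct_sum_simps agr(5) mem[OF f] intro!: restrict_ext)
  next
    fix f g h assume "f \<in> carrier ?S" "g \<in> carrier ?S" "h \<in> carrier ?S"
    then show "f \<oplus>\<^bsub>?S\<^esub> g \<oplus>\<^bsub>?S\<^esub> h = f \<oplus>\<^bsub>?S\<^esub> (g \<oplus>\<^bsub>?S\<^esub> h)"
      using agr(3) mem by (auto simp: direct_sum_simps intro!: restrict_ext)
  next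
    fix f g assume "f \<in> carrier ?S" "g \<in> carrier ?S"
    then show "f \<oplus>\<^bsub>?S\<^esub> g = g \<oplus>\<^bsub>?S\<^esub> f"
      using agr(4) mem by (auto simp: direct_sum_simps intro!: restrict_ext)
  qed (rule add)
  then show ?thesis
  proof (intro left_moduleI assms)
    fix f assume f: "f \<in> carrier ?S"
    show "\<one>\<^bsub>R\<^esub> \<odot>\<^bsub>?S\<^esub> f = f"
      by (subst (2) ext[OF f])
        (auto simp: direct_sum_simps left_module.smult_one[OF assms(2)] mem[OF f] intro!: restrict_ext)
  qed (use smult mem in \<open>auto simp: direct_sum_simps left_module.smult_l_distr[OF assms(2)]
      left_module.smult_r_distr[OF assms(2)] left_module.smult_assoc1[OF assms(2)] intro!: restrict_ext\<close>)
qed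

definition direct_sum_inj :: "'i set \<Rightarrow> ('i \<Rightarrow> ('a, 'b) module) \<Rightarrow> 'i \<Rightarrow> 'b \<Rightarrow> 'i \<Rightarrow> 'b" where
  "direct_sum_inj A M i x = (\<lambda>j\<in>A. if j = i then x else \<zero>\<^bsub>M j\<^esub>)"

context
  fixes R :: "('a, 'e) ring_scheme" and A :: "'i set" and M :: "'i \<Rightarrow> ('a, 'b) module"
  assumes M: "\<And>i. i \<in> A \<Longrightarrow> left_module R (M i)" and R: "ring R"
begin

lemma direct_sum_inj_hom:
  assumes "i \<in> A"
  shows "direct_sum_inj A M i \<in> lmod_hom R (M i) (direct_sum A M)"
proof -
  have ab: "abelian_group (M j)" if "j \<in> A" for j
    using left_moduleD[OF M[OF that]] by simp
  have "finite {j \<in> A. direct_sum_inj A M i x j \<noteq> \<zero>\<^bsub>M j\<^esub>}" for x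
    by (rule finite_subset[of _ "{i}"]) (auto simp: direct_sum_inj_def)
  then have "direct_sum_inj A M i x \<in> carrier (direct_sum A M)" if "x \<in> carrier (M i)" for x
    using that abelian_groupE(2)[OF ab] by (auto simp: carrier_direct_sum direct_sum_inj_def)
  then show ?thesis
    using abelian_groupE(2,5)[OF ab] left_module.smult_r_null[OF M] assms
    by (auto simp: lmod_hom_def direct_sum_inj_def direct_sum_simps intro!: restrict_ext)
qed

lemma direct_sum_proj_hom:
  assumes "i \<in> A"
  shows "(\<lambda>f. f i) \<in> lmod_hom R (direct_sum A M) (M i)"
  using assms by (auto simp: lmod_hom_def carrier_direct_sum direct_sum_simps)

text \<open>Elements have finite support, so splitting off one nonzero component at a time ends at
  zero; the induction is on the size of the support.\<close>

lemma direct_sum_induct [consumes 1, case_names zero add]: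
  assumes "f \<in> carrier (direct_sum A M)"
    and zero: "P \<zero>\<^bsub>direct_sum A M\<^esub>"
    and add: "\<And>i x g. i \<in> A \<Longrightarrow> x \<in> carrier (M i) \<Longrightarrow> g \<in> carrier (direct_sum A M) \<Longrightarrow> P g \<Longrightarrow>
        P (direct_sum_inj A M i x \<oplus>\<^bsub>direct_sum A M\<^esub> g)"
  shows "P f"
  using assms(1)
proof (induction "card {i \<in> A. f i \<noteq> \<zero>\<^bsub>M i\<^esub>}" arbitrary: f)
  case 0
  then have "f i = \<zero>\<^bsub>M i\<^esub>" if "i \<in> A" for i
    using that by (auto simp: carrier_direct_sum)
  then have "f = \<zero>\<^bsub>direct_sum A M\<^esub>"
    using 0 by (auto simp: direct_sum_simps carrier_direct_sum PiE_def extensional_def)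
  then show ?case using zero by simp
next
  case (Suc k)
  have ab: "abelian_group (M j)" if "j \<in> A" for j
    using left_moduleD[OF M[OF that]] by simp
  from Suc.hyps(2) obtain i where i: "i \<in> A" "f i \<noteq> \<zero>\<^bsub>M i\<^esub>"
    by (metis (mono_tags, lifting) Collect_empty_eq card.empty nat.distinct(1))
  define g where "g = (\<lambda>j\<in>A. if j = i then \<zero>\<^bsub>M i\<^esub> else f j)"
  have supp: "{j \<in> A. g j \<noteq> \<zero>\<^bsub>M j\<^esub>} = {j \<in> A. f j \<noteq> \<zero>\<^bsub>M j\<^esub>} - {i}"
    by (auto simp: g_def)
  have fin: "finite {j \<in> A. f j \<noteq> \<zero>\<^bsub>M j\<^esub>}" using Suc.prems by (simp add: carrier_direct_sum)
  have g: "g \<in> carrier (direct_sum A M)"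
    using Suc.prems i fin abelian_groupE(2)[OF ab] unfolding carrier_direct_sum supp by (auto simp: g_def)
  have "k = card {j \<in> A. g j \<noteq> \<zero>\<^bsub>M j\<^esub>}"
    using Suc.hyps(2) i fin unfolding supp by simp
  then have "P (direct_sum_inj A M i (f i) \<oplus>\<^bsub>direct_sum A M\<^esub> g)"
    using Suc.hyps(1) g Suc.prems i by (intro add) (auto simp: carrier_direct_sum)
  moreover have "direct_sum_inj A M i (f i) \<oplus>\<^bsub>direct_sum A M\<^esub> g = f"
    using Suc.prems abelian_groupE(5)[OF ab] abelian_monoid.r_zero[OF abelian_group.axioms(1)[OF ab]]
    by (auto simp: fun_eq_iff direct_sum_simps direct_sum_inj_def g_def carrier_direct_sum PiE_def extensional_def Pi_def)
  ultimately show ?case by simp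
qed

lemma direct_sum_hom_eqI:
  assumes L: "left_module R L"
    and h: "h \<in> lmod_hom R (direct_sum A M) L" "h' \<in> lmod_hom R (direct_sum A M) L"
    and eq: "\<And>i x. i \<in> A \<Longrightarrow> x \<in> carrier (M i) \<Longrightarrow> h (direct_sum_inj A M i x) = h' (direct_sum_inj A M i x)"
    and f: "f \<in> carrier (direct_sum A M)"
  shows "h f = h' f"
  using f
proof (induction rule: direct_sum_induct)
  case zero
  show ?case
    using lmod_hom_zero[OF h(1)] lmod_hom_zero[OF h(2)] left_module_direct_sum[OF R, of A M] M L by simp
next
  case (add i x g)
  then show ?case
    using lmod_homD(2)[OF h(1)] lmod_homD(2)[OF h(2)] lmod_homD(1)[OF direct_sum_inj_hom] eq by simp
qed

lemma direct_sum_universal: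
  assumes L: "left_module R L" and g: "\<And>i. i \<in> A \<Longrightarrow> g i \<in> lmod_hom R (M i) L"
  obtains h where "h \<in> lmod_hom R (direct_sum A M) L"
    "\<And>i x. i \<in> A \<Longrightarrow> x \<in> carrier (M i) \<Longrightarrow> h (direct_sum_inj A M i x) = g i x"
proof
  interpret L: left_module R L by fact
  let ?S = "direct_sum A M"
  \<comment> \<open>The index set may be infinite, as it is for the bases of free modules.
    \<open>gfinprod\<close> in the additive monoid sums over the support only, which is finite
    because each \<open>g i\<close> sends zero to zero.\<close>
  define h where "h f = gfinprod (add_monoid L) (\<lambda>i. g i (f i)) A" for f
  have mem: "(\<lambda>i. g i (f i)) \<in> A \<rightarrow> carrier L" if "f \<in> carrier ?S" for f
    using that lmod_homD(1)[OF g] by (auto simp: carrier_direct_sum)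
  have fin: "finite {i \<in> A. g i (f i) \<noteq> \<zero>\<^bsub>L\<^esub>}" if "f \<in> carrier ?S" for f
  proof (rule finite_subset)
    show "{i \<in> A. g i (f i) \<noteq> \<zero>\<^bsub>L\<^esub>} \<subseteq> {i \<in> A. f i \<noteq> \<zero>\<^bsub>M i\<^esub>}"
      using lmod_hom_zero[OF g M L] by auto
  qed (use that in \<open>simp add: carrier_direct_sum\<close>)
  have closed: "h f \<in> carrier L" if "f \<in> carrier ?S" for f
    unfolding h_def using L.M.add.gfinprod_closed[of "\<lambda>i. g i (f i)" A] mem[OF that] by simp
  have h_add: "h (f \<oplus>\<^bsub>?S\<^esub> f') = h f \<oplus>\<^bsub>L\<^esub> h f'" if f: "f \<in> carrier ?S" "f' \<in> carrier ?S" for f f'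
  proof -
    have "h (f \<oplus>\<^bsub>?S\<^esub> f') = gfinprod (add_monoid L) (\<lambda>i. g i (f i) \<oplus>\<^bsub>L\<^esub> g i (f' i)) A"
      unfolding h_def using mem[OF f(1)] mem[OF f(2)] f lmod_homD(2)[OF g]
      by (intro L.M.add.gfinprod_cong)
        (auto simp: direct_sum_simps carrier_direct_sum simp_implies_def PiE_def Pi_def)
    also have "\<dots> = h f \<oplus>\<^bsub>L\<^esub> h f'"
      unfolding h_def
      using L.M.add.gfinprod_distrib[of A "\<lambda>i. g i (f i)" "\<lambda>i. g i (f' i)"] mem fin f by simp
    finally show ?thesis .
  qed
  show inj: "h (direct_sum_inj A M i x) = g i x" if "i \<in> A" "x \<in> carrier (M i)" for i x
  proof -
    have gi: "g i x \<in> carrier L" using that lmod_homD(1)[OF g] by blast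
    have "h (direct_sum_inj A M i x) = gfinprod (add_monoid L) (\<lambda>j. g i x) {i}"
      unfolding h_def
      using that lmod_hom_zero[OF g M L] mem[of "direct_sum_inj A M i x"]
        lmod_homD(1)[OF direct_sum_inj_hom[OF that(1)] that(2)]
      by (intro L.M.add.gfinprod_mono_neutral_cong_right) (auto simp: direct_sum_inj_def)
    also have "\<dots> = g i x"
      using L.M.add.gfinprod_insert[of "{}" "\<lambda>_. g i x" i] gi L.M.add.gfinprod_eq_finprod[of "{}" "\<lambda>_. g i x"] by simp
    finally show ?thesis .
  qed
  have "h (a \<odot>\<^bsub>?S\<^esub> f) = a \<odot>\<^bsub>L\<^esub> h f" if a: "a \<in> carrier R" and f: "f \<in> carrier ?S" for a f
    using f
  proof (induction rule: direct_sum_induct)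
    case zero
    interpret S: left_module R ?S using left_module_direct_sum[OF R, of A M] M by blast
    have "h \<zero>\<^bsub>?S\<^esub> \<oplus>\<^bsub>L\<^esub> h \<zero>\<^bsub>?S\<^esub> = h \<zero>\<^bsub>?S\<^esub>"
      using h_add[of "\<zero>\<^bsub>?S\<^esub>" "\<zero>\<^bsub>?S\<^esub>"] by simp
    then have "h \<zero>\<^bsub>?S\<^esub> = \<zero>\<^bsub>L\<^esub>" using closed[OF S.M.zero_closed] by simp
    then show ?case using S.smult_r_null L.smult_r_null a by simp
  next
    case (add i x f)
    interpret S: left_module R ?S using left_module_direct_sum[OF R, of A M] M by blast
    interpret Mi: left_module R "M i" using M add by blast
    note i = direct_sum_inj_hom[OF \<open>i \<in> A\<close>]
    have "h (a \<odot>\<^bsub>?S\<^esub> (direct_sum_inj A M i x \<oplus>\<^bsub>?S\<^esub> f))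
        = h (direct_sum_inj A M i (a \<odot>\<^bsub>M i\<^esub> x) \<oplus>\<^bsub>?S\<^esub> a \<odot>\<^bsub>?S\<^esub> f)"
      using a add lmod_homD[OF i] by (simp add: S.smult_r_distr)
    also have "\<dots> = h (direct_sum_inj A M i (a \<odot>\<^bsub>M i\<^esub> x)) \<oplus>\<^bsub>L\<^esub> h (a \<odot>\<^bsub>?S\<^esub> f)"
      using a add lmod_homD(1)[OF i] by (intro h_add) auto
    also have "\<dots> = a \<odot>\<^bsub>L\<^esub> g i x \<oplus>\<^bsub>L\<^esub> a \<odot>\<^bsub>L\<^esub> h f"
      using a add inj[OF \<open>i \<in> A\<close>] lmod_homD(3)[OF g[OF \<open>i \<in> A\<close>]] by simp
    also have "\<dots> = a \<odot>\<^bsub>L\<^esub> h (direct_sum_inj A M i x \<oplus>\<^bsub>?S\<^esub> f)"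
      using a add inj lmod_homD(1)[OF i] lmod_homD(1)[OF g[OF \<open>i \<in> A\<close>]] closed
      by (simp add: L.smult_r_distr h_add)
    finally show ?case .
  qed
  then show "h \<in> lmod_hom R ?S L"
    using h_add closed by (simp add: lmod_hom_def)
qed

end

text \<open>\<open>P\<close> is a retract of a free module by \<open>\<iota>\<close> and
  \<open>\<pi>\<close>, so it is enough to lift \<open>k\<close> after \<open>\<pi>\<close>: choose
  a preimage \<open>l b\<close> under \<open>h\<close> for the image of each basis vector
  \<open>e b\<close>, extend freely to \<open>G\<close>, and restrict \<open>G\<close> along
  \<open>\<iota>\<close>.\<close>

lemma projective_lift:
  fixes P :: "('a, 'b) module"
  assumes P: "projective_module R P" and L: "left_module R L"
    and h: "h \<in> lmod_hom R L L'" "h ` carrier L = carrier L'" and L': "left_module R L'"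
    and k: "k \<in> lmod_hom R P L'"
  obtains g where "g \<in> lmod_hom R P L" "\<And>x. x \<in> carrier P \<Longrightarrow> h (g x) = k x"
proof -
  let ?F = "\<lambda>B. direct_sum B (\<lambda>_. regular_module R)"
  have lP: "left_module R P" using P by (simp add: projective_module_def)
  then interpret P: left_module R P .
  interpret L: left_module R L by fact
  interpret L': left_module R L' by fact
  have reg: "left_module R (regular_module R)" using left_module_regular P.R.ring_axioms .
  have "\<exists>B :: 'b set. \<exists>\<iota>\<in>lmod_hom R P (?F B). \<exists>\<pi>\<in>lmod_hom R (?F B) P. \<forall>x\<in>carrier P. \<pi> (\<iota> x) = x"
    using P by (simp add: projective_module_def Let_def)
  then obtain B :: "'b set" and \<iota> \<pi> where \<iota>: "\<iota> \<in> lmod_hom R P (?F B)" and \<pi>: "\<pi> \<in> lmod_hom R (?F B) P"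
    and "\<forall>x\<in>carrier P. \<pi> (\<iota> x) = x"
    by (elim exE bexE)
  then have id: "\<And>x. x \<in> carrier P \<Longrightarrow> \<pi> (\<iota> x) = x" by blast
  define e where "e b = direct_sum_inj B (\<lambda>_. regular_module R) b \<one>\<^bsub>R\<^esub>" for b
  note inj = direct_sum_inj_hom[OF reg P.R.ring_axioms]
  have one: "\<one>\<^bsub>R\<^esub> \<in> carrier (regular_module R)" by (simp add: regular_module_def)
  have "\<exists>l\<in>carrier L. h l = k (\<pi> (e b))" if "b \<in> B" for b
  proof -
    have "e b \<in> carrier (?F B)"
      unfolding e_def using lmod_homD(1)[OF inj[OF that] one] .
    then have "k (\<pi> (e b)) \<in> carrier L'"
      using lmod_homD(1)[OF \<pi>] lmod_homD(1)[OF k] by blast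
    then show ?thesis using h(2) by (metis imageE)
  qed
  then obtain l where l: "\<And>b. b \<in> B \<Longrightarrow> l b \<in> carrier L" "\<And>b. b \<in> B \<Longrightarrow> h (l b) = k (\<pi> (e b))"
    by metis
  have "(\<lambda>a. a \<odot>\<^bsub>L\<^esub> l b) \<in> lmod_hom R (regular_module R) L" if "b \<in> B" for b
    using l(1)[OF that] L.smult_l_distr L.smult_assoc1 by (auto simp: lmod_hom_def regular_module_def)
  then obtain G where G: "G \<in> lmod_hom R (?F B) L"
    "\<And>b a. b \<in> B \<Longrightarrow> a \<in> carrier R \<Longrightarrow> G (direct_sum_inj B (\<lambda>_. regular_module R) b a) = a \<odot>\<^bsub>L\<^esub> l b"
    using direct_sum_universal[OF reg P.R.ring_axioms L, of B "\<lambda>b a. a \<odot>\<^bsub>L\<^esub> l b"]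
    by (auto simp: regular_module_def)
  have scale: "direct_sum_inj B (\<lambda>_. regular_module R) b a = a \<odot>\<^bsub>?F B\<^esub> e b"
    if "b \<in> B" "a \<in> carrier R" for b a
    using lmod_homD(3)[OF inj[OF that(1)] that(2) one] that by (simp add: e_def regular_module_def)
  have e: "e b \<in> carrier (?F B)" if "b \<in> B" for b
    unfolding e_def using lmod_homD(1)[OF inj[OF that] one] .
  have "h (G f) = k (\<pi> f)" if "f \<in> carrier (?F B)" for f
  proof (rule direct_sum_hom_eqI[OF reg P.R.ring_axioms L' _ _ _ that])
    fix b a assume b: "b \<in> B" and "a \<in> carrier (regular_module R)"
    then have a: "a \<in> carrier R" by (simp add: regular_module_def)
    show "h (G (direct_sum_inj B (\<lambda>_. regular_module R) b a)) = k (\<pi> (direct_sum_inj B (\<lambda>_. regular_module R) b a))"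
      using a b l G(2) lmod_homD(3)[OF h(1)] lmod_homD[OF \<pi>] lmod_homD(3)[OF k] e
      by (simp add: scale[symmetric]) (simp add: scale)
  qed (use lmod_hom_comp[OF G(1) h(1)] lmod_hom_comp[OF \<pi> k] in auto)
  then have "h (G (\<iota> x)) = k x" if "x \<in> carrier P" for x
    using lmod_homD(1)[OF \<iota> that] id[OF that] by simp
  then show ?thesis using that lmod_hom_comp[OF \<iota> G(1)] by blast
qed

section \<open>Cosets and quotient modules\<close>

context left_module
begin

lemma abelian_subgroup_submodule:
  assumes "submodule U R M"
  shows "abelian_subgroup U M"
  using assms by (intro abelian_subgroupI3 additive_subgroupI M.abelian_group_axioms) (simp add: submodule_def)

end

lemma (in left_module) coset_eq_self_iff:
  assumes U: "submodule U R M" and x: "x \<in> carrier M"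
  shows "U +>\<^bsub>M\<^esub> x = U \<longleftrightarrow> x \<in> U"
proof -
  interpret abelian_subgroup U M using abelian_subgroup_submodule[OF U] .
  show ?thesis using a_rcos_self[OF x] a_rcos_const by metis
qed

lemma (in left_module) coset_eq_iff:
  assumes U: "submodule U R M" and "x \<in> carrier M" "y \<in> carrier M"
  shows "U +>\<^bsub>M\<^esub> x = U +>\<^bsub>M\<^esub> y \<longleftrightarrow> x \<ominus>\<^bsub>M\<^esub> y \<in> U"
proof -
  interpret abelian_subgroup U M using abelian_subgroup_submodule[OF U] .
  show ?thesis
    using a_rcos_module[of y x] assms a_rcos_self[of x] M.a_repr_independence[OF _ _ a_subgroup]
    by (metis M.minus_eq)
qed

lemma quot_module_simps:
  "carrier (quot_module M U) = A_RCOSETS M U" "\<zero>\<^bsub>quot_module M U\<^esub> = U"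
  "ring.add (quot_module M U) = set_add M"
  by (simp_all add: quot_module_def)

lemma quot_module_carrierE:
  assumes "S \<in> carrier (quot_module M U)"
  obtains x where "x \<in> carrier M" "S = U +>\<^bsub>M\<^esub> x"
  using assms by (auto simp: quot_module_simps A_RCOSETS_def')

lemma coset_in_quot:
  "x \<in> carrier M \<Longrightarrow> U +>\<^bsub>M\<^esub> x \<in> carrier (quot_module M U)"
  by (auto simp: quot_module_simps A_RCOSETS_def')

context
  fixes R :: "('a, 'e) ring_scheme" and M :: "('a, 'b) module"
  assumes M: "left_module R M"
begin

interpretation left_module R M by (rule M)

text \<open>The action on the quotient is defined as a union over all representatives. All members
  of this union are the same coset, and the union is not empty because a coset contains its
  representative.\<close>

lemma quot_module_smult:
  assumes U: "submodule U R M" and a: "a \<in> carrier R" and x: "x \<in> carrier M"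
  shows "a \<odot>\<^bsub>quot_module M U\<^esub> (U +>\<^bsub>M\<^esub> x) = U +>\<^bsub>M\<^esub> (a \<odot>\<^bsub>M\<^esub> x)"
proof -
  interpret abelian_subgroup U M using abelian_subgroup_submodule[OF U] .
  have "U +>\<^bsub>M\<^esub> (a \<odot>\<^bsub>M\<^esub> y) = U +>\<^bsub>M\<^esub> (a \<odot>\<^bsub>M\<^esub> x)" if y: "y \<in> U +>\<^bsub>M\<^esub> x" for y
  proof -
    obtain w where w: "w \<in> U" "y = w \<oplus>\<^bsub>M\<^esub> x" using y by (auto simp: a_r_coset_def')
    then have wc: "w \<in> carrier M" using a_Hcarr by blast
    then have "a \<odot>\<^bsub>M\<^esub> y = a \<odot>\<^bsub>M\<^esub> w \<oplus>\<^bsub>M\<^esub> a \<odot>\<^bsub>M\<^esub> x"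
      using w a x by (simp add: smult_r_distr)
    then have "a \<odot>\<^bsub>M\<^esub> y \<in> U +>\<^bsub>M\<^esub> (a \<odot>\<^bsub>M\<^esub> x)"
      using submoduleD(5)[OF U a w(1)] by (auto simp: a_r_coset_def')
    then show ?thesis using M.a_repr_independence[OF _ _ a_subgroup] a x by simp
  qed
  then have "(\<Union>y\<in>U +>\<^bsub>M\<^esub> x. U +>\<^bsub>M\<^esub> (a \<odot>\<^bsub>M\<^esub> y)) = (\<Union>y\<in>U +>\<^bsub>M\<^esub> x. U +>\<^bsub>M\<^esub> (a \<odot>\<^bsub>M\<^esub> x))"
    by (rule SUP_cong[OF refl])
  moreover have "U +>\<^bsub>M\<^esub> x \<noteq> {}" using a_rcos_self[OF x] by blast
  ultimately show ?thesis by (simp add: quot_module_def)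
qed

lemma quot_module_add:
  assumes U: "submodule U R M" and "x \<in> carrier M" "y \<in> carrier M"
  shows "(U +>\<^bsub>M\<^esub> x) \<oplus>\<^bsub>quot_module M U\<^esub> (U +>\<^bsub>M\<^esub> y) = U +>\<^bsub>M\<^esub> (x \<oplus>\<^bsub>M\<^esub> y)"
  using abelian_subgroup.a_rcos_sum[OF abelian_subgroup_submodule[OF U]] assms
  by (simp add: quot_module_simps)

lemma left_module_quot:
  assumes U: "submodule U R M"
  shows "left_module R (quot_module M U)"
proof -
  let ?Q = "quot_module M U"
  interpret abelian_subgroup U M using abelian_subgroup_submodule[OF U] .
  note add = quot_module_add[OF U] and smult = quot_module_smult[OF U]
  have zero: "U +>\<^bsub>M\<^esub> \<zero>\<^bsub>M\<^esub> = \<zero>\<^bsub>?Q\<^esub>"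
    using coset_eq_self_iff[OF U] by (simp add: quot_module_simps)
  have "abelian_group ?Q"
  proof (rule abelian_groupI)
    fix S Y assume "S \<in> carrier ?Q" "Y \<in> carrier ?Q"
    then show "S \<oplus>\<^bsub>?Q\<^esub> Y \<in> carrier ?Q"
      by (elim quot_module_carrierE) (simp add: add coset_in_quot)
  next
    show "\<zero>\<^bsub>?Q\<^esub> \<in> carrier ?Q" unfolding zero[symmetric] by (simp add: coset_in_quot)
  next
    fix S Y Z assume "S \<in> carrier ?Q" "Y \<in> carrier ?Q" "Z \<in> carrier ?Q"
    then show "S \<oplus>\<^bsub>?Q\<^esub> Y \<oplus>\<^bsub>?Q\<^esub> Z = S \<oplus>\<^bsub>?Q\<^esub> (Y \<oplus>\<^bsub>?Q\<^esub> Z)"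
      by (elim quot_module_carrierE) (simp add: add M.a_assoc)
  next
    fix S Y assume "S \<in> carrier ?Q" "Y \<in> carrier ?Q"
    then show "S \<oplus>\<^bsub>?Q\<^esub> Y = Y \<oplus>\<^bsub>?Q\<^esub> S"
      by (elim quot_module_carrierE) (simp add: add M.a_comm)
  next
    fix S assume "S \<in> carrier ?Q"
    then show "\<zero>\<^bsub>?Q\<^esub> \<oplus>\<^bsub>?Q\<^esub> S = S"
      by (elim quot_module_carrierE) (simp add: add zero[symmetric])
  next
    fix S assume "S \<in> carrier ?Q"
    then obtain x where x: "x \<in> carrier M" "S = U +>\<^bsub>M\<^esub> x" by (rule quot_module_carrierE)
    then show "\<exists>Y\<in>carrier ?Q. Y \<oplus>\<^bsub>?Q\<^esub> S = \<zero>\<^bsub>?Q\<^esub>"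
      by (intro bexI[of _ "U +>\<^bsub>M\<^esub> (\<ominus>\<^bsub>M\<^esub> x)"]) (simp_all add: add zero coset_in_quot M.l_neg)
  qed
  then show ?thesis
    by (intro left_moduleI R.ring_axioms)
      (auto elim!: quot_module_carrierE simp: smult add coset_in_quot
         smult_l_distr smult_r_distr smult_assoc1)
qed

end

section \<open>Functionals\<close>

text \<open>Complex scalars act through elements of the ring, so linearity is an eigenvalue
  condition for these elements; it is imposed through \<open>E\<close> or through
  \<open>linear_functional\<close>.\<close>

definition additive_functional :: "('a, 'b) module \<Rightarrow> ('b \<Rightarrow> complex) \<Rightarrow> bool" where
  "additive_functional M \<theta> \<longleftrightarrow>
    (\<forall>x\<in>carrier M. \<forall>y\<in>carrier M. \<theta> (x \<oplus>\<^bsub>M\<^esub> y) = \<theta> x + \<theta> y)"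

text \<open>\<open>E a z\<close> says that \<open>a\<close> is to act by \<open>z\<close>; only generators of the ring need to be listed.\<close>

definition eigen_functional :: "('a \<Rightarrow> complex \<Rightarrow> bool) \<Rightarrow> ('a, 'b) module \<Rightarrow> ('b \<Rightarrow> complex) \<Rightarrow> bool" where
  "eigen_functional E M \<theta> \<longleftrightarrow> additive_functional M \<theta> \<and>
    (\<forall>a z. E a z \<longrightarrow> (\<forall>x\<in>carrier M. \<theta> (a \<odot>\<^bsub>M\<^esub> x) = z * \<theta> x))"

lemma additive_functionalD:
  assumes "additive_functional M \<theta>" "abelian_group M"
  shows "\<And>x y. x \<in> carrier M \<Longrightarrow> y \<in> carrier M \<Longrightarrow> \<theta> (x \<oplus>\<^bsub>M\<^esub> y) = \<theta> x + \<theta> y"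
    and "\<theta> \<zero>\<^bsub>M\<^esub> = 0"
    and "\<And>x. x \<in> carrier M \<Longrightarrow> \<theta> (\<ominus>\<^bsub>M\<^esub> x) = - \<theta> x"
    and "\<And>x y. x \<in> carrier M \<Longrightarrow> y \<in> carrier M \<Longrightarrow> \<theta> (x \<ominus>\<^bsub>M\<^esub> y) = \<theta> x - \<theta> y"
proof -
  interpret M: abelian_group M by fact
  show add: "\<And>x y. x \<in> carrier M \<Longrightarrow> y \<in> carrier M \<Longrightarrow> \<theta> (x \<oplus>\<^bsub>M\<^esub> y) = \<theta> x + \<theta> y"
    using assms(1) by (simp add: additive_functional_def)
  show zero: "\<theta> \<zero>\<^bsub>M\<^esub> = 0"
    using add[of "\<zero>\<^bsub>M\<^esub>" "\<zero>\<^bsub>M\<^esub>"] by simp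
  show neg: "\<theta> (\<ominus>\<^bsub>M\<^esub> x) = - \<theta> x" if "x \<in> carrier M" for x
    using add[of "\<ominus>\<^bsub>M\<^esub> x" x] that zero by (simp add: M.l_neg eq_neg_iff_add_eq_0)
  show "\<And>x y. x \<in> carrier M \<Longrightarrow> y \<in> carrier M \<Longrightarrow> \<theta> (x \<ominus>\<^bsub>M\<^esub> y) = \<theta> x - \<theta> y"
    using add neg by (simp add: M.minus_eq)
qed

text \<open>The elements that act by one and the same scalar on both functionals are closed under
  the ring operations. Two modules are treated at once so that the scalar is common to them, as
  \<open>projective_lift_functional\<close> requires.\<close>

lemma eigen_functional_generate:
  assumes "left_module R M" "left_module R N" and G: "G \<subseteq> carrier R"
    and \<theta>: "eigen_functional E M \<theta>" and \<eta>: "eigen_functional E N \<eta>"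
    and E: "\<And>a. a \<in> G \<Longrightarrow> \<exists>z. E a z"
    and a: "a \<in> generate_ring R G"
  shows "\<exists>z. (\<forall>x\<in>carrier M. \<theta> (a \<odot>\<^bsub>M\<^esub> x) = z * \<theta> x) \<and> (\<forall>x\<in>carrier N. \<eta> (a \<odot>\<^bsub>N\<^esub> x) = z * \<eta> x)"
proof -
  interpret M: left_module R M by fact
  interpret N: left_module R N by fact
  note add = additive_functionalD[OF _ M.M.abelian_group_axioms, of \<theta>] additive_functionalD[OF _ N.M.abelian_group_axioms, of \<eta>]
  have af: "additive_functional M \<theta>" "additive_functional N \<eta>"
    using \<theta> \<eta> by (auto simp: eigen_functional_def)
  note car = M.R.generate_ring_in_carrier[OF G]
  from a show ?thesis
  proof (induction rule: generate_ring.induct)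
    case one
    show ?case by (intro exI[of _ 1]) simp
  next
    case (incl h)
    then obtain z where "E h z" using E by blast
    then show ?case using \<theta> \<eta> by (intro exI[of _ z]) (simp add: eigen_functional_def)
  next
    case (a_inv h)
    then obtain z where z: "\<forall>x\<in>carrier M. \<theta> (h \<odot>\<^bsub>M\<^esub> x) = z * \<theta> x" "\<forall>x\<in>carrier N. \<eta> (h \<odot>\<^bsub>N\<^esub> x) = z * \<eta> x"
      by blast
    then show ?case
      using car[OF a_inv.hyps] add af by (intro exI[of _ "- z"]) (simp add: M.smult_l_minus N.smult_l_minus)
  next
    case (eng_add h1 h2)
    then obtain z w where "\<forall>x\<in>carrier M. \<theta> (h1 \<odot>\<^bsub>M\<^esub> x) = z * \<theta> x" "\<forall>x\<in>carrier N. \<eta> (h1 \<odot>\<^bsub>N\<^esub> x) = z * \<eta> x"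
      "\<forall>x\<in>carrier M. \<theta> (h2 \<odot>\<^bsub>M\<^esub> x) = w * \<theta> x" "\<forall>x\<in>carrier N. \<eta> (h2 \<odot>\<^bsub>N\<^esub> x) = w * \<eta> x"
      by blast
    then show ?case
      using car[OF eng_add.hyps(1)] car[OF eng_add.hyps(2)] add af
      by (intro exI[of _ "z + w"]) (simp add: M.smult_l_distr N.smult_l_distr algebra_simps)
  next
    case (eng_mult h1 h2)
    then obtain z w where "\<forall>x\<in>carrier M. \<theta> (h1 \<odot>\<^bsub>M\<^esub> x) = z * \<theta> x" "\<forall>x\<in>carrier N. \<eta> (h1 \<odot>\<^bsub>N\<^esub> x) = z * \<eta> x"
      "\<forall>x\<in>carrier M. \<theta> (h2 \<odot>\<^bsub>M\<^esub> x) = w * \<theta> x" "\<forall>x\<in>carrier N. \<eta> (h2 \<odot>\<^bsub>N\<^esub> x) = w * \<eta> x"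
      by blast
    then show ?case
      using car[OF eng_mult.hyps(1)] car[OF eng_mult.hyps(2)]
      by (intro exI[of _ "z * w"]) (simp add: M.smult_assoc1 N.smult_assoc1)
  qed
qed

lemma eigen_functional_comp:
  assumes "h \<in> lmod_hom R M N" "eigen_functional E N \<theta>" "\<And>a z. E a z \<Longrightarrow> a \<in> carrier R"
  shows "eigen_functional E M (\<lambda>x. \<theta> (h x))"
  using lmod_homD[OF assms(1)] assms(2,3)
  by (auto simp: eigen_functional_def additive_functional_def)

lemma eigen_functional_lincomb:
  assumes "eigen_functional E M \<theta>" "eigen_functional E M \<eta>"
  shows "eigen_functional E M (\<lambda>x. \<theta> x - z * \<eta> x)"
  using assms by (auto simp: eigen_functional_def additive_functional_def algebra_simps)

text \<open>By \<open>all\<close>, a vector \<open>y\<close> with \<open>\<theta> y\<close> nonzero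
  can be moved by the ring to a vector of any prescribed value. One nonzero coset therefore
  generates all cosets, and a nonzero submodule of the quotient is the whole quotient.\<close>

lemma simple_quot_kernel:
  assumes M: "left_module R M" and \<theta>: "additive_functional M \<theta>"
    and eig: "\<And>a. a \<in> carrier R \<Longrightarrow> \<exists>z. \<forall>x\<in>carrier M. \<theta> (a \<odot>\<^bsub>M\<^esub> x) = z * \<theta> x"
    and all: "\<And>z. \<exists>a\<in>carrier R. \<forall>x\<in>carrier M. \<theta> (a \<odot>\<^bsub>M\<^esub> x) = z * \<theta> x"
    and nz: "\<exists>x\<in>carrier M. \<theta> x \<noteq> 0"
  shows "submodule {x \<in> carrier M. \<theta> x = 0} R M"
    and "simple_module R (quot_module M {x \<in> carrier M. \<theta> x = 0})"
proof -
  interpret M: left_module R M by fact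
  note add = additive_functionalD[OF \<theta> M.M.abelian_group_axioms]
  let ?U = "{x \<in> carrier M. \<theta> x = 0}"
  show U: "submodule ?U R M"
  proof (rule M.submoduleI)
    fix a x assume "a \<in> carrier R" "x \<in> ?U"
    then show "a \<odot>\<^bsub>M\<^esub> x \<in> ?U" using eig[of a] by fastforce
  qed (use add in auto)
  let ?Q = "quot_module M ?U"
  interpret Q: left_module R ?Q using left_module_quot[OF M U] .
  from nz obtain x where x: "x \<in> carrier M" "\<theta> x \<noteq> 0" by blast
  have "?U +>\<^bsub>M\<^esub> x \<noteq> ?U" using M.coset_eq_self_iff[OF U x(1)] x(2) by simp
  then have "carrier ?Q \<noteq> {\<zero>\<^bsub>?Q\<^esub>}"
    using coset_in_quot[OF x(1), of ?U] by (auto simp: quot_module_simps)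
  moreover have "V = {\<zero>\<^bsub>?Q\<^esub>} \<or> V = carrier ?Q" if V: "submodule V R ?Q" for V
  proof (rule disjCI)
    assume "V \<noteq> carrier ?Q"
    note VD = Q.submoduleD[OF V]
    have "Y = \<zero>\<^bsub>?Q\<^esub>" if Y: "Y \<in> V" for Y
    proof (rule ccontr)
      assume "Y \<noteq> \<zero>\<^bsub>?Q\<^esub>"
      obtain y where y: "y \<in> carrier M" "Y = ?U +>\<^bsub>M\<^esub> y"
        using quot_module_carrierE Y VD(1) by blast
      then have ny: "\<theta> y \<noteq> 0"
        using \<open>Y \<noteq> _\<close> M.coset_eq_self_iff[OF U y(1)] by (auto simp: quot_module_simps)
      have "carrier ?Q \<subseteq> V"
      proof
        fix W assume "W \<in> carrier ?Q"
        then obtain w where w: "w \<in> carrier M" "W = ?U +>\<^bsub>M\<^esub> w" by (rule quot_module_carrierE)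
        obtain a where a: "a \<in> carrier R" "\<forall>x\<in>carrier M. \<theta> (a \<odot>\<^bsub>M\<^esub> x) = (\<theta> w / \<theta> y) * \<theta> x"
          using all by blast
        have "W = a \<odot>\<^bsub>?Q\<^esub> Y"
          using quot_module_smult[OF M U a(1) y(1)] M.coset_eq_iff[OF U w(1), of "a \<odot>\<^bsub>M\<^esub> y"]
            a y w ny add(4) by simp
        then show "W \<in> V" using VD(5)[OF a(1) Y] by simp
      qed
      then show False using \<open>V \<noteq> carrier ?Q\<close> VD(1) by blast
    qed
    then show "V = {\<zero>\<^bsub>?Q\<^esub>}" using VD(2) by blast
  qed
  ultimately show "simple_module R ?Q"
    using Q.left_module_axioms by (simp add: simple_module_def)
qed

text \<open>\<open>\<theta> x\<close> is the coordinate of the coset of \<open>x\<close> with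
  respect to a spanning vector \<open>v\<close>. The coordinate is unique because a nonzero scalar
  killing \<open>v\<close> could be inverted, which would make \<open>v\<close> zero.\<close>

lemma functional_of_one_dimensional_quot:
  assumes M: "left_module R M" and U: "submodule U R M"
    and one: "one_dimensional R \<iota> (quot_module M U)"
    and \<iota>: "\<And>z. \<iota> z \<in> carrier R" "\<And>z w. \<iota> (z + w) = \<iota> z \<oplus>\<^bsub>R\<^esub> \<iota> w"
      "\<And>z w. \<iota> (z * w) = \<iota> z \<otimes>\<^bsub>R\<^esub> \<iota> w" "\<iota> 1 = \<one>\<^bsub>R\<^esub>"
  obtains \<theta> where "additive_functional M \<theta>" "\<And>x. x \<in> carrier M \<Longrightarrow> \<theta> x = 0 \<longleftrightarrow> x \<in> U"
    "\<exists>x\<in>carrier M. \<theta> x = 1"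
    "\<And>a z x. acts_by \<iota> (quot_module M U) a z \<Longrightarrow> a \<in> carrier R \<Longrightarrow> x \<in> carrier M \<Longrightarrow> \<theta> (a \<odot>\<^bsub>M\<^esub> x) = z * \<theta> x"
proof -
  interpret M: left_module R M by fact
  let ?Q = "quot_module M U"
  interpret Q: left_module R ?Q using left_module_quot[OF M U] .
  obtain v where v: "v \<in> carrier ?Q" "v \<noteq> \<zero>\<^bsub>?Q\<^esub>" "carrier ?Q = {\<iota> z \<odot>\<^bsub>?Q\<^esub> v | z. True}"
    using one by (auto simp: one_dimensional_def)
  have inj: "z = w" if "\<iota> z \<odot>\<^bsub>?Q\<^esub> v = \<iota> w \<odot>\<^bsub>?Q\<^esub> v" for z w
  proof (rule ccontr)
    assume "z \<noteq> w"
    have "\<iota> (z - w) \<odot>\<^bsub>?Q\<^esub> v \<oplus>\<^bsub>?Q\<^esub> \<iota> w \<odot>\<^bsub>?Q\<^esub> v = \<iota> z \<odot>\<^bsub>?Q\<^esub> v"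
      using Q.smult_l_distr[OF \<iota>(1)[of "z - w"] \<iota>(1)[of w] v(1)] \<iota>(2)[of "z - w" w] by simp
    then have "\<iota> (z - w) \<odot>\<^bsub>?Q\<^esub> v = \<zero>\<^bsub>?Q\<^esub>"
      using that Q.smult_closed[OF \<iota>(1) v(1)] Q.M.add.r_cancel_one by metis
    then have "\<iota> (1 / (z - w)) \<odot>\<^bsub>?Q\<^esub> (\<iota> (z - w) \<odot>\<^bsub>?Q\<^esub> v) = \<zero>\<^bsub>?Q\<^esub>"
      using \<iota>(1) by (simp add: Q.smult_r_null)
    then have "v = \<zero>\<^bsub>?Q\<^esub>"
      using \<open>z \<noteq> w\<close> Q.smult_assoc1[OF \<iota>(1) \<iota>(1) v(1), of "1 / (z - w)" "z - w"]
        \<iota>(3)[of "1 / (z - w)" "z - w"] \<iota>(4) Q.smult_one[OF v(1)]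
      by (simp del: Q.smult_one)
    then show False using v(2) by simp
  qed
  define \<theta> where "\<theta> x = (THE z. U +>\<^bsub>M\<^esub> x = \<iota> z \<odot>\<^bsub>?Q\<^esub> v)" for x
  have ex: "\<exists>z. U +>\<^bsub>M\<^esub> x = \<iota> z \<odot>\<^bsub>?Q\<^esub> v" if "x \<in> carrier M" for x
    using coset_in_quot[OF that, of U] v(3) by auto
  have \<theta>: "U +>\<^bsub>M\<^esub> x = \<iota> (\<theta> x) \<odot>\<^bsub>?Q\<^esub> v" if "x \<in> carrier M" for x
    unfolding \<theta>_def by (rule theI') (use ex[OF that] inj in metis)
  have \<theta>I: "\<theta> x = z" if "x \<in> carrier M" "U +>\<^bsub>M\<^esub> x = \<iota> z \<odot>\<^bsub>?Q\<^esub> v" for x z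
    using inj[of "\<theta> x" z] \<theta>[OF that(1)] that(2) by simp
  show thesis
  proof (rule that)
    show "additive_functional M \<theta>"
      unfolding additive_functional_def
    proof (intro ballI \<theta>I)
      fix x y assume xy: "x \<in> carrier M" "y \<in> carrier M"
      show "x \<oplus>\<^bsub>M\<^esub> y \<in> carrier M" using xy by simp
      show "U +>\<^bsub>M\<^esub> (x \<oplus>\<^bsub>M\<^esub> y) = \<iota> (\<theta> x + \<theta> y) \<odot>\<^bsub>?Q\<^esub> v"
        using quot_module_add[OF M U xy] \<theta>[OF xy(1)] \<theta>[OF xy(2)] Q.smult_l_distr[OF \<iota>(1) \<iota>(1) v(1)]
        by (simp add: \<iota>(2))
    qed
    have zero: "\<iota> 0 \<odot>\<^bsub>?Q\<^esub> v = U"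
    proof -
      have "\<iota> 0 \<odot>\<^bsub>?Q\<^esub> v \<oplus>\<^bsub>?Q\<^esub> \<iota> 0 \<odot>\<^bsub>?Q\<^esub> v = \<iota> 0 \<odot>\<^bsub>?Q\<^esub> v"
        using Q.smult_l_distr[OF \<iota>(1) \<iota>(1) v(1), of 0 0] \<iota>(2)[of 0 0] by simp
      then have "\<iota> 0 \<odot>\<^bsub>?Q\<^esub> v = \<zero>\<^bsub>?Q\<^esub>"
        using Q.smult_closed \<iota>(1) v(1) by (metis Q.M.add.l_cancel_one)
      then show ?thesis by (simp add: quot_module_simps)
    qed
    show "\<theta> x = 0 \<longleftrightarrow> x \<in> U" if "x \<in> carrier M" for x
      using \<theta>[OF that] \<theta>I[OF that] zero M.coset_eq_self_iff[OF U that] by metis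
    obtain x where x: "x \<in> carrier M" "v = U +>\<^bsub>M\<^esub> x" using v(1) by (rule quot_module_carrierE)
    then have "\<theta> x = 1" using \<theta>I[of x 1] \<iota>(4) v(1) by simp
    then show "\<exists>x\<in>carrier M. \<theta> x = 1" using x by blast
    fix a z x assume a: "acts_by \<iota> ?Q a z" "a \<in> carrier R" and x: "x \<in> carrier M"
    show "\<theta> (a \<odot>\<^bsub>M\<^esub> x) = z * \<theta> x"
    proof (rule \<theta>I)
      have "U +>\<^bsub>M\<^esub> (a \<odot>\<^bsub>M\<^esub> x) = \<iota> z \<odot>\<^bsub>?Q\<^esub> (U +>\<^bsub>M\<^esub> x)"
        using quot_module_smult[OF M U a(2) x] a(1) coset_in_quot[OF x, of U] by (simp add: acts_by_def)
      also have "\<dots> = \<iota> (z * \<theta> x) \<odot>\<^bsub>?Q\<^esub> v"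
        using \<theta>[OF x] Q.smult_assoc1[OF \<iota>(1) \<iota>(1) v(1)] by (simp add: \<iota>(3))
      finally show "U +>\<^bsub>M\<^esub> (a \<odot>\<^bsub>M\<^esub> x) = \<iota> (z * \<theta> x) \<odot>\<^bsub>?Q\<^esub> v" .
    qed (use a x in simp)
  qed
qed

text \<open>Subtracting from \<open>x\<close> the multiple of \<open>v\<close> with the same value
  of \<open>\<eta>\<close> gives an element of the common kernel. Hypothesis \<open>sc\<close>
  provides this multiple as \<open>a\<close> times \<open>v\<close> for an element \<open>a\<close>
  that scales both functionals alike.\<close>

lemma functionals_same_kernel:
  assumes M: "abelian_group M" and \<theta>: "additive_functional M \<theta>" and \<eta>: "additive_functional M \<eta>"
    and ker: "\<And>x. x \<in> carrier M \<Longrightarrow> \<theta> x = 0 \<longleftrightarrow> \<eta> x = 0"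
    and sc: "\<And>z. \<exists>a. \<forall>x\<in>carrier M. a \<odot>\<^bsub>M\<^esub> x \<in> carrier M \<and>
        \<theta> (a \<odot>\<^bsub>M\<^esub> x) = z * \<theta> x \<and> \<eta> (a \<odot>\<^bsub>M\<^esub> x) = z * \<eta> x"
  obtains z where "\<And>x. x \<in> carrier M \<Longrightarrow> \<theta> x = z * \<eta> x"
proof (cases "\<forall>x\<in>carrier M. \<eta> x = 0")
  case True
  then show ?thesis using that[of 0] ker by auto
next
  case False
  then obtain v where v: "v \<in> carrier M" "\<eta> v \<noteq> 0" by blast
  interpret M: abelian_group M by fact
  show ?thesis
  proof (rule that[of "\<theta> v / \<eta> v"])
    fix x assume x: "x \<in> carrier M"
    obtain a where a: "a \<odot>\<^bsub>M\<^esub> v \<in> carrier M" "\<theta> (a \<odot>\<^bsub>M\<^esub> v) = (\<eta> x / \<eta> v) * \<theta> v"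
      "\<eta> (a \<odot>\<^bsub>M\<^esub> v) = (\<eta> x / \<eta> v) * \<eta> v"
      using sc v(1) by metis
    have "\<eta> (x \<ominus>\<^bsub>M\<^esub> a \<odot>\<^bsub>M\<^esub> v) = 0"
      using additive_functionalD(4)[OF \<eta> M x a(1)] a(3) v by simp
    then have "\<theta> (x \<ominus>\<^bsub>M\<^esub> a \<odot>\<^bsub>M\<^esub> v) = 0" using ker x a(1) by simp
    then show "\<theta> x = \<theta> v / \<eta> v * \<eta> x"
      using additive_functionalD(4)[OF \<theta> M x a(1)] a(2) by (simp add: field_simps)
  qed
qed

text \<open>A subspace \<open>S\<close> that is maximal among those containing \<open>W\<close> and
  missing \<open>v\<close> is a complement of the line through \<open>v\<close>, and
  \<open>\<theta>\<close> reads off the coefficient of \<open>v\<close>. Zorn's lemma is applied to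
  complex subspaces, closed under the scalars \<open>\<iota> z\<close> only: such an
  \<open>S\<close> is a hyperplane, whereas a maximal submodule missing \<open>v\<close> could be
  smaller.\<close>

lemma functional_extension:
  assumes M: "left_module R M"
    and \<iota>: "\<And>z. \<iota> z \<in> carrier R" "\<And>z w. \<iota> (z + w) = \<iota> z \<oplus>\<^bsub>R\<^esub> \<iota> w"
      "\<And>z w. \<iota> (z * w) = \<iota> z \<otimes>\<^bsub>R\<^esub> \<iota> w" "\<iota> 1 = \<one>\<^bsub>R\<^esub>"
    and W: "submodule W R M" and v: "v \<in> carrier M" "v \<notin> W"
  obtains \<theta> where "additive_functional M \<theta>" "\<And>z x. x \<in> carrier M \<Longrightarrow> \<theta> (\<iota> z \<odot>\<^bsub>M\<^esub> x) = z * \<theta> x"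
    "\<And>x. x \<in> W \<Longrightarrow> \<theta> x = 0" "\<theta> v = 1"
proof -
  interpret M: left_module R M by fact
  note \<iota>_smult = M.smult_l_distr[OF \<iota>(1) \<iota>(1), folded \<iota>(2)] M.smult_assoc1[OF \<iota>(1) \<iota>(1), folded \<iota>(3)]
    M.smult_r_distr[OF \<iota>(1)]
  have \<iota>1: "\<iota> 1 \<odot>\<^bsub>M\<^esub> x = x" if "x \<in> carrier M" for x using \<iota>(4) that by simp
  have "\<iota> 0 \<oplus>\<^bsub>R\<^esub> \<iota> 0 = \<iota> 0" using \<iota>(2)[of 0 0] by simp
  then have "\<iota> 0 = \<zero>\<^bsub>R\<^esub>" using \<iota>(1) M.R.add.l_cancel_one by blast
  then have \<iota>0: "\<iota> 0 \<odot>\<^bsub>M\<^esub> x = \<zero>\<^bsub>M\<^esub>" if "x \<in> carrier M" for x using that M.smult_l_null by simp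
  have \<iota>neg: "\<iota> (- z) \<odot>\<^bsub>M\<^esub> x \<oplus>\<^bsub>M\<^esub> \<iota> z \<odot>\<^bsub>M\<^esub> x = \<zero>\<^bsub>M\<^esub>" if "x \<in> carrier M" for x z
    using \<iota>_smult(1)[OF that, of "- z" z] \<iota>0[OF that] by simp
  define sub where "sub S \<longleftrightarrow> S \<subseteq> carrier M \<and> \<zero>\<^bsub>M\<^esub> \<in> S \<and> (\<forall>x\<in>S. \<forall>y\<in>S. x \<oplus>\<^bsub>M\<^esub> y \<in> S) \<and>
    (\<forall>z. \<forall>x\<in>S. \<iota> z \<odot>\<^bsub>M\<^esub> x \<in> S)" for S
  let ?A = "{S. sub S \<and> W \<subseteq> S \<and> v \<notin> S}"
  have "W \<in> ?A" using M.submoduleD[OF W] v \<iota>(1) by (auto simp: sub_def)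
  moreover have "\<Union>C \<in> ?A" if ne: "C \<noteq> {}" and chain: "subset.chain ?A C" for C
  proof -
    have C: "\<And>S. S \<in> C \<Longrightarrow> sub S \<and> W \<subseteq> S \<and> v \<notin> S" "\<And>S T. S \<in> C \<Longrightarrow> T \<in> C \<Longrightarrow> S \<subseteq> T \<or> T \<subseteq> S"
      using chain by (auto simp: subset_chain_def)
    have "x \<oplus>\<^bsub>M\<^esub> y \<in> \<Union>C" if "x \<in> \<Union>C" "y \<in> \<Union>C" for x y
    proof -
      from that obtain S T where "x \<in> S" "S \<in> C" "y \<in> T" "T \<in> C" by blast
      with C(2)[of S T] obtain S' where "x \<in> S'" "y \<in> S'" "S' \<in> C" by blast
      then show ?thesis using C(1)[of S'] by (auto simp: sub_def)
    qed
    moreover obtain S0 where "S0 \<in> C" using ne by blast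
    then have "\<zero>\<^bsub>M\<^esub> \<in> \<Union>C" "W \<subseteq> \<Union>C" using C(1)[of S0] by (auto simp: sub_def)
    moreover have "\<Union>C \<subseteq> carrier M" "v \<notin> \<Union>C" using C(1) unfolding sub_def by blast+
    moreover have "\<iota> z \<odot>\<^bsub>M\<^esub> x \<in> \<Union>C" if "x \<in> \<Union>C" for x z
      using that C(1) unfolding sub_def by blast
    ultimately show ?thesis by (simp add: sub_def)
  qed
  ultimately have "\<exists>S\<in>?A. \<forall>S'\<in>?A. S \<subseteq> S' \<longrightarrow> S' = S"
    by (intro subset_Zorn_nonempty) auto
  then obtain S where S: "sub S" "W \<subseteq> S" "v \<notin> S"
    and max: "\<And>S'. sub S' \<Longrightarrow> W \<subseteq> S' \<Longrightarrow> v \<notin> S' \<Longrightarrow> S \<subseteq> S' \<Longrightarrow> S' = S"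
    by auto
  have SD: "S \<subseteq> carrier M" "\<zero>\<^bsub>M\<^esub> \<in> S" "\<And>x y. x \<in> S \<Longrightarrow> y \<in> S \<Longrightarrow> x \<oplus>\<^bsub>M\<^esub> y \<in> S"
    "\<And>z x. x \<in> S \<Longrightarrow> \<iota> z \<odot>\<^bsub>M\<^esub> x \<in> S"
    using S(1) by (auto simp: sub_def)
  note Sc = subsetD[OF SD(1)]
  have decomp: "\<exists>z. \<exists>s\<in>S. x = s \<oplus>\<^bsub>M\<^esub> \<iota> z \<odot>\<^bsub>M\<^esub> v" if x: "x \<in> carrier M" for x
  proof (cases "x \<in> S")
    case True
    then show ?thesis using x v \<iota>0 by (intro exI[of _ 0] bexI[of _ x]) auto
  next
    case False
    \<comment> \<open>By maximality, adding the line through \<open>x\<close> to \<open>S\<close>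
      must capture \<open>v\<close>. The coefficient of \<open>x\<close> in the resulting expression
      for \<open>v\<close> is nonzero because \<open>v\<close> is not in \<open>S\<close>, so the
      equation can be solved for \<open>x\<close>.\<close>
    define S' where "S' = {s \<oplus>\<^bsub>M\<^esub> \<iota> z \<odot>\<^bsub>M\<^esub> x | s z. s \<in> S}"
    have in1: "s \<in> S'" if "s \<in> S" for s
      unfolding S'_def using that Sc[OF that] \<iota>0[OF x] by (intro CollectI exI[of _ s] exI[of _ 0]) simp
    have "x \<in> S'"
      unfolding S'_def using SD(2) x \<iota>1[OF x] by (intro CollectI exI[of _ "\<zero>\<^bsub>M\<^esub>"] exI[of _ 1]) simp
    moreover have "sub S'"
      unfolding sub_def
    proof (intro conjI ballI allI)
      show "S' \<subseteq> carrier M" using Sc x \<iota>(1) by (auto simp: S'_def)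
      show "\<zero>\<^bsub>M\<^esub> \<in> S'" using in1 SD(2) .
      fix y assume "y \<in> S'"
      then obtain s z where y: "s \<in> S" "y = s \<oplus>\<^bsub>M\<^esub> \<iota> z \<odot>\<^bsub>M\<^esub> x" by (auto simp: S'_def)
      show "\<iota> w \<odot>\<^bsub>M\<^esub> y \<in> S'" for w
        unfolding S'_def using y Sc[OF y(1)] SD(4) x \<iota>(1)
        by (intro CollectI exI[of _ "\<iota> w \<odot>\<^bsub>M\<^esub> s"] exI[of _ "w * z"]) (simp add: \<iota>_smult)
      fix y' assume "y' \<in> S'"
      then obtain s' z' where y': "s' \<in> S" "y' = s' \<oplus>\<^bsub>M\<^esub> \<iota> z' \<odot>\<^bsub>M\<^esub> x" by (auto simp: S'_def)
      show "y \<oplus>\<^bsub>M\<^esub> y' \<in> S'"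
        unfolding S'_def using y y' Sc[OF y(1)] Sc[OF y'(1)] SD(3) x \<iota>(1)
        by (intro CollectI exI[of _ "s \<oplus>\<^bsub>M\<^esub> s'"] exI[of _ "z + z'"]) (simp add: \<iota>_smult M.M.a_ac)
    qed
    ultimately have "v \<in> S'" using max[of S'] in1 S(2) False by blast
    then obtain s z where sz: "s \<in> S" "v = s \<oplus>\<^bsub>M\<^esub> \<iota> z \<odot>\<^bsub>M\<^esub> x" by (auto simp: S'_def)
    have "z \<noteq> 0" using sz S(3) \<iota>0[OF x] Sc[OF sz(1)] by auto
    have "\<iota> (1 / z) \<odot>\<^bsub>M\<^esub> v = \<iota> (1 / z) \<odot>\<^bsub>M\<^esub> s \<oplus>\<^bsub>M\<^esub> x"
      using sz Sc[OF sz(1)] x \<iota>(1) \<open>z \<noteq> 0\<close> \<iota>1[OF x] by (simp add: \<iota>_smult flip: \<iota>_smult(2))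
    then have "\<iota> (- (1 / z)) \<odot>\<^bsub>M\<^esub> s \<oplus>\<^bsub>M\<^esub> \<iota> (1 / z) \<odot>\<^bsub>M\<^esub> v = x"
      using \<iota>neg[OF Sc[OF sz(1)], of "1 / z"] Sc[OF sz(1)] x \<iota>(1) by (simp flip: M.M.a_assoc)
    then show ?thesis using SD(4)[OF sz(1)] by metis
  qed
  have uniq: "z = w" if "s \<in> S" "t \<in> S" "s \<oplus>\<^bsub>M\<^esub> \<iota> z \<odot>\<^bsub>M\<^esub> v = t \<oplus>\<^bsub>M\<^esub> \<iota> w \<odot>\<^bsub>M\<^esub> v" for s t z w
  proof (rule ccontr)
    assume "z \<noteq> w"
    note c = Sc[OF that(1)] Sc[OF that(2)] v(1) \<iota>(1)
    have "\<iota> (z - w) \<odot>\<^bsub>M\<^esub> v = \<iota> z \<odot>\<^bsub>M\<^esub> v \<oplus>\<^bsub>M\<^esub> \<iota> (- w) \<odot>\<^bsub>M\<^esub> v"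
      using \<iota>_smult(1)[OF v(1), of z "- w"] by simp
    also have "\<iota> z \<odot>\<^bsub>M\<^esub> v = (\<iota> (- 1) \<odot>\<^bsub>M\<^esub> s \<oplus>\<^bsub>M\<^esub> \<iota> 1 \<odot>\<^bsub>M\<^esub> s) \<oplus>\<^bsub>M\<^esub> \<iota> z \<odot>\<^bsub>M\<^esub> v"
      using \<iota>neg[OF c(1), of 1] c by simp
    also have "\<dots> = \<iota> (- 1) \<odot>\<^bsub>M\<^esub> s \<oplus>\<^bsub>M\<^esub> (s \<oplus>\<^bsub>M\<^esub> \<iota> z \<odot>\<^bsub>M\<^esub> v)"
      using c \<iota>1[OF c(1)] by (simp add: M.M.a_assoc)
    also have "\<dots> = \<iota> (- 1) \<odot>\<^bsub>M\<^esub> s \<oplus>\<^bsub>M\<^esub> (t \<oplus>\<^bsub>M\<^esub> \<iota> w \<odot>\<^bsub>M\<^esub> v)" using that(3) by simp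
    also have "\<dots> \<oplus>\<^bsub>M\<^esub> \<iota> (- w) \<odot>\<^bsub>M\<^esub> v = (\<iota> (- 1) \<odot>\<^bsub>M\<^esub> s \<oplus>\<^bsub>M\<^esub> t) \<oplus>\<^bsub>M\<^esub> (\<iota> (- w) \<odot>\<^bsub>M\<^esub> v \<oplus>\<^bsub>M\<^esub> \<iota> w \<odot>\<^bsub>M\<^esub> v)"
      using c by (simp add: M.M.a_ac)
    also have "\<dots> = \<iota> (- 1) \<odot>\<^bsub>M\<^esub> s \<oplus>\<^bsub>M\<^esub> t" using \<iota>neg[OF c(3), of w] c by simp
    finally have "\<iota> (z - w) \<odot>\<^bsub>M\<^esub> v \<in> S" using SD that by simp
    then have "\<iota> (1 / (z - w)) \<odot>\<^bsub>M\<^esub> (\<iota> (z - w) \<odot>\<^bsub>M\<^esub> v) \<in> S" by (rule SD(4))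
    then show False using S(3) \<open>z \<noteq> w\<close> v(1) \<iota>1 by (simp flip: \<iota>_smult(2))
  qed
  define \<theta> where "\<theta> x = (THE z. \<exists>s\<in>S. x = s \<oplus>\<^bsub>M\<^esub> \<iota> z \<odot>\<^bsub>M\<^esub> v)" for x
  have \<theta>: "\<exists>s\<in>S. x = s \<oplus>\<^bsub>M\<^esub> \<iota> (\<theta> x) \<odot>\<^bsub>M\<^esub> v" if x: "x \<in> carrier M" for x
    unfolding \<theta>_def
  proof (rule theI')
    obtain z where z: "\<exists>s\<in>S. x = s \<oplus>\<^bsub>M\<^esub> \<iota> z \<odot>\<^bsub>M\<^esub> v" using decomp[OF x] by blast
    then show "\<exists>!z. \<exists>s\<in>S. x = s \<oplus>\<^bsub>M\<^esub> \<iota> z \<odot>\<^bsub>M\<^esub> v"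
      using uniq by (intro ex1I[of _ z]) auto
  qed
  have \<theta>I: "\<theta> x = z" if "x \<in> carrier M" "s \<in> S" "x = s \<oplus>\<^bsub>M\<^esub> \<iota> z \<odot>\<^bsub>M\<^esub> v" for x z s
    using \<theta>[OF that(1)] that(2,3) uniq by auto
  show thesis
  proof (rule that)
    show "additive_functional M \<theta>"
      unfolding additive_functional_def
    proof (intro ballI)
      fix x y assume x: "x \<in> carrier M" and y: "y \<in> carrier M"
      obtain s t where "s \<in> S" "x = s \<oplus>\<^bsub>M\<^esub> \<iota> (\<theta> x) \<odot>\<^bsub>M\<^esub> v" "t \<in> S" "y = t \<oplus>\<^bsub>M\<^esub> \<iota> (\<theta> y) \<odot>\<^bsub>M\<^esub> v"
        using \<theta>[OF x] \<theta>[OF y] by blast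
      note st = this
      have "x \<oplus>\<^bsub>M\<^esub> y = (s \<oplus>\<^bsub>M\<^esub> \<iota> (\<theta> x) \<odot>\<^bsub>M\<^esub> v) \<oplus>\<^bsub>M\<^esub> (t \<oplus>\<^bsub>M\<^esub> \<iota> (\<theta> y) \<odot>\<^bsub>M\<^esub> v)"
        using st(2,4) by simp
      also have "\<dots> = (s \<oplus>\<^bsub>M\<^esub> t) \<oplus>\<^bsub>M\<^esub> \<iota> (\<theta> x + \<theta> y) \<odot>\<^bsub>M\<^esub> v"
        using Sc[OF st(1)] Sc[OF st(3)] v(1) \<iota>(1) by (simp add: \<iota>_smult M.M.a_ac)
      finally show "\<theta> (x \<oplus>\<^bsub>M\<^esub> y) = \<theta> x + \<theta> y"
        by (rule \<theta>I[OF M.M.a_closed[OF x y] SD(3)[OF st(1,3)]])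
    qed
    show "\<theta> (\<iota> z \<odot>\<^bsub>M\<^esub> x) = z * \<theta> x" if x: "x \<in> carrier M" for z x
    proof -
      obtain s where s: "s \<in> S" "x = s \<oplus>\<^bsub>M\<^esub> \<iota> (\<theta> x) \<odot>\<^bsub>M\<^esub> v" using \<theta>[OF x] by blast
      have "\<iota> z \<odot>\<^bsub>M\<^esub> x = \<iota> z \<odot>\<^bsub>M\<^esub> (s \<oplus>\<^bsub>M\<^esub> \<iota> (\<theta> x) \<odot>\<^bsub>M\<^esub> v)" using s(2) by simp
      also have "\<dots> = \<iota> z \<odot>\<^bsub>M\<^esub> s \<oplus>\<^bsub>M\<^esub> \<iota> (z * \<theta> x) \<odot>\<^bsub>M\<^esub> v"
        using Sc[OF s(1)] v(1) \<iota>(1) by (simp add: \<iota>_smult)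
      finally show ?thesis
        by (rule \<theta>I[OF M.smult_closed[OF \<iota>(1) x] SD(4)[OF s(1)]])
    qed
    show "\<theta> x = 0" if "x \<in> W" for x
    proof (rule \<theta>I)
      show "x \<in> S" using that S(2) by blast
      then show "x \<in> carrier M" "x = x \<oplus>\<^bsub>M\<^esub> \<iota> 0 \<odot>\<^bsub>M\<^esub> v" using Sc \<iota>0[OF v(1)] by auto
    qed
    show "\<theta> v = 1"
      using SD(2) v(1) \<iota>1[OF v(1)] by (intro \<theta>I) auto
  qed
qed

section \<open>Eigenfunctionals, unique simple quotients and projectivity\<close>

lemma eigen_functionalD:
  assumes "eigen_functional E M \<theta>"
  shows "additive_functional M \<theta>" "\<And>a z x. E a z \<Longrightarrow> x \<in> carrier M \<Longrightarrow> \<theta> (a \<odot>\<^bsub>M\<^esub> x) = z * \<theta> x"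
  using assms by (auto simp: eigen_functional_def)

lemma eigen_functional_scalar:
  assumes "left_module R M" "carrier R = generate_ring R G" "G \<subseteq> carrier R"
    and "eigen_functional E M \<theta>" "\<And>a. a \<in> G \<Longrightarrow> \<exists>z. E a z" "a \<in> carrier R"
  shows "\<exists>z. \<forall>x\<in>carrier M. \<theta> (a \<odot>\<^bsub>M\<^esub> x) = z * \<theta> x"
  using eigen_functional_generate[OF assms(1) assms(1) assms(3) assms(4) assms(4) assms(5)] assms(2,6) by blast

lemma eigen_kernel_submodule:
  assumes M: "left_module R M" and G: "carrier R = generate_ring R G" "G \<subseteq> carrier R"
    and \<theta>: "eigen_functional E M \<theta>" "\<And>a. a \<in> G \<Longrightarrow> \<exists>z. E a z"
  shows "submodule {x \<in> carrier M. \<theta> x = 0} R M"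
proof -
  interpret M: left_module R M by fact
  note add = additive_functionalD[OF eigen_functionalD(1)[OF \<theta>(1)] M.M.abelian_group_axioms]
  show ?thesis
  proof (rule M.submoduleI)
    fix a x assume "a \<in> carrier R" "x \<in> {x \<in> carrier M. \<theta> x = 0}"
    then show "a \<odot>\<^bsub>M\<^esub> x \<in> {x \<in> carrier M. \<theta> x = 0}"
      using eigen_functional_scalar[OF M G \<theta>, of a] by fastforce
  qed (use add in auto)
qed

text \<open>The kernel of a nonzero eigenfunctional is a submodule with simple quotient, so
  uniqueness makes it equal to \<open>U\<close>; functionals with equal kernels are proportional.
  \<open>E'\<close> is arbitrary, so functionals of every weight are compared with the same
  \<open>\<psi>\<close>.\<close>

lemma functional_of_unique_simple_quotient:
  assumes ip: "indec_projective_with_simple_quotient R is_S M"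
    and G: "carrier R = generate_ring R G" "G \<subseteq> carrier R"
    and \<iota>: "\<And>z. \<iota> z \<in> carrier R" "\<And>z w. \<iota> (z + w) = \<iota> z \<oplus>\<^bsub>R\<^esub> \<iota> w"
      "\<And>z w. \<iota> (z * w) = \<iota> z \<otimes>\<^bsub>R\<^esub> \<iota> w" "\<iota> 1 = \<one>\<^bsub>R\<^esub>"
    and S: "\<And>N. is_S N \<Longrightarrow> one_dimensional R \<iota> N"
      "\<And>N a z. is_S N \<Longrightarrow> E a z \<Longrightarrow> acts_by \<iota> N a z"
    and E: "\<And>z. E (\<iota> z) z" "\<And>a z. E a z \<Longrightarrow> a \<in> carrier R"
  obtains \<psi> where "eigen_functional E M \<psi>" "\<exists>x\<in>carrier M. \<psi> x = 1"
    "\<And>E' \<theta>. eigen_functional E' M \<theta> \<Longrightarrow> (\<And>a. a \<in> G \<Longrightarrow> \<exists>z. E' a z) \<Longrightarrow> (\<And>z. E' (\<iota> z) z) \<Longrightarrow>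
      \<exists>z. \<forall>x\<in>carrier M. \<theta> x = z * \<psi> x"
proof -
  have M: "left_module R M" using ip by (simp add: indec_projective_with_simple_quotient_def)
  then interpret M: left_module R M .
  obtain U where U: "submodule U R M" "simple_module R (quot_module M U)"
    and uniq: "\<And>V. submodule V R M \<Longrightarrow> simple_module R (quot_module M V) \<Longrightarrow> V = U"
    and "is_S (quot_module M U)"
    using ip unfolding indec_projective_with_simple_quotient_def by blast
  obtain \<psi> where \<psi>: "additive_functional M \<psi>" "\<And>x. x \<in> carrier M \<Longrightarrow> \<psi> x = 0 \<longleftrightarrow> x \<in> U"
    "\<exists>x\<in>carrier M. \<psi> x = 1"
    "\<And>a z x. acts_by \<iota> (quot_module M U) a z \<Longrightarrow> a \<in> carrier R \<Longrightarrow> x \<in> carrier M \<Longrightarrow> \<psi> (a \<odot>\<^bsub>M\<^esub> x) = z * \<psi> x"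
    by (rule functional_of_one_dimensional_quot[OF M U(1) S(1)[OF \<open>is_S _\<close>] \<iota>]) blast
  show thesis
  proof (rule that)
    show eig: "eigen_functional E M \<psi>"
      unfolding eigen_functional_def using \<psi>(1,4) S(2)[OF \<open>is_S _\<close>] E(2) by blast
    show "\<exists>x\<in>carrier M. \<psi> x = 1" by (rule \<psi>(3))
    fix E' \<theta> assume \<theta>: "eigen_functional E' M \<theta>" and E': "\<And>a. a \<in> G \<Longrightarrow> \<exists>z. E' a z" "\<And>z. E' (\<iota> z) z"
    note \<theta>D = eigen_functionalD[OF \<theta>]
    show "\<exists>z. \<forall>x\<in>carrier M. \<theta> x = z * \<psi> x"
    proof (cases "\<exists>x\<in>carrier M. \<theta> x \<noteq> 0")
      case True
      have "{x \<in> carrier M. \<theta> x = 0} = U"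
      proof (rule uniq)
        have all: "\<exists>a\<in>carrier R. \<forall>x\<in>carrier M. \<theta> (a \<odot>\<^bsub>M\<^esub> x) = z * \<theta> x" for z
          using \<iota>(1) E'(2) \<theta>D(2) by (intro bexI[of _ "\<iota> z"]) auto
        show "submodule {x \<in> carrier M. \<theta> x = 0} R M"
          "simple_module R (quot_module M {x \<in> carrier M. \<theta> x = 0})"
          using simple_quot_kernel[OF M \<theta>D(1) eigen_functional_scalar[OF M G \<theta> E'(1)] all True] by auto
      qed
      then have ker: "\<theta> x = 0 \<longleftrightarrow> \<psi> x = 0" if "x \<in> carrier M" for x
        using \<psi>(2)[OF that] that by auto
      have sc: "\<exists>a. \<forall>x\<in>carrier M. a \<odot>\<^bsub>M\<^esub> x \<in> carrier M \<and> \<theta> (a \<odot>\<^bsub>M\<^esub> x) = z * \<theta> x \<and> \<psi> (a \<odot>\<^bsub>M\<^esub> x) = z * \<psi> x" for z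
        using \<iota>(1) \<theta>D(2)[OF E'(2)] eigen_functionalD(2)[OF eig E(1)] by (intro exI[of _ "\<iota> z"]) auto
      show ?thesis
        using functionals_same_kernel[OF M.M.abelian_group_axioms \<theta>D(1) \<psi>(1) ker sc] by metis
    qed (auto intro: exI[of _ 0])
  qed
qed

text \<open>The common eigenvalues form a character \<open>\<chi>\<close> of the ring, which turns
  the complex numbers into a module \<open>C\<close>. Both functionals are homomorphisms to
  \<open>C\<close>, and \<open>\<psi>\<close> is onto by \<open>all\<close>, so projectivity lifts
  \<open>\<phi>\<close> along \<open>\<psi>\<close>.\<close>

lemma projective_lift_functional:
  assumes P: "projective_module R P" and L: "left_module R L"
    and \<psi>: "additive_functional L \<psi>" "\<exists>x\<in>carrier L. \<psi> x = 1" and \<phi>: "additive_functional P \<phi>"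
    and eig: "\<And>a. a \<in> carrier R \<Longrightarrow> \<exists>z. (\<forall>x\<in>carrier L. \<psi> (a \<odot>\<^bsub>L\<^esub> x) = z * \<psi> x) \<and>
        (\<forall>x\<in>carrier P. \<phi> (a \<odot>\<^bsub>P\<^esub> x) = z * \<phi> x)"
    and all: "\<And>z. \<exists>a\<in>carrier R. \<forall>x\<in>carrier L. \<psi> (a \<odot>\<^bsub>L\<^esub> x) = z * \<psi> x"
  obtains g where "g \<in> lmod_hom R P L" "\<And>x. x \<in> carrier P \<Longrightarrow> \<psi> (g x) = \<phi> x"
proof -
  interpret L: left_module R L by fact
  note add = additive_functionalD[OF \<psi>(1) L.M.abelian_group_axioms]
  obtain \<chi> where \<chi>: "\<And>a x. a \<in> carrier R \<Longrightarrow> x \<in> carrier L \<Longrightarrow> \<psi> (a \<odot>\<^bsub>L\<^esub> x) = \<chi> a * \<psi> x"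
    "\<And>a x. a \<in> carrier R \<Longrightarrow> x \<in> carrier P \<Longrightarrow> \<phi> (a \<odot>\<^bsub>P\<^esub> x) = \<chi> a * \<phi> x"
    using eig by metis
  obtain v where v: "v \<in> carrier L" "\<psi> v = 1" using \<psi>(2) by blast
  define C :: "('a, complex) module" where
    "C = \<lparr>carrier = UNIV, monoid.mult = undefined, one = undefined, ring.zero = 0, ring.add = (+),
      module.smult = (\<lambda>a z. \<chi> a * z)\<rparr>"
  have "abelian_group C"
    by (rule abelian_groupI) (auto simp: C_def intro: exI[of _ "- _"])
  \<comment> \<open>That \<open>\<chi>\<close> is additive and multiplicative is read off at
    \<open>v\<close>, where \<open>\<psi>\<close> takes the value 1.\<close>
  moreover have "\<chi> (a \<oplus>\<^bsub>R\<^esub> b) = \<chi> a + \<chi> b" "\<chi> (a \<otimes>\<^bsub>R\<^esub> b) = \<chi> a * \<chi> b"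
    if "a \<in> carrier R" "b \<in> carrier R" for a b
    using \<chi>(1)[of "a \<oplus>\<^bsub>R\<^esub> b" v] \<chi>(1)[of "a \<otimes>\<^bsub>R\<^esub> b" v] \<chi>(1)[OF that(1), of v] \<chi>(1)[OF that(2), of v]
      \<chi>(1)[OF that(1), of "b \<odot>\<^bsub>L\<^esub> v"] that v add(1)
    by (simp_all add: L.smult_l_distr L.smult_assoc1)
  moreover have "\<chi> \<one>\<^bsub>R\<^esub> = 1" using \<chi>(1)[of "\<one>\<^bsub>R\<^esub>" v] v by simp
  ultimately have C: "left_module R C"
    by (intro left_moduleI L.R.ring_axioms) (auto simp: C_def algebra_simps)
  have "\<psi> \<in> lmod_hom R L C" "\<phi> \<in> lmod_hom R P C"
    using \<chi> \<psi>(1) \<phi> by (auto simp: lmod_hom_def C_def additive_functional_def)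
  moreover have "\<psi> ` carrier L = carrier C"
  proof -
    have "\<exists>x\<in>carrier L. z = \<psi> x" for z
    proof -
      obtain a where "a \<in> carrier R" "\<forall>x\<in>carrier L. \<psi> (a \<odot>\<^bsub>L\<^esub> x) = z * \<psi> x" using all by blast
      then show ?thesis using v by (intro bexI[of _ "a \<odot>\<^bsub>L\<^esub> v"]) auto
    qed
    then show ?thesis by (auto simp: C_def)
  qed
  ultimately show ?thesis
    using projective_lift[OF P L _ _ C] that by metis
qed

lemma direct_sum_functional_eqI:
  assumes R: "ring R" and M: "\<And>i. i \<in> A \<Longrightarrow> left_module R (M i)"
    and \<theta>: "additive_functional (direct_sum A M) \<theta>" "additive_functional (direct_sum A M) \<eta>"
    and eq: "\<And>i x. i \<in> A \<Longrightarrow> x \<in> carrier (M i) \<Longrightarrow> \<theta> (direct_sum_inj A M i x) = \<eta> (direct_sum_inj A M i x)"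
    and f: "f \<in> carrier (direct_sum A M)"
  shows "\<theta> f = \<eta> f"
proof -
  have ab: "abelian_group (direct_sum A M)"
    using left_moduleD(2)[OF left_module_direct_sum[OF R]] M by blast
  note add = additive_functionalD[OF \<theta>(1) ab] additive_functionalD[OF \<theta>(2) ab]
  show ?thesis
  proof (rule direct_sum_induct[OF M R f])
    fix i x g assume "i \<in> A" "x \<in> carrier (M i)" "g \<in> carrier (direct_sum A M)" "\<theta> g = \<eta> g"
    moreover have "direct_sum_inj A M i \<in> lmod_hom R (M i) (direct_sum A M)"
      by (rule direct_sum_inj_hom) (use M R \<open>i \<in> A\<close> in auto)
    then have "direct_sum_inj A M i x \<in> carrier (direct_sum A M)"
      using \<open>x \<in> carrier (M i)\<close> by (rule lmod_homD(1))
    ultimately show "\<theta> (direct_sum_inj A M i x \<oplus>\<^bsub>direct_sum A M\<^esub> g) = \<eta> (direct_sum_inj A M i x \<oplus>\<^bsub>direct_sum A M\<^esub> g)"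
      using add eq by simp
  qed (use add in auto)
qed

section \<open>Induced modules\<close>

definition tensor :: "('a, 'e) ring_scheme \<Rightarrow> 'a set \<Rightarrow> ('a, 'b) module \<Rightarrow> 'a \<Rightarrow> 'b \<Rightarrow> ('a \<times> 'b \<Rightarrow>\<^sub>0 int) set" where
  "tensor R A P x p = generate (free_Abelian_group (carrier R \<times> carrier P)) (tensor_relators R A P)
     #>\<^bsub>free_Abelian_group (carrier R \<times> carrier P)\<^esub> frag_of (x, p)"

context
  fixes R :: "('a, 'e) ring_scheme" and A :: "'a set" and P :: "('a, 'b) module"
  assumes R: "ring R" and A: "subring A R" and P: "left_module (R\<lparr>carrier := A\<rparr>) P"
begin

interpretation R: ring R by (rule R)
interpretation P: left_module "R\<lparr>carrier := A\<rparr>" P by (rule P)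

private abbreviation (input) "F \<equiv> free_Abelian_group (carrier R \<times> carrier P)"
private abbreviation (input) "N \<equiv> generate F (tensor_relators R A P)"
private abbreviation (input) "IM \<equiv> induced_module R A P"
private abbreviation (input) "lmult h \<equiv> frag_extend (\<lambda>(x, p). frag_of (h \<otimes>\<^bsub>R\<^esub> x, p))"

interpretation F: comm_group F by (rule abelian_free_Abelian_group)

private lemma A_carrier: "a \<in> A \<Longrightarrow> a \<in> carrier R"
  using subringE(1)[OF A] by blast

private lemma P_smult: "a \<in> A \<Longrightarrow> p \<in> carrier P \<Longrightarrow> a \<odot>\<^bsub>P\<^esub> p \<in> carrier P"
  using P.smult_closed by simp

private lemma F_add: "f \<in> carrier F \<Longrightarrow> g \<in> carrier F \<Longrightarrow> f + g \<in> carrier F"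
  using F.m_closed[of f g] by simp

private lemma F_diff: "f \<in> carrier F \<Longrightarrow> g \<in> carrier F \<Longrightarrow> f - g \<in> carrier F"
  using F.m_closed[of f "- g"] by simp

private lemma frag_of_F: "x \<in> carrier R \<Longrightarrow> p \<in> carrier P \<Longrightarrow> frag_of (x, p) \<in> carrier F"
  by simp

private lemma relators_F: "tensor_relators R A P \<subseteq> carrier F"
  unfolding tensor_relators_def
  by (auto simp del: carrier_free_Abelian_group_iff intro!: F_diff frag_of_F P_smult R.a_closed R.m_closed P.M.a_closed
      intro: A_carrier)

private lemma N_subgroup: "subgroup N F"
  by (rule F.generate_is_subgroup[OF relators_F])

private lemma N_normal: "N \<lhd> F"
  using F.subgroup_imp_normal[OF N_subgroup] .

interpretation N: normal N F by (rule N_normal)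

private lemma N_F: "f \<in> N \<Longrightarrow> f \<in> carrier F"
  using N.subset by blast

private lemma N_add: "f \<in> N \<Longrightarrow> g \<in> N \<Longrightarrow> f + g \<in> N"
  using N.m_closed[of f g] by simp

private lemma N_minus: "f \<in> N \<Longrightarrow> - f \<in> N"
  using N.m_inv_closed[of f] N_F[of f] inv_free_Abelian_group[of f]
  by (metis carrier_free_Abelian_group_iff)

private lemma tensor_coset_eq_iff:
  assumes "f \<in> carrier F" "g \<in> carrier F"
  shows "N #>\<^bsub>F\<^esub> f = N #>\<^bsub>F\<^esub> g \<longleftrightarrow> f - g \<in> N"
proof -
  have "f \<in> N #>\<^bsub>F\<^esub> g \<longleftrightarrow> f - g \<in> N"
  proof
    assume "f - g \<in> N"
    moreover have "f = (f - g) + g" by simp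
    ultimately show "f \<in> N #>\<^bsub>F\<^esub> g"
      unfolding r_coset_def mult_free_Abelian_group by blast
  qed (auto simp: r_coset_def)
  moreover have "f \<in> N #>\<^bsub>F\<^esub> f" using F.rcos_self[OF assms(1) N_subgroup] .
  ultimately show ?thesis using F.repr_independence[OF _ assms(2) N_subgroup] by blast
qed

private lemma F_induct [consumes 1, case_names zero diff of]:
  assumes "f \<in> carrier F" "Q 0"
    "\<And>f g. f \<in> carrier F \<Longrightarrow> g \<in> carrier F \<Longrightarrow> Q f \<Longrightarrow> Q g \<Longrightarrow> Q (f - g)"
    "\<And>x p. x \<in> carrier R \<Longrightarrow> p \<in> carrier P \<Longrightarrow> Q (frag_of (x, p))"
  shows "Q f"
  using assms free_Abelian_group_induct[of f "carrier R \<times> carrier P" Q] by auto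

private lemma lmult_F:
  assumes "h \<in> carrier R" "f \<in> carrier F"
  shows "lmult h f \<in> carrier F"
  using assms(2)
proof (induction rule: F_induct)
  case (diff f g)
  then show ?case using F_diff[of "lmult h f" "lmult h g"] by (simp only: frag_extend_diff)
qed (use assms(1) in auto)

text \<open>Each relator goes to one of the same kind: the first kind by distributivity, the third
  by associativity, and in the second only the left factor is replaced. This is what lets
  multiplication pass to cosets of \<open>N\<close>.\<close>

private lemma lmult_relator:
  assumes h: "h \<in> carrier R" and "f \<in> tensor_relators R A P"
  shows "lmult h f \<in> tensor_relators R A P"
proof -
  from assms(2) consider
    (add_left) x y p where "f = frag_of (x \<oplus>\<^bsub>R\<^esub> y, p) - frag_of (x, p) - frag_of (y, p)"
      "x \<in> carrier R" "y \<in> carrier R" "p \<in> carrier P"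
  | (add_right) x p q where "f = frag_of (x, p \<oplus>\<^bsub>P\<^esub> q) - frag_of (x, p) - frag_of (x, q)"
      "x \<in> carrier R" "p \<in> carrier P" "q \<in> carrier P"
  | (balanced) x a p where "f = frag_of (x \<otimes>\<^bsub>R\<^esub> a, p) - frag_of (x, a \<odot>\<^bsub>P\<^esub> p)"
      "x \<in> carrier R" "a \<in> A" "p \<in> carrier P"
    unfolding tensor_relators_def by blast
  then show ?thesis
  proof cases
    case (add_left x y p)
    then have eq: "lmult h f = frag_of ((h \<otimes>\<^bsub>R\<^esub> x) \<oplus>\<^bsub>R\<^esub> (h \<otimes>\<^bsub>R\<^esub> y), p) - frag_of (h \<otimes>\<^bsub>R\<^esub> x, p) - frag_of (h \<otimes>\<^bsub>R\<^esub> y, p)"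
      using h by (simp add: frag_extend_diff R.r_distr)
    show ?thesis
      unfolding tensor_relators_def eq
      by (rule UnI1, rule UnI1) (use h add_left R.m_closed in blast)
  next
    case (add_right x p q)
    then have eq: "lmult h f = frag_of (h \<otimes>\<^bsub>R\<^esub> x, p \<oplus>\<^bsub>P\<^esub> q) - frag_of (h \<otimes>\<^bsub>R\<^esub> x, p) - frag_of (h \<otimes>\<^bsub>R\<^esub> x, q)"
      by (simp add: frag_extend_diff)
    show ?thesis
      unfolding tensor_relators_def eq
      by (rule UnI1, rule UnI2) (use h add_right R.m_closed in blast)
  next
    case (balanced x a p)
    then have eq: "lmult h f = frag_of ((h \<otimes>\<^bsub>R\<^esub> x) \<otimes>\<^bsub>R\<^esub> a, p) - frag_of (h \<otimes>\<^bsub>R\<^esub> x, a \<odot>\<^bsub>P\<^esub> p)"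
      using h A_carrier by (simp add: frag_extend_diff R.m_assoc)
    show ?thesis
      unfolding tensor_relators_def eq
      by (rule UnI2) (use h balanced R.m_closed in blast)
  qed
qed

private lemma lmult_N:
  assumes h: "h \<in> carrier R" and "f \<in> N"
  shows "lmult h f \<in> N"
  using assms(2)
proof (induction rule: generate.induct)
  case one
  then show ?case using N.one_closed by simp
next
  case (incl f)
  then show ?case using lmult_relator[OF h] by (blast intro: generate.incl)
next
  case (inv f)
  then have "- lmult h f \<in> N" using lmult_relator[OF h] by (blast intro: N_minus generate.incl)
  moreover have "f \<in> carrier F" using relators_F inv by blast
  then have "inv\<^bsub>F\<^esub> f = - f" by (intro inv_free_Abelian_group) simp
  ultimately show ?case by (simp add: frag_extend_minus)
next
  case (eng f g)
  then show ?case using N_add by (simp add: frag_extend_add)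
qed

private lemma cosetE:
  assumes "Y \<in> carrier IM"
  obtains f where "f \<in> carrier F" "Y = N #>\<^bsub>F\<^esub> f"
  using assms by (auto simp: induced_module_def Let_def RCOSETS_def simp del: carrier_free_Abelian_group_iff)

private lemma coset_IM: "f \<in> carrier F \<Longrightarrow> N #>\<^bsub>F\<^esub> f \<in> carrier IM"
  by (auto simp: induced_module_def Let_def RCOSETS_def simp del: carrier_free_Abelian_group_iff)

private lemma IM_add:
  "f \<in> carrier F \<Longrightarrow> g \<in> carrier F \<Longrightarrow> (N #>\<^bsub>F\<^esub> f) \<oplus>\<^bsub>IM\<^esub> (N #>\<^bsub>F\<^esub> g) = N #>\<^bsub>F\<^esub> (f + g)"
  using N.rcos_sum[of f g] by (simp add: induced_module_def Let_def)

private lemma IM_zero: "\<zero>\<^bsub>IM\<^esub> = N #>\<^bsub>F\<^esub> 0"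
  using F.coset_mult_one[OF N.subset] by (simp add: induced_module_def Let_def)

lemma abelian_group_induced: "abelian_group IM"
proof (rule abelian_groupI)
  fix Y assume "Y \<in> carrier IM"
  then obtain f where f: "f \<in> carrier F" "Y = N #>\<^bsub>F\<^esub> f" by (metis cosetE)
  have "- f \<in> carrier F" using f(1) by simp
  with f show "\<exists>Z\<in>carrier IM. Z \<oplus>\<^bsub>IM\<^esub> Y = \<zero>\<^bsub>IM\<^esub>"
    by (intro bexI[of _ "N #>\<^bsub>F\<^esub> (- f)"])
      (simp_all add: IM_add IM_zero coset_IM del: carrier_free_Abelian_group_iff)
next
  have "0 \<in> carrier F" by simp
  then show "\<zero>\<^bsub>IM\<^esub> \<in> carrier IM" unfolding IM_zero by (rule coset_IM)
  fix Y assume "Y \<in> carrier IM"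
  with \<open>0 \<in> carrier F\<close> show "\<zero>\<^bsub>IM\<^esub> \<oplus>\<^bsub>IM\<^esub> Y = Y"
    by (elim cosetE) (simp add: IM_add IM_zero del: carrier_free_Abelian_group_iff)
qed (auto elim!: cosetE simp: IM_add coset_IM F_add ac_simps
    simp del: carrier_free_Abelian_group_iff)

private lemma IM_smult:
  assumes "h \<in> carrier R" "f \<in> carrier F"
  shows "h \<odot>\<^bsub>IM\<^esub> (N #>\<^bsub>F\<^esub> f) = N #>\<^bsub>F\<^esub> lmult h f"
proof -
  have "N #>\<^bsub>F\<^esub> lmult h g = N #>\<^bsub>F\<^esub> lmult h f" if g: "g \<in> N #>\<^bsub>F\<^esub> f" for g
  proof -
    have "g - f \<in> N" using g by (auto simp: r_coset_def)
    moreover have "g \<in> carrier F" using F.r_coset_subset_G[OF N.subset assms(2)] g by blast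
    ultimately show ?thesis
      using lmult_N[OF assms(1), of "g - f"] lmult_F[OF assms(1)] assms(2)
      by (subst tensor_coset_eq_iff) (simp_all only: frag_extend_diff)
  qed
  then have "(\<Union>g\<in>N #>\<^bsub>F\<^esub> f. N #>\<^bsub>F\<^esub> lmult h g) = (\<Union>g\<in>N #>\<^bsub>F\<^esub> f. N #>\<^bsub>F\<^esub> lmult h f)"
    by (rule SUP_cong[OF refl])
  moreover have "N #>\<^bsub>F\<^esub> f \<noteq> {}" using F.rcos_self[OF assms(2) N_subgroup] by blast
  ultimately show ?thesis by (simp add: induced_module_def Let_def)
qed

text \<open>In the free abelian group the pair of a sum is not the sum of the pairs, so additivity
  in the ring element holds only modulo \<open>N\<close>, through the first kind of relator. The
  laws for products and for the unit hold before passing to cosets.\<close>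

private lemma lmult_add:
  assumes "a \<in> carrier R" "b \<in> carrier R" "f \<in> carrier F"
  shows "lmult (a \<oplus>\<^bsub>R\<^esub> b) f - (lmult a f + lmult b f) \<in> N"
  using assms(3)
proof (induction rule: F_induct)
  case zero
  then show ?case using N.one_closed by simp
next
  case (diff f g)
  then have "(lmult (a \<oplus>\<^bsub>R\<^esub> b) f - (lmult a f + lmult b f)) + - (lmult (a \<oplus>\<^bsub>R\<^esub> b) g - (lmult a g + lmult b g)) \<in> N"
    by (intro N_add N_minus)
  then show ?case by (simp add: frag_extend_diff algebra_simps)
next
  case (of x p)
  have "frag_of ((a \<otimes>\<^bsub>R\<^esub> x) \<oplus>\<^bsub>R\<^esub> (b \<otimes>\<^bsub>R\<^esub> x), p) - frag_of (a \<otimes>\<^bsub>R\<^esub> x, p) - frag_of (b \<otimes>\<^bsub>R\<^esub> x, p)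
      \<in> tensor_relators R A P"
    unfolding tensor_relators_def using assms of by (intro UnI1) blast
  then show ?case using assms of by (simp add: R.l_distr diff_diff_eq generate.incl)
qed

private lemma lmult_mult:
  assumes "a \<in> carrier R" "b \<in> carrier R" "f \<in> carrier F"
  shows "lmult (a \<otimes>\<^bsub>R\<^esub> b) f = lmult a (lmult b f)"
  using assms(3) by (induction rule: F_induct) (auto simp: frag_extend_diff R.m_assoc assms)

private lemma lmult_one: "f \<in> carrier F \<Longrightarrow> lmult \<one>\<^bsub>R\<^esub> f = f"
  by (induction rule: F_induct) (auto simp: frag_extend_diff)

lemma left_module_induced: "left_module R IM"
proof (rule left_moduleI[OF R abelian_group_induced])
  fix a b Y assume ab: "a \<in> carrier R" "b \<in> carrier R" and "Y \<in> carrier IM"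
  then obtain f where f: "f \<in> carrier F" "Y = N #>\<^bsub>F\<^esub> f" by (metis cosetE)
  show "(a \<oplus>\<^bsub>R\<^esub> b) \<odot>\<^bsub>IM\<^esub> Y = a \<odot>\<^bsub>IM\<^esub> Y \<oplus>\<^bsub>IM\<^esub> b \<odot>\<^bsub>IM\<^esub> Y"
    using ab f lmult_F[OF _ f(1)] lmult_add[OF ab f(1)] IM_smult[OF _ f(1)] F_add
      tensor_coset_eq_iff[of "lmult (a \<oplus>\<^bsub>R\<^esub> b) f" "lmult a f + lmult b f"]
    by (simp add: IM_add del: carrier_free_Abelian_group_iff)
  show "(a \<otimes>\<^bsub>R\<^esub> b) \<odot>\<^bsub>IM\<^esub> Y = a \<odot>\<^bsub>IM\<^esub> (b \<odot>\<^bsub>IM\<^esub> Y)"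
    using ab f lmult_F lmult_mult[OF ab f(1)] by (simp add: IM_smult del: carrier_free_Abelian_group_iff)
next
  fix a Y Z assume a: "a \<in> carrier R" and "Y \<in> carrier IM" "Z \<in> carrier IM"
  then obtain f g where f: "f \<in> carrier F" "Y = N #>\<^bsub>F\<^esub> f" and g: "g \<in> carrier F" "Z = N #>\<^bsub>F\<^esub> g"
    by (metis cosetE)
  show "a \<odot>\<^bsub>IM\<^esub> (Y \<oplus>\<^bsub>IM\<^esub> Z) = a \<odot>\<^bsub>IM\<^esub> Y \<oplus>\<^bsub>IM\<^esub> a \<odot>\<^bsub>IM\<^esub> Z"
    using a f g lmult_F F_add by (simp add: IM_smult IM_add frag_extend_add del: carrier_free_Abelian_group_iff)
next
  fix a Y assume a: "a \<in> carrier R" and "Y \<in> carrier IM"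
  then obtain f where f: "f \<in> carrier F" "Y = N #>\<^bsub>F\<^esub> f" by (metis cosetE)
  show "a \<odot>\<^bsub>IM\<^esub> Y \<in> carrier IM"
    using a f lmult_F coset_IM by (simp add: IM_smult del: carrier_free_Abelian_group_iff)
next
  fix Y assume "Y \<in> carrier IM"
  then obtain f where f: "f \<in> carrier F" "Y = N #>\<^bsub>F\<^esub> f" by (metis cosetE)
  then show "\<one>\<^bsub>R\<^esub> \<odot>\<^bsub>IM\<^esub> Y = Y"
    using lmult_one by (simp add: IM_smult del: carrier_free_Abelian_group_iff)
qed

lemma tensor_closed: "x \<in> carrier R \<Longrightarrow> p \<in> carrier P \<Longrightarrow> tensor R A P x p \<in> carrier IM"
  unfolding tensor_def by (intro coset_IM) simp

lemma smult_tensor: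
  "h \<in> carrier R \<Longrightarrow> x \<in> carrier R \<Longrightarrow> p \<in> carrier P \<Longrightarrow>
    h \<odot>\<^bsub>IM\<^esub> tensor R A P x p = tensor R A P (h \<otimes>\<^bsub>R\<^esub> x) p"
  unfolding tensor_def by (subst IM_smult) auto

lemma tensor_add:
  assumes "x \<in> carrier R" "p \<in> carrier P" "q \<in> carrier P"
  shows "tensor R A P x (p \<oplus>\<^bsub>P\<^esub> q) = tensor R A P x p \<oplus>\<^bsub>IM\<^esub> tensor R A P x q"
proof -
  have "frag_of (x, p \<oplus>\<^bsub>P\<^esub> q) - frag_of (x, p) - frag_of (x, q) \<in> tensor_relators R A P"
    unfolding tensor_relators_def by (rule UnI1, rule UnI2) (use assms in blast)
  then have "frag_of (x, p \<oplus>\<^bsub>P\<^esub> q) - (frag_of (x, p) + frag_of (x, q)) \<in> N"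
    by (simp add: diff_diff_eq generate.incl)
  then show ?thesis
    unfolding tensor_def using assms F_add frag_of_F
    by (simp add: IM_add tensor_coset_eq_iff del: carrier_free_Abelian_group_iff)
qed

lemma tensor_balanced:
  assumes "x \<in> carrier R" "a \<in> A" "p \<in> carrier P"
  shows "tensor R A P (x \<otimes>\<^bsub>R\<^esub> a) p = tensor R A P x (a \<odot>\<^bsub>P\<^esub> p)"
proof -
  have "frag_of (x \<otimes>\<^bsub>R\<^esub> a, p) - frag_of (x, a \<odot>\<^bsub>P\<^esub> p) \<in> tensor_relators R A P"
    unfolding tensor_relators_def using assms by (intro UnI2) blast
  then have "frag_of (x \<otimes>\<^bsub>R\<^esub> a, p) - frag_of (x, a \<odot>\<^bsub>P\<^esub> p) \<in> N"
    by (simp add: generate.incl)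
  then show ?thesis
    unfolding tensor_def using assms frag_of_F P_smult A_carrier
    by (simp add: tensor_coset_eq_iff del: carrier_free_Abelian_group_iff)
qed

text \<open>Multiplying the tensor of 1 and \<open>p\<close> by \<open>x\<close> gives the tensor of
  \<open>x\<close> and \<open>p\<close>, so the image of \<open>P\<close> generates the induced
  module. Two eigenfunctionals of the same weight that agree on this image are therefore
  equal.\<close>

lemma induced_generated:
  assumes U: "submodule U R IM" and one: "\<And>p. p \<in> carrier P \<Longrightarrow> tensor R A P \<one>\<^bsub>R\<^esub> p \<in> U"
  shows "U = carrier IM"
proof
  interpret IM: left_module R IM by (rule left_module_induced)
  note UD = IM.submoduleD[OF U]
  show "U \<subseteq> carrier IM" by (rule UD)
  have "N #>\<^bsub>F\<^esub> f \<in> U" if "f \<in> carrier F" for f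
    using that
  proof (induction rule: F_induct)
    case zero
    show ?case using UD(2) IM_zero by simp
  next
    case (diff f g)
    have mg: "- g \<in> carrier F" using diff(2) by simp
    have "(N #>\<^bsub>F\<^esub> (- g)) \<oplus>\<^bsub>IM\<^esub> (N #>\<^bsub>F\<^esub> g) = \<zero>\<^bsub>IM\<^esub>"
      using IM_add[OF mg diff(2)] IM_zero by simp
    then have "\<ominus>\<^bsub>IM\<^esub> (N #>\<^bsub>F\<^esub> g) = N #>\<^bsub>F\<^esub> (- g)"
      using coset_IM diff(2) mg by (intro IM.M.minus_equality) auto
    then have "N #>\<^bsub>F\<^esub> (- g) \<in> U" using UD(4) diff(4) by metis
    then have "(N #>\<^bsub>F\<^esub> f) \<oplus>\<^bsub>IM\<^esub> (N #>\<^bsub>F\<^esub> (- g)) \<in> U" using UD(3) diff(3) by blast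
    then show ?case using IM_add[OF diff(1) mg] by simp
  next
    case (of x p)
    then have "tensor R A P x p \<in> U"
      using smult_tensor[of x "\<one>\<^bsub>R\<^esub>" p] UD(5)[OF of(1) one[OF of(2)]] by simp
    then show ?case by (simp add: tensor_def)
  qed
  then show "carrier IM \<subseteq> U" by (metis cosetE subsetI)
qed

text \<open>One half of Frobenius reciprocity: the tensor of \<open>x\<close> and \<open>p\<close>
  is sent to \<open>x\<close> applied to \<open>g p\<close>. The relators are killed by the module
  laws of \<open>L\<close> and, for the third kind, by linearity of \<open>g\<close> over
  \<open>A\<close>.\<close>

lemma induced_universal:
  assumes L: "left_module R L" and g: "g \<in> lmod_hom (R\<lparr>carrier := A\<rparr>) P L"
  obtains f where "f \<in> lmod_hom R IM L" "\<And>p. p \<in> carrier P \<Longrightarrow> f (tensor R A P \<one>\<^bsub>R\<^esub> p) = g p"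
proof -
  interpret L: left_module R L by fact
  note gD = lmod_homD[OF g]
  have "(\<lambda>(x, p). x \<odot>\<^bsub>L\<^esub> g p) ` (carrier R \<times> carrier P) \<subseteq> carrier (add_monoid L)"
    using gD(1) by auto
  then obtain H where H: "H \<in> hom F (add_monoid L)"
    and "\<And>y. y \<in> carrier R \<times> carrier P \<Longrightarrow> H (frag_of y) = (\<lambda>(x, p). x \<odot>\<^bsub>L\<^esub> g p) y"
    by (rule comm_group.free_Abelian_group_universal[OF L.M.a_comm_group]) blast
  then have H_of: "H (frag_of (x, p)) = x \<odot>\<^bsub>L\<^esub> g p" if "x \<in> carrier R" "p \<in> carrier P" for x p
    using that by simp
  have HF: "H f \<in> carrier L" if "f \<in> carrier F" for f
    using H that by (auto simp: hom_def)
  have H_add: "H (f + f') = H f \<oplus>\<^bsub>L\<^esub> H f'" if "f \<in> carrier F" "f' \<in> carrier F" for f f'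
    using hom_mult[OF H that] by simp
  have H_zero: "H 0 = \<zero>\<^bsub>L\<^esub>"
    using H_add[of 0 0] HF[of 0] L.M.add.l_cancel_one[of "H 0" "H 0"] by simp
  have H_minus: "H (- f) = \<ominus>\<^bsub>L\<^esub> H f" if "f \<in> carrier F" for f
  proof -
    have "- f \<in> carrier F" using that by simp
    moreover have "H (- f) \<oplus>\<^bsub>L\<^esub> H f = \<zero>\<^bsub>L\<^esub>" using H_add[OF calculation that] H_zero by simp
    ultimately show ?thesis using L.M.minus_equality HF that by metis
  qed
  have H_diff: "H (f - f') = H f \<ominus>\<^bsub>L\<^esub> H f'" if "f \<in> carrier F" "f' \<in> carrier F" for f f'
    using H_add[of f "- f'"] H_minus[OF that(2)] that by (simp add: L.M.minus_eq)
  have cancel: "(a \<oplus>\<^bsub>L\<^esub> b) \<ominus>\<^bsub>L\<^esub> a \<ominus>\<^bsub>L\<^esub> b = \<zero>\<^bsub>L\<^esub>" if "a \<in> carrier L" "b \<in> carrier L" for a b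
  proof -
    have "(a \<oplus>\<^bsub>L\<^esub> b) \<ominus>\<^bsub>L\<^esub> a \<ominus>\<^bsub>L\<^esub> b = (a \<oplus>\<^bsub>L\<^esub> \<ominus>\<^bsub>L\<^esub> a) \<oplus>\<^bsub>L\<^esub> (b \<oplus>\<^bsub>L\<^esub> \<ominus>\<^bsub>L\<^esub> b)"
      using that by (simp only: L.M.minus_eq L.M.a_ac L.M.a_closed L.M.a_inv_closed)
    then show ?thesis using that by (simp add: L.M.r_neg)
  qed
  have H_relator: "H f = \<zero>\<^bsub>L\<^esub>" if "f \<in> tensor_relators R A P" for f
    using that unfolding tensor_relators_def
  proof (elim UnE CollectE exE conjE)
    fix x y p assume "f = frag_of (x \<oplus>\<^bsub>R\<^esub> y, p) - frag_of (x, p) - frag_of (y, p)"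
      and "x \<in> carrier R" "y \<in> carrier R" "p \<in> carrier P"
    then show ?thesis
      using F_diff frag_of_F gD(1)
      by (simp add: H_diff H_of L.smult_l_distr cancel
          del: carrier_free_Abelian_group_iff)
  next
    fix x p q assume "f = frag_of (x, p \<oplus>\<^bsub>P\<^esub> q) - frag_of (x, p) - frag_of (x, q)"
      and "x \<in> carrier R" "p \<in> carrier P" "q \<in> carrier P"
    then show ?thesis
      using F_diff frag_of_F gD(1,2)
      by (simp add: H_diff H_of L.smult_r_distr cancel
          del: carrier_free_Abelian_group_iff)
  next
    fix x a p assume f: "f = frag_of (x \<otimes>\<^bsub>R\<^esub> a, p) - frag_of (x, a \<odot>\<^bsub>P\<^esub> p)"
      and x: "x \<in> carrier R" "a \<in> A" "p \<in> carrier P"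
    then have "H f = (x \<otimes>\<^bsub>R\<^esub> a) \<odot>\<^bsub>L\<^esub> g p \<ominus>\<^bsub>L\<^esub> x \<odot>\<^bsub>L\<^esub> (a \<odot>\<^bsub>L\<^esub> g p)"
      using F_diff frag_of_F gD(3)[of a p] A_carrier P_smult
      by (simp add: H_diff H_of del: carrier_free_Abelian_group_iff)
    then show ?thesis
      using x gD(1) A_carrier by (simp add: L.smult_assoc1 L.M.minus_eq L.M.r_neg)
  qed
  have H_N: "H f = \<zero>\<^bsub>L\<^esub>" if "f \<in> N" for f
    using that
  proof (induction rule: generate.induct)
    case (inv f)
    then have "f \<in> carrier F" using relators_F by blast
    then show ?case using H_minus[of f] H_relator[OF inv] by simp
  next
    case (eng f f')
    then show ?case using H_add[OF N_F N_F, of f f'] by simp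
  qed (use H_zero H_relator in auto)
  have "H f = H f'" if "f \<in> carrier F" "f' \<in> carrier F" "N #>\<^bsub>F\<^esub> f = N #>\<^bsub>F\<^esub> f'" for f f'
    using H_diff[OF that(1,2)] H_N tensor_coset_eq_iff[OF that(1,2)] that(3) HF[OF that(1)] HF[OF that(2)]
    by (simp add: L.M.minus_eq) (metis L.M.add.inv_solve_right' L.M.l_zero L.M.zero_closed)
  then obtain G where G: "G \<in> hom (F Mod N) (add_monoid L)" "\<And>f. f \<in> carrier F \<Longrightarrow> G (N #>\<^bsub>F\<^esub> f) = H f"
    using FactGroup_universal[OF H N_normal] by metis
  have H_lmult: "H (lmult h f) = h \<odot>\<^bsub>L\<^esub> H f" if h: "h \<in> carrier R" and "f \<in> carrier F" for h f
    using that(2)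
  proof (induction rule: F_induct)
    case zero
    then show ?case using H_zero L.smult_r_null h by simp
  next
    case (diff f f')
    then show ?case
      using h lmult_F HF by (simp add: frag_extend_diff H_diff L.M.minus_eq L.smult_r_distr L.smult_r_minus
          del: carrier_free_Abelian_group_iff)
  next
    case (of x p)
    then show ?case using h gD(1) by (simp add: H_of L.smult_assoc1)
  qed
  have "G \<in> lmod_hom R IM L"
    unfolding lmod_hom_def
  proof (intro CollectI conjI ballI Pi_I)
    fix Y assume "Y \<in> carrier IM"
    then obtain f where f: "f \<in> carrier F" "Y = N #>\<^bsub>F\<^esub> f" by (metis cosetE)
    then show "G Y \<in> carrier L" using G(2) HF by simp
    show "G (a \<odot>\<^bsub>IM\<^esub> Y) = a \<odot>\<^bsub>L\<^esub> G Y" if "a \<in> carrier R" for a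
      using f that G(2) H_lmult lmult_F by (simp add: IM_smult del: carrier_free_Abelian_group_iff)
    fix Z assume "Z \<in> carrier IM"
    then obtain f' where f': "f' \<in> carrier F" "Z = N #>\<^bsub>F\<^esub> f'" by (metis cosetE)
    then show "G (Y \<oplus>\<^bsub>IM\<^esub> Z) = G Y \<oplus>\<^bsub>L\<^esub> G Z"
      using f G(2) H_add F_add by (simp add: IM_add del: carrier_free_Abelian_group_iff)
  qed
  moreover have "G (tensor R A P \<one>\<^bsub>R\<^esub> p) = g p" if "p \<in> carrier P" for p
    using that G(2)[OF frag_of_F] H_of[of "\<one>\<^bsub>R\<^esub>" p] gD(1) by (simp add: tensor_def)
  ultimately show ?thesis using that by blast
qed

end

section \<open>Normal words for the braid relations\<close>

text \<open>The congruence defining the positive braid monoid. Squares stay unrelated to shorter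
  words, because what \<open>\<tau>_i\<close> does when applied twice depends on the weight that it
  meets.\<close>

inductive braid_eq :: "nat list \<Rightarrow> nat list \<Rightarrow> bool" where
  braid_eq_refl: "braid_eq w w"
| braid_eq_sym: "braid_eq v w \<Longrightarrow> braid_eq w v"
| braid_eq_trans: "braid_eq v w \<Longrightarrow> braid_eq w x \<Longrightarrow> braid_eq v x"
| braid_eq_context: "braid_eq v w \<Longrightarrow> braid_eq (a @ v @ b) (a @ w @ b)"
| braid_eq_commute: "i + 2 \<le> j \<Longrightarrow> braid_eq [i, j] [j, i]"
| braid_eq_braid: "braid_eq [i, Suc i, i] [Suc i, i, Suc i]"

lemma braid_eq_set: "braid_eq v w \<Longrightarrow> set v = set w"
  by (induction rule: braid_eq.induct) auto

lemma braid_eq_append1: "braid_eq v w \<Longrightarrow> braid_eq (a @ v) (a @ w)"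
  using braid_eq_context[of v w a "[]"] by simp

lemma braid_eq_append2: "braid_eq v w \<Longrightarrow> braid_eq (v @ b) (w @ b)"
  using braid_eq_context[of v w "[]" b] by simp

lemma braid_eq_Cons: "braid_eq v w \<Longrightarrow> braid_eq (a # v) (a # w)"
  using braid_eq_append1[of v w "[a]"] by simp

lemma braid_eq_swap: "i + 2 \<le> j \<or> j + 2 \<le> i \<Longrightarrow> braid_eq (i # j # w) (j # i # w)"
  using braid_eq_append2[of "[i, j]" "[j, i]" w] braid_eq_commute[of i j]
    braid_eq_sym[OF braid_eq_commute[of j i]] by auto

lemma braid_eq_move:
  assumes "\<And>x. x \<in> set v \<Longrightarrow> x + 2 \<le> i \<or> i + 2 \<le> x"
  shows "braid_eq (v @ [i]) (i # v)"
  using assms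
proof (induction v)
  case Nil
  show ?case by (simp add: braid_eq_refl)
next
  case (Cons x v)
  then have "braid_eq (x # v @ [i]) (x # i # v)" by (intro braid_eq_Cons) auto
  moreover have "braid_eq (x # i # v) (i # x # v)" using Cons.prems by (intro braid_eq_swap) auto
  ultimately show ?case by (auto intro: braid_eq_trans)
qed

text \<open>Concatenating one descending word for each \<open>m\<close> gives the staircase normal forms of the
  symmetric group.\<close>

fun descending :: "nat \<Rightarrow> nat \<Rightarrow> nat list" where
  "descending m 0 = []"
| "descending 0 (Suc k) = []"
| "descending (Suc m) (Suc k) = Suc m # descending m k"

lemma descending_append: "k < m \<Longrightarrow> descending m (Suc k) = descending m k @ [m - k]"
proof (induction m k rule: descending.induct)
  case (1 m)
  then show ?case by (cases m) auto
qed auto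

lemma length_descending: "k \<le> m \<Longrightarrow> length (descending m k) = k"
  by (induction m k rule: descending.induct) auto

lemma set_descending: "x \<in> set (descending m k) \<Longrightarrow> x \<le> m \<and> m < x + k \<and> 1 \<le> x"
  by (induction m k rule: descending.induct) auto

text \<open>The word runs from \<open>m\<close> down to \<open>m - k + 1\<close>, and
  \<open>i\<close> is one of its letters other than the last. From the right, \<open>i\<close>
  commutes past the letters below \<open>i - 1\<close>, then \<open>i, i - 1, i\<close> becomes
  \<open>i - 1, i, i - 1\<close>, and the new leading \<open>i - 1\<close> commutes past the letters
  above \<open>i\<close>.\<close>

lemma descending_move:
  assumes "m + 1 < i + k" "i \<le> m" "k \<le> m"
  shows "braid_eq (descending m k @ [i]) ((i - 1) # descending m k)"
  using assms
proof (induction m k rule: descending.induct)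
  case (3 m k)
  show ?case
  proof (cases "i \<le> m")
    case True
    have "braid_eq (Suc m # descending m k @ [i]) (Suc m # (i - 1) # descending m k)"
      using 3 True by (intro braid_eq_Cons) auto
    moreover have "braid_eq (Suc m # (i - 1) # descending m k) ((i - 1) # Suc m # descending m k)"
      using True 3 by (intro braid_eq_swap) auto
    ultimately show ?thesis by (auto intro: braid_eq_trans)
  next
    case False
    with 3 have i: "i = Suc m" by auto
    with 3 obtain m' k' where mk: "m = Suc m'" "k = Suc k'"
      by (cases m; cases k) auto
    let ?d = "descending m' k'"
    have "braid_eq (?d @ [i]) (i # ?d)"
      using set_descending[of _ m' k'] i mk by (intro braid_eq_move) force
    then have "braid_eq (Suc m # m # ?d @ [i]) (Suc m # m # Suc m # ?d)"
      using i by (intro braid_eq_Cons) auto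
    moreover have "braid_eq (Suc m # m # Suc m # ?d) (m # Suc m # m # ?d)"
      using braid_eq_append2[OF braid_eq_sym[OF braid_eq_braid[of m]], of ?d] by simp
    ultimately show ?thesis using mk i by (auto intro: braid_eq_trans)
  qed
qed auto

fun normal_words :: "nat \<Rightarrow> nat list set" where
  "normal_words 0 = {[]}"
| "normal_words (Suc m) = {w @ descending (Suc m) k | w k. w \<in> normal_words m \<and> k \<le> Suc m}"

lemma finite_normal_words: "finite (normal_words m)"
proof (induction m)
  case (Suc m)
  have "normal_words (Suc m) =
      (\<lambda>(w, k). w @ descending (Suc m) k) ` (normal_words m \<times> {..Suc m})" by auto
  then show ?case using Suc by simp
qed simp

lemma Nil_normal: "[] \<in> normal_words m"
  by (induction m) (auto intro!: exI[of _ "[]"] exI[of _ 0])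

lemma set_normal_words: "w \<in> normal_words m \<Longrightarrow> set w \<subseteq> {1..m}"
proof (induction m arbitrary: w)
  case (Suc m)
  then obtain v k where "w = v @ descending (Suc m) k" "v \<in> normal_words m" by auto
  with Suc.IH[of v] show ?case using set_descending[of _ "Suc m" k] by force
qed auto

text \<open>The second alternative replaces the descent condition of the exchange property: \<open>w\<close> can be
  rewritten to end in \<open>i\<close>, so that \<open>w @ [i]\<close> can be rewritten to end in a square.\<close>

lemma normal_words_step:
  assumes "w \<in> normal_words m" "1 \<le> i" "i \<le> m"
  shows "(\<exists>v\<in>normal_words m. length v = Suc (length w) \<and> braid_eq (w @ [i]) v) \<or>
    (\<exists>v. braid_eq w (v @ [i]))"
  using assms
proof (induction m arbitrary: w i)
  case (Suc m)
  then obtain v k where w: "w = v @ descending (Suc m) k" and v: "v \<in> normal_words m" and k: "k \<le> Suc m"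
    by auto
  let ?d = "descending (Suc m) k"
  \<comment> \<open>The letter \<open>i\<close> crosses the last block and comes out as
    \<open>j\<close>, small enough for the induction hypothesis on \<open>v\<close>. In the second
    alternative the crossing is undone, so that the rewritten word ends in \<open>i\<close>
    again.\<close>
  have pass: ?case if j: "1 \<le> j" "j \<le> m" and mv: "braid_eq (?d @ [i]) (j # ?d)" for j
  proof -
    have e: "braid_eq (w @ [i]) ((v @ [j]) @ ?d)"
      using braid_eq_append1[OF mv, of v] w by simp
    from Suc.IH[OF v j] show ?thesis
    proof (elim disjE bexE exE conjE)
      fix v' assume v': "v' \<in> normal_words m" "length v' = Suc (length v)" "braid_eq (v @ [j]) v'"
      have "braid_eq (w @ [i]) (v' @ ?d)"
        using e braid_eq_append2[OF v'(3)] by (rule braid_eq_trans)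
      then show ?thesis
        using v' w k by (intro disjI1 bexI[of _ "v' @ ?d"]) auto
    next
      fix v' assume v': "braid_eq v (v' @ [j])"
      have "braid_eq w (v' @ (j # ?d))"
        using braid_eq_append2[OF v', of ?d] w by simp
      moreover have "braid_eq (v' @ (j # ?d)) ((v' @ ?d) @ [i])"
        using braid_eq_append1[OF braid_eq_sym[OF mv], of v'] by simp
      ultimately show ?thesis by (blast intro: braid_eq_trans)
    qed
  qed
  \<comment> \<open>The last block runs from \<open>m + 1\<close> down to \<open>m + 2 - k\<close>.
    In the order of the cases, \<open>i\<close> continues the block, equals its last letter, equals
    an earlier letter, or is too small to interact with it.\<close>
  consider "i + k = Suc m" | "i + k = Suc (Suc m)" | "i + k > Suc (Suc m)" | "i + k < Suc m" by linarith
  then show ?case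
  proof cases
    case 1
    then have "w @ [i] = v @ descending (Suc m) (Suc k)"
      using w descending_append[of k "Suc m"] Suc.prems by (auto simp: Suc_diff_le)
    moreover have "Suc k \<le> Suc m" using 1 Suc.prems by simp
    ultimately show ?thesis
      using v w k by (intro disjI1 bexI[of _ "w @ [i]"]) (auto simp: braid_eq_refl length_descending simp del: descending.simps)
  next
    case 2
    then obtain k' where k': "k = Suc k'" using Suc.prems by (cases k) auto
    have "w = (v @ descending (Suc m) k') @ [i]"
      using w k k' 2 descending_append[of k' "Suc m"]
      by (auto simp del: descending.simps)
    then show ?thesis by (metis braid_eq_refl)
  next
    case 3
    then show ?thesis
      using descending_move[of "Suc m" i k] Suc.prems k by (intro pass[of "i - 1"]) auto
  next
    case 4
    have "braid_eq (?d @ [i]) (i # ?d)"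
      using set_descending[of _ "Suc m" k] 4 by (intro braid_eq_move) force
    then show ?thesis using 4 Suc.prems by (intro pass[of i]) auto
  qed
qed simp

section \<open>Compositions and descents\<close>

lemma Des_singleton: "Des [i] = {}"
  by (auto simp: Des_def)

lemma Des_Cons:
  assumes "I \<noteq> []"
  shows "Des (i # I) = insert i ((+) i ` Des I)"
proof -
  have "k = 1 \<or> (\<exists>k'. k = Suc k' \<and> 1 \<le> k')" if "1 \<le> k" for k :: nat
    using that by (cases k) auto
  then show ?thesis
    using assms by (fastforce simp: Des_def image_iff)
qed

lemma Des_subset:
  assumes "\<forall>i\<in>set I. i \<ge> 1"
  shows "Des I \<subseteq> {1..<sum_list I}"
  using assms
proof (induction I)
  case (Cons i I)
  show ?case
  proof (cases "I = []")
    case False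
    then have "sum_list I \<ge> 1" using Cons.prems by (cases I) auto
    with False Cons show ?thesis by (fastforce simp: Des_Cons)
  qed (simp add: Des_singleton)
qed (simp add: Des_def)

lemma composition_eqI:
  assumes "composition n I" "composition n J" "Des I = Des J"
  shows "I = J"
  using assms
proof (induction I arbitrary: n J)
  case Nil
  then show ?case by (cases J) (auto simp: composition_def)
next
  case (Cons i I)
  then obtain j J' where J: "J = j # J'" by (cases J) (auto simp: composition_def)
  show ?case
  proof (cases "I = [] \<or> J' = []")
    case True
    then have "I = [] \<and> J' = []"
      using Cons.prems(3) J Des_Cons[of I i] Des_Cons[of J' j]
      by (cases "I = []"; cases "J' = []") (auto simp: Des_singleton)
    then show ?thesis using Cons.prems J by (auto simp: composition_def)
  next
    case False
    then have D: "insert i ((+) i ` Des I) = insert j ((+) j ` Des J')"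
      using Cons.prems(3) J by (simp add: Des_Cons)
    \<comment> \<open>Each first part belongs to the descent set of the other composition, whose
      elements are all at least the other first part. So the two first parts agree.\<close>
    have "i \<in> insert j ((+) j ` Des J')" "j \<in> insert i ((+) i ` Des I)"
      using D by blast+
    then have ij: "i = j" by auto
    have pos: "0 \<notin> Des I" "0 \<notin> Des J'"
      using Cons.prems J Des_subset[of I] Des_subset[of J'] by (fastforce simp: composition_def)+
    have "(+) i ` Des I = (+) i ` Des J'"
      using D pos unfolding ij by (metis (no_types, lifting) add_cancel_left_right imageE insert_ident)
    then have "Des I = Des J'" by (simp add: inj_image_eq_iff)
    moreover have "composition (n - i) I" "composition (n - i) J'"
      using Cons.prems J ij by (auto simp: composition_def)
    ultimately show ?thesis using Cons.IH J ij by blast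
  qed
qed

text \<open>The smallest element of \<open>D\<close> has to be the first part; the remaining
  elements, shifted down by it, form the descent set of the rest.\<close>

lemma composition_exists:
  assumes "D \<subseteq> {1..<n}" "n \<ge> 1"
  shows "\<exists>I. composition n I \<and> Des I = D"
  using assms
proof (induction n arbitrary: D rule: less_induct)
  case (less n)
  show ?case
  proof (cases "D = {}")
    case True
    then show ?thesis
      using less.prems by (intro exI[of _ "[n]"]) (auto simp: composition_def Des_singleton)
  next
    case False
    have fin: "finite D" using less.prems finite_subset by blast
    define m where "m = Min D"
    have m: "m \<in> D" "\<And>d. d \<in> D \<Longrightarrow> m \<le> d" using fin False by (auto simp: m_def)
    have mn: "1 \<le> m" "m < n" using m less.prems by auto
    define D' where "D' = (\<lambda>d. d - m) ` (D - {m})"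
    have "d - m \<in> {1..<n - m}" if "d \<in> D - {m}" for d
    proof -
      have "m \<le> d" "d \<noteq> m" "d < n" using that m(2)[of d] less.prems by auto
      then have "1 \<le> d - m" "d - m < n - m" by linarith+
      then show ?thesis by simp
    qed
    then have "D' \<subseteq> {1..<n - m}" unfolding D'_def by blast
    then obtain I where I: "composition (n - m) I" "Des I = D'"
      using less.IH[of "n - m" D'] mn by (auto simp: Suc_le_eq)
    have "I \<noteq> []" using I mn by (auto simp: composition_def)
    moreover have "(+) m ` D' = D - {m}"
    proof -
      have "(+) m ` D' = (\<lambda>d. m + (d - m)) ` (D - {m})" by (simp add: D'_def image_image)
      also have "\<dots> = (\<lambda>d. d) ` (D - {m})" using m(2) by (intro image_cong) auto
      finally show ?thesis by simp
    qed
    ultimately have "Des (m # I) = D" using I m by (auto simp: Des_Cons)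
    moreover have "composition n (m # I)" using I mn by (auto simp: composition_def)
    ultimately show ?thesis by blast
  qed
qed

lemma phi_Des:
  assumes "n \<ge> 1"
  shows "Des (fst (phi n (I, c))) = {j \<in> {1..<n}. j \<in> Des I \<longleftrightarrow> c j = c (j + 1)}"
proof -
  let ?D = "{j \<in> {1..<n}. j \<in> Des I \<and> c j = c (j+1)} \<union> {j \<in> {1..<n}. j \<notin> Des I \<and> c j \<noteq> c (j+1)}"
  have D: "?D = {j \<in> {1..<n}. j \<in> Des I \<longleftrightarrow> c j = c (j + 1)}" by auto
  have "?D \<subseteq> {1..<n}" by auto
  then obtain J where J: "composition n J" "Des J = ?D"
    using composition_exists assms by blast
  have "composition n (fst (phi n (I, c))) \<and> Des (fst (phi n (I, c))) = ?D"
    unfolding phi_def prod.case fst_conv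
    by (rule theI[of _ J]) (use J composition_eqI in auto)
  then show ?thesis unfolding D by blast
qed

lemma snd_phi: "snd (phi n K) = snd K"
  by (simp add: phi_def split_beta)

text \<open>With the colors kept, a position is a descent of the image exactly when being a descent
  and having equal colors are equivalent; comparing with equality of colors twice restores the
  descents. The simple quotient of the projective for \<open>K\<close> is indexed by
  \<open>phi n K\<close>, and its \<open>T\<close>-eigenvalues are read off \<open>phi\<close> once
  more. The two applications cancel, so the descent set of the shape of \<open>K\<close> itself
  governs the action.\<close>

lemma Des_phi_phi:
  assumes "n \<ge> 1" "composition n I"
  shows "Des (fst (phi n (phi n (I, c)))) = Des I"
proof -
  have "phi n (I, c) = (fst (phi n (I, c)), c)" using snd_phi[of n "(I, c)"] by (metis prod.collapse snd_conv)
  then have "Des (fst (phi n (phi n (I, c)))) =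
      {j \<in> {1..<n}. j \<in> Des (fst (phi n (I, c))) \<longleftrightarrow> c j = c (j + 1)}"
    using phi_Des[OF assms(1)] by metis
  also have "\<dots> = Des I"
    using phi_Des[OF assms(1), of I c] Des_subset[of I] assms(2) by (auto simp: composition_def)
  finally show ?thesis .
qed

section \<open>The algebra and its subalgebra\<close>

lemma aks_relators_in_ideal: "aks_relators n r u \<subseteq> aks_ideal n r u"
  unfolding aks_ideal_def by (rule ring.genideal_self[OF ring_free_alg aks_relators_closed])

lemma ideal_aks_ideal: "ideal (aks_ideal n r u) (free_alg n)"
  unfolding aks_ideal_def by (rule ring.genideal_ideal[OF ring_free_alg aks_relators_closed])

lemma free_alg_simps [simp]:
  "f \<oplus>\<^bsub>free_alg n\<^esub> g = f + g" "f \<otimes>\<^bsub>free_alg n\<^esub> g = f * g" "\<one>\<^bsub>free_alg n\<^esub> = 1" "\<zero>\<^bsub>free_alg n\<^esub> = 0"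
  by (simp_all add: free_alg_def)

lemma carrier_AKS: "carrier (AKS n r u) = aks_class n r u ` carrier (free_alg n)"
  by (auto simp: AKS_def FactRing_def A_RCOSETS_def' aks_class_def)

lemma aks_class_closed: "f \<in> carrier (free_alg n) \<Longrightarrow> aks_class n r u f \<in> carrier (AKS n r u)"
  by (auto simp: carrier_AKS)

lemma aks_class_ring_hom: "aks_class n r u \<in> ring_hom (free_alg n) (AKS n r u)"
  using ideal.rcos_ring_hom[OF ideal_aks_ideal] unfolding AKS_def aks_class_def .

lemma aks_class_add:
  "f \<in> carrier (free_alg n) \<Longrightarrow> g \<in> carrier (free_alg n) \<Longrightarrow>
    aks_class n r u (f + g) = aks_class n r u f \<oplus>\<^bsub>AKS n r u\<^esub> aks_class n r u g"
  using ring_hom_add[OF aks_class_ring_hom] by fastforce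

lemma aks_class_mult:
  "f \<in> carrier (free_alg n) \<Longrightarrow> g \<in> carrier (free_alg n) \<Longrightarrow>
    aks_class n r u (f * g) = aks_class n r u f \<otimes>\<^bsub>AKS n r u\<^esub> aks_class n r u g"
  using ring_hom_mult[OF aks_class_ring_hom] by fastforce

lemma aks_class_one: "aks_class n r u 1 = \<one>\<^bsub>AKS n r u\<^esub>"
  using ring_hom_one[OF aks_class_ring_hom] by simp

lemma aks_class_relator:
  assumes "f - g \<in> aks_relators n r u" "g \<in> carrier (free_alg n)"
  shows "aks_class n r u f = aks_class n r u g"
proof -
  interpret ideal "aks_ideal n r u" "free_alg n" by (rule ideal_aks_ideal)
  have "f - g \<in> aks_ideal n r u" using assms aks_relators_in_ideal by blast
  moreover have "f = (f - g) \<oplus>\<^bsub>free_alg n\<^esub> g" by simp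
  ultimately have "f \<in> aks_ideal n r u +>\<^bsub>free_alg n\<^esub> g"
    unfolding a_r_coset_def' by blast
  then show ?thesis
    unfolding aks_class_def using a_repr_independence[OF _ assms(2) a_subgroup] by simp
qed

lemma scal_add: "scal (z + w) = scal z + scal w"
  by (simp add: scal_def single_add)

lemma scal_mult: "scal (z * w) = scal z * scal w"
  by (simp add: scal_def mult_single)

lemma scal_one: "scal 1 = 1"
  by (simp add: scal_def)

lemma aks_scal:
  "aks_class n r u (scal z) \<in> carrier (AKS n r u)"
  "aks_class n r u (scal (z + w)) = aks_class n r u (scal z) \<oplus>\<^bsub>AKS n r u\<^esub> aks_class n r u (scal w)"
  "aks_class n r u (scal (z * w)) = aks_class n r u (scal z) \<otimes>\<^bsub>AKS n r u\<^esub> aks_class n r u (scal w)"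
  "aks_class n r u (scal 1) = \<one>\<^bsub>AKS n r u\<^esub>"
  by (simp_all add: aks_class_closed free_alg_basic scal_add scal_mult scal_one aks_class_add
      aks_class_mult aks_class_one)

definition aks_gens :: "nat \<Rightarrow> nat \<Rightarrow> (nat \<Rightarrow> complex) \<Rightarrow> aks_elem set" where
  "aks_gens n r u = (\<lambda>i. aks_class n r u (T i)) ` {1..<n} \<union> (\<lambda>j. aks_class n r u (\<Xi> j)) ` {1..n} \<union>
     range (\<lambda>z. aks_class n r u (scal z))"

lemma free_elem_decompose:
  fixes f :: free_elem
  assumes "Poly_Mapping.keys f \<subseteq> W" "Q 0" "\<And>w z. w \<in> W \<Longrightarrow> Q (Poly_Mapping.single w z)"
    "\<And>w z g. w \<in> W \<Longrightarrow> Poly_Mapping.keys g \<subseteq> W \<Longrightarrow> Q g \<Longrightarrow> Q (Poly_Mapping.single w z + g)"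
  shows "Q f"
  using assms(1)
proof (induction "card (Poly_Mapping.keys f)" arbitrary: f)
  case 0
  then show ?case using assms(2) by simp
next
  case (Suc k)
  then obtain w where w: "w \<in> Poly_Mapping.keys f" by fastforce
  define g where "g = f - Poly_Mapping.single w (Poly_Mapping.lookup f w)"
  have "Poly_Mapping.keys g = Poly_Mapping.keys f - {w}"
    by (auto simp: g_def in_keys_iff lookup_minus lookup_single when_def split: if_splits)
  then have "Q g" using Suc w by (intro Suc.hyps) auto
  moreover have "Poly_Mapping.keys g \<subseteq> W" using Suc.prems \<open>Poly_Mapping.keys g = _\<close> by blast
  ultimately have "Q (Poly_Mapping.single w (Poly_Mapping.lookup f w) + g)"
    using assms(4) Suc.prems w by blast
  then show ?case by (simp add: g_def)
qed

lemma scal_commute: "scal z * f = f * scal z"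
proof (rule free_elem_decompose[of f UNIV])
  fix w :: word and x :: complex and g :: free_elem
  show "scal z * Poly_Mapping.single w x = Poly_Mapping.single w x * scal z"
    by (simp add: scal_def mult_single mult.commute)
  then show "scal z * (Poly_Mapping.single w x + g) = (Poly_Mapping.single w x + g) * scal z"
    if "scal z * g = g * scal z"
    using that by (simp add: distrib_left distrib_right)
qed auto

lemma AKS_generated: "carrier (AKS n r u) = generate_ring (AKS n r u) (aks_gens n r u)"
proof
  interpret ring "AKS n r u" by (rule ring_AKS)
  let ?c = "aks_class n r u" and ?G = "generate_ring (AKS n r u) (aks_gens n r u)"
  have "aks_gens n r u \<subseteq> carrier (AKS n r u)"
    by (auto simp: aks_gens_def intro!: aks_class_closed free_alg_basic)
  then show "?G \<subseteq> carrier (AKS n r u)" by (rule generate_ring_incl)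
  have scal: "?c (scal z) \<in> ?G" for z
    by (intro generate_ring.incl) (simp add: aks_gens_def)
  have gen: "Poly_Mapping.single (Word [x]) 1 \<in> carrier (free_alg n) \<and> ?c (Poly_Mapping.single (Word [x]) 1) \<in> ?G"
    if "x \<in> gens n" for x
    using that free_alg_basic(4,5)
    by (auto simp: gens_def aks_gens_def T_def[symmetric] \<Xi>_def[symmetric] intro!: generate_ring.incl)
  have word: "?c (Poly_Mapping.single (Word ws) z) \<in> ?G \<and> Poly_Mapping.single (Word ws) z \<in> carrier (free_alg n)"
    if "set ws \<subseteq> gens n" for ws z
    using that
  proof (induction ws rule: rev_induct)
    case Nil
    then show ?case using scal[of z] free_alg_basic(3)[of z] by (simp add: scal_def zero_word_def)
  next
    case (snoc x ws)
    have "Poly_Mapping.single (Word (ws @ [x])) z =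
        Poly_Mapping.single (Word ws) z * Poly_Mapping.single (Word [x]) 1"
      by (simp add: mult_single)
    then show ?case
      using snoc gen[of x] by (auto simp: aks_class_mult intro: generate_ring.eng_mult free_alg_mult_closed)
  qed
  have "?c f \<in> ?G" if "f \<in> carrier (free_alg n)" for f
  proof (rule free_elem_decompose)
    show "Poly_Mapping.keys f \<subseteq> Word ` lists (gens n)" using that by (simp add: free_alg_def)
    show "?c 0 \<in> ?G" using scal[of 0] by (simp add: scal_def)
    fix w z assume "w \<in> Word ` lists (gens n)"
    then obtain ws where ws: "w = Word ws" "set ws \<subseteq> gens n" by auto
    then show "?c (Poly_Mapping.single w z) \<in> ?G" using word by blast
    fix g assume "Poly_Mapping.keys g \<subseteq> Word ` lists (gens n)" "?c g \<in> ?G"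
    then show "?c (Poly_Mapping.single w z + g) \<in> ?G"
      using word[OF ws(2), of z] ws(1) aks_class_add[of "Poly_Mapping.single w z" n g]
      by (auto simp: free_alg_def intro: generate_ring.eng_add)
  qed
  then show "carrier (AKS n r u) \<subseteq> ?G" by (auto simp: carrier_AKS)
qed

definition hecke_gens :: "nat \<Rightarrow> nat \<Rightarrow> (nat \<Rightarrow> complex) \<Rightarrow> aks_elem set" where
  "hecke_gens n r u = (\<lambda>i. aks_class n r u (T i)) ` {1..<n} \<union> range (\<lambda>z. aks_class n r u (scal z))"

lemma hecke_gens_closed: "hecke_gens n r u \<subseteq> carrier (AKS n r u)"
  by (auto simp: hecke_gens_def intro!: aks_class_closed free_alg_basic)

lemma Hecke0_eq: "Hecke0 n r u = (AKS n r u)\<lparr>carrier := generate_ring (AKS n r u) (hecke_gens n r u)\<rparr>"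
  by (simp add: Hecke0_def hecke_gens_def)

lemma subring_Hecke0: "subring (carrier (Hecke0 n r u)) (AKS n r u)"
  unfolding Hecke0_eq using ring.generate_ring_is_subring[OF ring_AKS hecke_gens_closed] by simp

lemma Hecke0_restrict: "Hecke0 n r u = (AKS n r u)\<lparr>carrier := carrier (Hecke0 n r u)\<rparr>"
  by (simp add: Hecke0_def)

text \<open>The subalgebra is defined by generation inside the large algebra, while the lemmas on
  functionals are applied with the subalgebra as base ring and ask for generation inside it.
  Additive inverses need an argument, since they are taken with respect to different
  carriers.\<close>

lemma Hecke0_generated: "carrier (Hecke0 n r u) = generate_ring (Hecke0 n r u) (hecke_gens n r u)"
proof
  let ?H = "Hecke0 n r u" and ?A = "AKS n r u"
  interpret A: ring ?A by (rule ring_AKS)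
  have c: "carrier ?H = generate_ring ?A (hecke_gens n r u)" by (simp add: Hecke0_eq)
  have sub: "subring (carrier ?H) ?A" by (rule subring_Hecke0)
  interpret H: ring ?H using A.subring_is_ring[OF sub] Hecke0_restrict by metis
  have ops: "\<one>\<^bsub>?H\<^esub> = \<one>\<^bsub>?A\<^esub>" "a \<oplus>\<^bsub>?H\<^esub> b = a \<oplus>\<^bsub>?A\<^esub> b" "a \<otimes>\<^bsub>?H\<^esub> b = a \<otimes>\<^bsub>?A\<^esub> b" for a b
    by (simp_all add: Hecke0_eq)
  have neg: "\<ominus>\<^bsub>?H\<^esub> a = \<ominus>\<^bsub>?A\<^esub> a" if "a \<in> carrier ?H" for a
  proof -
    have "a \<in> carrier ?A" "\<ominus>\<^bsub>?A\<^esub> a \<in> carrier ?H" using that subringE(1,5)[OF sub] by auto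
    moreover have "\<zero>\<^bsub>?H\<^esub> = \<zero>\<^bsub>?A\<^esub>" by (simp add: Hecke0_eq)
    ultimately show ?thesis using that H.minus_equality[of "\<ominus>\<^bsub>?A\<^esub> a" a] A.l_neg by (simp add: ops)
  qed
  have G: "hecke_gens n r u \<subseteq> carrier ?H" unfolding c by (auto intro: generate_ring.incl)
  show "generate_ring ?H (hecke_gens n r u) \<subseteq> carrier ?H" by (rule H.generate_ring_incl[OF G])
  have "a \<in> generate_ring ?H (hecke_gens n r u) \<and> a \<in> carrier ?H" if "a \<in> generate_ring ?A (hecke_gens n r u)" for a
    using that
  proof (induction rule: generate_ring.induct)
    case one
    show ?case using generate_ring.one[of ?H] H.one_closed by (simp add: ops)
  next
    case (incl h)
    then show ?case using G by (auto intro: generate_ring.incl)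
  next
    case (a_inv h)
    then show ?case using generate_ring.a_inv[of h ?H] H.a_inv_closed[of h] by (simp add: neg)
  next
    case (eng_add h1 h2)
    then show ?case using generate_ring.eng_add[of h1 ?H _ h2] H.a_closed[of h1 h2] by (simp add: ops)
  next
    case (eng_mult h1 h2)
    then show ?case using generate_ring.eng_mult[of h1 ?H _ h2] H.m_closed[of h1 h2] by (simp add: ops)
  qed
  then show "carrier ?H \<subseteq> generate_ring ?H (hecke_gens n r u)" unfolding c by blast
qed

text \<open>A relation and not a function, since different expressions could name the same class of
  the quotient; a functional must then satisfy every condition listed for that class.\<close>

definition hecke_weight ::
  "nat \<Rightarrow> nat \<Rightarrow> (nat \<Rightarrow> complex) \<Rightarrow> nat set \<Rightarrow> aks_elem \<Rightarrow> complex \<Rightarrow> bool" where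
  "hecke_weight n r u D a z \<longleftrightarrow> a = aks_class n r u (scal z) \<or>
    (\<exists>i\<in>{1..<n}. a = aks_class n r u (T i) \<and> z = (if i \<in> D then - 1 else 0))"

definition aks_weight ::
  "nat \<Rightarrow> nat \<Rightarrow> (nat \<Rightarrow> complex) \<Rightarrow> nat set \<Rightarrow> (nat \<Rightarrow> nat) \<Rightarrow> aks_elem \<Rightarrow> complex \<Rightarrow> bool" where
  "aks_weight n r u D c a z \<longleftrightarrow> hecke_weight n r u D a z \<or>
    (\<exists>j\<in>{1..n}. a = aks_class n r u (\<Xi> j) \<and> z = u (c j))"

lemma Hecke0_scal:
  "aks_class n r u (scal z) \<in> carrier (Hecke0 n r u)"
  "aks_class n r u (scal (z + w)) = aks_class n r u (scal z) \<oplus>\<^bsub>Hecke0 n r u\<^esub> aks_class n r u (scal w)"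
  "aks_class n r u (scal (z * w)) = aks_class n r u (scal z) \<otimes>\<^bsub>Hecke0 n r u\<^esub> aks_class n r u (scal w)"
  "aks_class n r u (scal 1) = \<one>\<^bsub>Hecke0 n r u\<^esub>"
  by (simp_all add: Hecke0_eq aks_scal) (simp add: generate_ring.incl hecke_gens_def)

lemma hecke_gens_Hecke0: "hecke_gens n r u \<subseteq> carrier (Hecke0 n r u)"
  by (auto simp: Hecke0_eq intro: generate_ring.incl)

lemma aks_gens_closed: "aks_gens n r u \<subseteq> carrier (AKS n r u)"
  by (auto simp: aks_gens_def intro!: aks_class_closed free_alg_basic)

lemma hecke_weight_closed: "hecke_weight n r u D a z \<Longrightarrow> a \<in> carrier (Hecke0 n r u)"
  using hecke_gens_Hecke0[of n r u] by (auto simp: hecke_weight_def hecke_gens_def)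

lemma Hecke0_AKS: "a \<in> carrier (Hecke0 n r u) \<Longrightarrow> a \<in> carrier (AKS n r u)"
  using subringE(1)[OF subring_Hecke0] by blast

lemma aks_weight_closed: "aks_weight n r u D c a z \<Longrightarrow> a \<in> carrier (AKS n r u)"
  using aks_gens_closed[of n r u] by (auto simp: aks_weight_def aks_gens_def dest: hecke_weight_closed Hecke0_AKS)

lemma hecke_weight_gens: "a \<in> hecke_gens n r u \<Longrightarrow> \<exists>z. hecke_weight n r u D a z"
  by (auto simp: hecke_weight_def hecke_gens_def)

lemma aks_weight_gens: "a \<in> aks_gens n r u \<Longrightarrow> \<exists>z. aks_weight n r u D c a z"
  using hecke_weight_gens[of a n r u D]
  unfolding aks_gens_def hecke_gens_def aks_weight_def by blast

lemma hecke_weight_scal: "hecke_weight n r u D (aks_class n r u (scal z)) z"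
  by (simp add: hecke_weight_def)

lemma aks_weight_scal: "aks_weight n r u D c (aks_class n r u (scal z)) z"
  by (simp add: aks_weight_def hecke_weight_scal)

lemma eigen_functional_mono:
  assumes "eigen_functional E M \<theta>" "\<And>a z. E' a z \<Longrightarrow> E a z"
  shows "eigen_functional E' M \<theta>"
  using assms by (auto simp: eigen_functional_def)

lemma hecke_weight_unique:
  assumes \<theta>: "eigen_functional (hecke_weight n r u D) M \<theta>" and \<psi>: "eigen_functional (hecke_weight n r u D') M \<psi>"
    and eq: "\<And>x. x \<in> carrier M \<Longrightarrow> \<theta> x = z * \<psi> x" and z: "z \<noteq> 0" and x: "x \<in> carrier M" "\<psi> x = 1"
    and closed: "\<And>i. i \<in> {1..<n} \<Longrightarrow> aks_class n r u (T i) \<odot>\<^bsub>M\<^esub> x \<in> carrier M"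
    and D: "D \<subseteq> {1..<n}" "D' \<subseteq> {1..<n}"
  shows "D = D'"
proof -
  have "i \<in> D \<longleftrightarrow> i \<in> D'" if i: "i \<in> {1..<n}" for i
  proof -
    have "hecke_weight n r u D (aks_class n r u (T i)) (if i \<in> D then - 1 else 0)"
      "hecke_weight n r u D' (aks_class n r u (T i)) (if i \<in> D' then - 1 else 0)"
      using i by (auto simp: hecke_weight_def)
    from eigen_functionalD(2)[OF \<theta> this(1) x(1)] eigen_functionalD(2)[OF \<psi> this(2) x(1)]
    show ?thesis using eq[OF closed[OF i]] eq[OF x(1)] x(2) z by (auto split: if_splits)
  qed
  then show ?thesis using D by blast
qed

text \<open>The descents are determined by the eigenvalues of the \<open>T\<close>. Those of the
  \<open>\<xi>\<close> determine the colors because the \<open>u\<close> are distinct, and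
  extensionality of colorings turns agreement on the positions into equality.\<close>

lemma aks_weight_unique:
  assumes \<theta>: "eigen_functional (aks_weight n r u D c) M \<theta>" and \<psi>: "eigen_functional (aks_weight n r u D' c') M \<psi>"
    and eq: "\<And>x. x \<in> carrier M \<Longrightarrow> \<theta> x = z * \<psi> x" and z: "z \<noteq> 0" and x: "x \<in> carrier M" "\<psi> x = 1"
    and M: "left_module (AKS n r u) M" and u: "inj_on u {1..r}"
    and D: "D \<subseteq> {1..<n}" "D' \<subseteq> {1..<n}" and c: "c \<in> {1..n} \<rightarrow>\<^sub>E {1..r}" "c' \<in> {1..n} \<rightarrow>\<^sub>E {1..r}"
  shows "D = D'" "c = c'"
proof -
  have closed: "a \<odot>\<^bsub>M\<^esub> x \<in> carrier M" if "a \<in> carrier (AKS n r u)" for a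
    using left_module.smult_closed[OF M that x(1)] .
  have hw: "eigen_functional (hecke_weight n r u D) M \<theta>" "eigen_functional (hecke_weight n r u D') M \<psi>"
    using eigen_functional_mono[OF \<theta>] eigen_functional_mono[OF \<psi>] by (auto simp: aks_weight_def)
  show "D = D'"
    by (rule hecke_weight_unique[OF hw eq z x closed D]) (assumption | rule aks_class_closed free_alg_basic(4))+
  show "c = c'"
  proof (rule PiE_ext[OF c])
    fix j assume j: "j \<in> {1..n}"
    have "aks_weight n r u D c (aks_class n r u (\<Xi> j)) (u (c j))"
      "aks_weight n r u D' c' (aks_class n r u (\<Xi> j)) (u (c' j))"
      using j by (auto simp: aks_weight_def)
    from eigen_functionalD(2)[OF \<theta> this(1) x(1)] eigen_functionalD(2)[OF \<psi> this(2) x(1)]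
    have "u (c j) = u (c' j)"
      using eq[OF closed[OF aks_class_closed[OF free_alg_basic(5)[OF j]]]] eq[OF x(1)] x(2) z by simp
    moreover have "c j \<in> {1..r}" "c' j \<in> {1..r}" using c j by auto
    ultimately show "c j = c' j" using inj_onD[OF u] by blast
  qed
qed

lemma functional_of_P_Hecke0:
  assumes "is_P_Hecke0 n r u I P"
  obtains \<psi> where "eigen_functional (hecke_weight n r u (Des I)) P \<psi>" "\<exists>x\<in>carrier P. \<psi> x = 1"
    "\<And>D \<theta>. eigen_functional (hecke_weight n r u D) P \<theta> \<Longrightarrow> \<exists>z. \<forall>x\<in>carrier P. \<theta> x = z * \<psi> x"
proof (rule functional_of_unique_simple_quotient[OF assms[unfolded is_P_Hecke0_def] Hecke0_generated
      hecke_gens_Hecke0 Hecke0_scal])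
  fix N :: "(aks_elem, 'a set) module" assume N: "is_simple_Hecke0 n r u I N"
  show "one_dimensional (Hecke0 n r u) (\<lambda>z. aks_class n r u (scal z)) N"
    using N by (simp add: is_simple_Hecke0_def Let_def)
  show "acts_by (\<lambda>z. aks_class n r u (scal z)) N a z" if "hecke_weight n r u (Des I) a z" for a z
    using N that by (auto simp: is_simple_Hecke0_def Let_def hecke_weight_def) (auto simp: acts_by_def)
next
  show "hecke_weight n r u (Des I) (aks_class n r u (scal z)) z" for z by (rule hecke_weight_scal)
  show "a \<in> carrier (Hecke0 n r u)" if "hecke_weight n r u (Des I) a z" for a z
    using that by (rule hecke_weight_closed)
next
  fix \<psi> assume \<psi>: "eigen_functional (hecke_weight n r u (Des I)) P \<psi>" "\<exists>x\<in>carrier P. \<psi> x = 1"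
    and *: "\<And>E' \<theta>. eigen_functional E' P \<theta> \<Longrightarrow> (\<And>a. a \<in> hecke_gens n r u \<Longrightarrow> \<exists>z. E' a z) \<Longrightarrow>
      (\<And>z. E' (aks_class n r u (scal z)) z) \<Longrightarrow> \<exists>z. \<forall>x\<in>carrier P. \<theta> x = z * \<psi> x"
  show thesis
  proof (rule that[OF \<psi>])
    fix D \<theta> assume "eigen_functional (hecke_weight n r u D) P \<theta>"
    then show "\<exists>z. \<forall>x\<in>carrier P. \<theta> x = z * \<psi> x"
      by (rule *) (rule hecke_weight_gens hecke_weight_scal; assumption?)+
  qed
qed

lemma functional_of_P_AKS:
  assumes "is_P_AKS n r u (I, c) Q" and I: "n \<ge> 1" "composition n I"
  obtains \<psi> where "eigen_functional (aks_weight n r u (Des I) c) Q \<psi>" "\<exists>x\<in>carrier Q. \<psi> x = 1"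
    "\<And>D c' \<theta>. eigen_functional (aks_weight n r u D c') Q \<theta> \<Longrightarrow> \<exists>z. \<forall>x\<in>carrier Q. \<theta> x = z * \<psi> x"
proof (rule functional_of_unique_simple_quotient[OF assms(1)[unfolded is_P_AKS_def] AKS_generated
      aks_gens_closed aks_scal])
  fix N :: "(aks_elem, 'a set) module" assume N: "is_simple_AKS n r u (phi n (I, c)) N"
  show "one_dimensional (AKS n r u) (\<lambda>z. aks_class n r u (scal z)) N"
    using N by (simp add: is_simple_AKS_def Let_def)
  show "acts_by (\<lambda>z. aks_class n r u (scal z)) N a z" if "aks_weight n r u (Des I) c a z" for a z
    using N that
    by (auto simp: is_simple_AKS_def Let_def aks_weight_def hecke_weight_def Des_phi_phi[OF I] snd_phi)
      (auto simp: acts_by_def)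
next
  show "aks_weight n r u (Des I) c (aks_class n r u (scal z)) z" for z by (rule aks_weight_scal)
  show "a \<in> carrier (AKS n r u)" if "aks_weight n r u (Des I) c a z" for a z
    using that by (rule aks_weight_closed)
next
  fix \<psi> assume \<psi>: "eigen_functional (aks_weight n r u (Des I) c) Q \<psi>" "\<exists>x\<in>carrier Q. \<psi> x = 1"
    and *: "\<And>E' \<theta>. eigen_functional E' Q \<theta> \<Longrightarrow> (\<And>a. a \<in> aks_gens n r u \<Longrightarrow> \<exists>z. E' a z) \<Longrightarrow>
      (\<And>z. E' (aks_class n r u (scal z)) z) \<Longrightarrow> \<exists>z. \<forall>x\<in>carrier Q. \<theta> x = z * \<psi> x"
  show thesis
  proof (rule that[OF \<psi>])
    fix D c' \<theta> assume "eigen_functional (aks_weight n r u D c') Q \<theta>"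
    then show "\<exists>z. \<forall>x\<in>carrier Q. \<theta> x = z * \<psi> x"
      by (rule *) (rule aks_weight_gens aks_weight_scal; assumption?)+
  qed
qed

section \<open>Weight functionals and the Nakayama lemma\<close>

definition linear_functional ::
  "nat \<Rightarrow> nat \<Rightarrow> (nat \<Rightarrow> complex) \<Rightarrow> (aks_elem, 'b) module \<Rightarrow> ('b \<Rightarrow> complex) \<Rightarrow> bool" where
  "linear_functional n r u M \<theta> \<longleftrightarrow> additive_functional M \<theta> \<and>
    (\<forall>z. \<forall>x\<in>carrier M. \<theta> (aks_class n r u (scal z) \<odot>\<^bsub>M\<^esub> x) = z * \<theta> x)"

definition swap_color :: "nat \<Rightarrow> (nat \<Rightarrow> nat) \<Rightarrow> nat \<Rightarrow> nat" where
  "swap_color i c = c(i := c (i + 1), i + 1 := c i)"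

context
  fixes n r :: nat and u :: "nat \<Rightarrow> complex" and M :: "(aks_elem, 'b) module" and Y :: "'b set"
  assumes M: "left_module (AKS n r u) M" and Y: "submodule Y (AKS n r u) M" and u: "inj_on u {1..r}"
begin

interpretation M: left_module "AKS n r u" M by (rule M)

private abbreviation (input) act :: "free_elem \<Rightarrow> 'b \<Rightarrow> 'b" where
  "act f x \<equiv> aks_class n r u f \<odot>\<^bsub>M\<^esub> x"

private abbreviation (input) "FA \<equiv> carrier (free_alg n)"

private lemmas FA = free_alg_mult_closed free_alg_add_closed free_alg_basic

private lemma act_closed: "f \<in> FA \<Longrightarrow> x \<in> carrier M \<Longrightarrow> act f x \<in> carrier M"
  by (simp add: aks_class_closed)

private lemma act_Y: "f \<in> FA \<Longrightarrow> x \<in> Y \<Longrightarrow> act f x \<in> Y"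
  using M.submoduleD(5)[OF Y] by (simp add: aks_class_closed)

private lemma Y_M: "x \<in> Y \<Longrightarrow> x \<in> carrier M"
  using M.submoduleD(1)[OF Y] by blast

private lemma act_mult:
  "f \<in> FA \<Longrightarrow> g \<in> FA \<Longrightarrow> x \<in> carrier M \<Longrightarrow> act (f * g) x = act f (act g x)"
  by (simp add: aks_class_closed aks_class_mult M.smult_assoc1)

private lemma act_add:
  "f \<in> FA \<Longrightarrow> g \<in> FA \<Longrightarrow> x \<in> carrier M \<Longrightarrow> act (f + g) x = act f x \<oplus>\<^bsub>M\<^esub> act g x"
  by (simp add: aks_class_closed aks_class_add M.smult_l_distr)

private lemma act_one: "x \<in> carrier M \<Longrightarrow> act 1 x = x"
  by (simp add: aks_class_one)

private lemma act_relator: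
  "f - g \<in> aks_relators n r u \<Longrightarrow> g \<in> FA \<Longrightarrow> act f x = act g x"
  using aks_class_relator[of f g n r u] by simp

text \<open>Vanishing on the fixed submodule \<open>Y\<close> is built in, so these are the
  functionals of the quotient by \<open>Y\<close>. Every construction below stays among them, and so
  does the eigenvector found at the end.\<close>

private definition lin :: "('b \<Rightarrow> complex) \<Rightarrow> bool" where
  "lin \<theta> \<longleftrightarrow> linear_functional n r u M \<theta> \<and> (\<forall>x\<in>Y. \<theta> x = 0) \<and> (\<forall>x. x \<notin> carrier M \<longrightarrow> \<theta> x = 0)"

private lemma lin_plus:
  assumes "lin \<theta>" "x \<in> carrier M" "y \<in> carrier M"
  shows "\<theta> (x \<oplus>\<^bsub>M\<^esub> y) = \<theta> x + \<theta> y"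
  using assms by (simp add: lin_def linear_functional_def additive_functional_def)

private lemma lin_add:
  assumes "lin \<theta>" "f \<in> FA" "g \<in> FA" "x \<in> carrier M"
  shows "\<theta> (act (f + g) x) = \<theta> (act f x) + \<theta> (act g x)"
  using assms lin_plus[OF assms(1)] act_closed by (simp add: act_add)

private lemma lin_diff:
  assumes "lin \<theta>" "f \<in> FA" "g \<in> FA" "x \<in> carrier M"
  shows "\<theta> (act (f - g) x) = \<theta> (act f x) - \<theta> (act g x)"
  using lin_add[OF assms(1) free_alg_add_closed(2)[OF assms(2,3)] assms(3,4)] by simp

private lemma lin_scal:
  assumes "lin \<theta>" "x \<in> carrier M"
  shows "\<theta> (act (scal z) x) = z * \<theta> x"
  using assms by (simp add: lin_def linear_functional_def)

private lemma lin_zero: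
  assumes "lin \<theta>" "x \<in> carrier M"
  shows "\<theta> (act 0 x) = 0"
  using lin_scal[OF assms, of 0] by (simp add: scal_def)

text \<open>Functionals are normalized to vanish outside the carrier, so that equal ones are equal as
  functions and the rewriting of words below yields equations.\<close>

private definition twist :: "free_elem \<Rightarrow> complex \<Rightarrow> ('b \<Rightarrow> complex) \<Rightarrow> 'b \<Rightarrow> complex" where
  "twist f z \<theta> x = (if x \<in> carrier M then \<theta> (act f x) + z * \<theta> x else 0)"

text \<open>Linearity is kept because scalars are central in the free algebra, and vanishing on
  \<open>Y\<close> because \<open>Y\<close> is a submodule.\<close>

private lemma lin_twist:
  assumes \<theta>: "lin \<theta>" and f: "f \<in> FA"
  shows "lin (twist f z \<theta>)"
proof -
  have "act f (act (scal w) x) = act (scal w) (act f x)" if "x \<in> carrier M" for w x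
    using act_mult[OF f free_alg_basic(3) that] act_mult[OF free_alg_basic(3) f that]
      scal_commute[of w f] by metis
  then have "linear_functional n r u M (twist f z \<theta>)"
    using lin_plus[OF \<theta>] act_closed[OF f] act_closed[OF free_alg_basic(3)] lin_scal[OF \<theta>]
    by (auto simp: linear_functional_def additive_functional_def twist_def M.smult_r_distr aks_class_closed f algebra_simps)
  moreover have "\<forall>x\<in>Y. twist f z \<theta> x = 0"
    using \<theta> act_Y[OF f] by (auto simp: lin_def twist_def)
  ultimately show ?thesis by (auto simp: lin_def twist_def)
qed

private lemma T_quadratic:
  assumes "lin \<theta>" "i \<in> {1..<n}" "x \<in> carrier M"
  shows "\<theta> (act (T i) (act (T i) x)) = - \<theta> (act (T i) x)"
proof -
  have T: "T i \<in> FA" using assms by (intro FA)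
  have "T i * (T i + 1) - 0 \<in> aks_relators n r u"
    using assms(2) by (auto simp: aks_relators_def)
  then have "act (T i * (T i + 1)) x = act 0 x" by (rule act_relator) (rule FA)
  moreover have "act (T i * (T i + 1)) x = act (T i * T i + T i) x" by (simp add: distrib_left)
  ultimately have "\<theta> (act (T i * T i) x) + \<theta> (act (T i) x) = 0"
    using lin_add[OF assms(1) _ T assms(3), of "T i * T i"] lin_zero[OF assms(1,3)] free_alg_mult_closed[OF T T]
    by simp
  then show ?thesis using act_mult[OF T T assms(3)] by (simp add: eq_neg_iff_add_eq_0)
qed

private lemma T_braid:
  assumes "i \<in> {1..<n}" "i + 1 \<in> {1..<n}" "x \<in> carrier M"
  shows "act (T i) (act (T (i+1)) (act (T i) x)) = act (T (i+1)) (act (T i) (act (T (i+1)) x))"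
proof -
  have T: "T i \<in> FA" "T (i+1) \<in> FA" using assms by (intro FA; simp)+
  have "T i * T (i+1) * T i - T (i+1) * T i * T (i+1) \<in> aks_relators n r u"
    using assms(1,2) unfolding aks_relators_def by blast
  then have "act (T i * T (i+1) * T i) x = act (T (i+1) * T i * T (i+1)) x"
    by (rule act_relator) (intro FA T)
  then show ?thesis using T assms(3) by (simp add: act_mult FA act_closed del: One_nat_def)
qed

private lemma T_commute:
  assumes "i \<in> {1..<n}" "j \<in> {1..<n}" "i + 2 \<le> j \<or> j + 2 \<le> i" "x \<in> carrier M"
  shows "act (T i) (act (T j) x) = act (T j) (act (T i) x)"
proof -
  have T: "T i \<in> FA" "T j \<in> FA" using assms by (intro FA; simp)+
  have "T i * T j - T j * T i \<in> aks_relators n r u"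
    using assms(1,2,3) unfolding aks_relators_def by blast
  then have "act (T i * T j) x = act (T j * T i) x"
    by (rule act_relator) (intro FA T)
  then show ?thesis using T assms(4) by (simp add: act_mult)
qed

private lemma Xi_commute:
  assumes "i \<in> {1..n}" "j \<in> {1..n}" "x \<in> carrier M"
  shows "act (\<Xi> i) (act (\<Xi> j) x) = act (\<Xi> j) (act (\<Xi> i) x)"
proof -
  have X: "\<Xi> i \<in> FA" "\<Xi> j \<in> FA" using assms by (intro FA; simp)+
  have "\<Xi> i * \<Xi> j - \<Xi> j * \<Xi> i \<in> aks_relators n r u"
    using assms(1,2) unfolding aks_relators_def by blast
  then have "act (\<Xi> i * \<Xi> j) x = act (\<Xi> j * \<Xi> i) x"
    by (rule act_relator) (intro FA X)
  then show ?thesis using X assms(3) by (simp add: act_mult)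
qed

private lemma T_Xi_commute:
  assumes "i \<in> {1..<n}" "j \<in> {1..n}" "j \<noteq> i" "j \<noteq> i + 1" "x \<in> carrier M"
  shows "act (T i) (act (\<Xi> j) x) = act (\<Xi> j) (act (T i) x)"
proof -
  have X: "T i \<in> FA" "\<Xi> j \<in> FA" using assms by (intro FA; simp)+
  have "T i * \<Xi> j - \<Xi> j * T i \<in> aks_relators n r u"
    using assms(1-4) unfolding aks_relators_def by blast
  then have "act (T i * \<Xi> j) x = act (\<Xi> j * T i) x"
    by (rule act_relator) (intro FA X)
  then show ?thesis using X assms(5) by (simp add: act_mult)
qed

private lemma T_Xi_sum:
  assumes \<theta>: "lin \<theta>" and i: "i \<in> {1..<n}" and x: "x \<in> carrier M"
  shows "\<theta> (act (T i) (act (\<Xi> (i+1)) x)) + \<theta> (act (T i) (act (\<Xi> i) x)) =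
    \<theta> (act (\<Xi> (i+1)) (act (T i) x)) + \<theta> (act (\<Xi> i) (act (T i) x))"
proof -
  have X: "T i \<in> FA" "\<Xi> i \<in> FA" "\<Xi> (i+1) \<in> FA" using i by (intro FA; simp)+
  note mc = free_alg_mult_closed
  have "T i * (\<Xi> (i+1) + \<Xi> i) - (\<Xi> (i+1) + \<Xi> i) * T i \<in> aks_relators n r u"
    using i unfolding aks_relators_def by blast
  then have "act (T i * (\<Xi> (i+1) + \<Xi> i)) x = act ((\<Xi> (i+1) + \<Xi> i) * T i) x"
    by (rule act_relator) (intro FA X)
  then have "\<theta> (act (T i * \<Xi> (i+1) + T i * \<Xi> i) x) = \<theta> (act (\<Xi> (i+1) * T i + \<Xi> i * T i) x)"
    by (simp add: distrib_left distrib_right)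
  then show ?thesis
    using lin_add[OF \<theta> mc mc x] X x act_mult by (simp del: One_nat_def)
qed

section \<open>Color weights and the operators \<open>\<tau>_i\<close>\<close>

private definition evaluates :: "('b \<Rightarrow> complex) \<Rightarrow> free_elem \<Rightarrow> complex \<Rightarrow> bool" where
  "evaluates \<theta> f z \<longleftrightarrow> f \<in> FA \<and> (\<forall>x\<in>carrier M. \<theta> (act f x) = z * \<theta> x)"

private lemma evaluates_mult:
  assumes "evaluates \<theta> f z" "evaluates \<theta> g w"
  shows "evaluates \<theta> (f * g) (z * w)"
  using assms by (auto simp: evaluates_def FA act_mult act_closed)

private lemma evaluates_add:
  assumes "lin \<theta>" "evaluates \<theta> f z" "evaluates \<theta> g w"
  shows "evaluates \<theta> (f + g) (z + w)"
  using assms by (auto simp: evaluates_def FA lin_add distrib_right)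

private lemma evaluates_diff:
  assumes "lin \<theta>" "evaluates \<theta> f z" "evaluates \<theta> g w"
  shows "evaluates \<theta> (f - g) (z - w)"
  using assms by (auto simp: evaluates_def FA lin_diff left_diff_distrib)

private lemma evaluates_scal: "lin \<theta> \<Longrightarrow> evaluates \<theta> (scal z) z"
  by (simp add: evaluates_def FA lin_scal)

private lemma evaluates_sum:
  assumes "lin \<theta>" "\<And>a. a \<in> A \<Longrightarrow> evaluates \<theta> (f a) (z a)"
  shows "evaluates \<theta> (sum f A) (sum z A)"
proof -
  have zero: "evaluates \<theta> 0 0" using evaluates_scal[OF assms(1), of 0] by (simp add: scal_def)
  show ?thesis
    using assms(2)
    by (induction A rule: infinite_finite_induct) (auto simp: zero intro: evaluates_add[OF assms(1)])
qed

private lemma evaluates_prod_list: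
  assumes "lin \<theta>" "\<And>a. a \<in> set xs \<Longrightarrow> evaluates \<theta> (f a) (z a)"
  shows "evaluates \<theta> (\<Prod>a\<leftarrow>xs. f a) (\<Prod>a\<leftarrow>xs. z a)"
  using assms(2)
proof (induction xs)
  case Nil
  show ?case using evaluates_scal[OF assms(1), of 1] by (simp add: scal_one)
qed (simp add: evaluates_mult)

text \<open>On an eigenvector with eigenvalue \<open>u l\<close> the interpolation polynomial takes
  its value at this node. For \<open>l = k\<close> every factor is 1, where distinctness of the
  nodes keeps the denominators nonzero; otherwise the factor for \<open>l\<close> vanishes.\<close>

private lemma evaluates_lagrange:
  assumes \<theta>: "lin \<theta>" and k: "k \<in> {1..r}" and l: "l \<in> {1..r}" and f: "evaluates \<theta> f (u l)"
  shows "evaluates \<theta> (lagrange r u k f) (if k = l then 1 else 0)"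
proof -
  let ?ls = "filter (\<lambda>l. l \<noteq> k) [1..<Suc r]"
  let ?z = "\<Prod>m\<leftarrow>?ls. 1 / (u k - u m) * (u l - u m)"
  have "evaluates \<theta> (lagrange r u k f) ?z"
    unfolding lagrange_def
    by (intro evaluates_prod_list \<theta> evaluates_mult evaluates_diff evaluates_scal f)
  moreover have "?z = (if k = l then 1 else 0)"
  proof (cases "k = l")
    case True
    have "1 / (u k - u m) * (u l - u m) = 1" if "m \<in> set ?ls" for m
      using that True inj_onD[OF u, of k m] k by auto
    then have "?z = (\<Prod>m\<leftarrow>?ls. 1)" by (intro arg_cong[of _ _ prod_list] map_cong refl)
    then show ?thesis using True by (simp add: map_replicate_const)
  next
    case False
    then have "l \<in> set ?ls" using l by auto
    then have "0 \<in> set (map (\<lambda>m. 1 / (u k - u m) * (u l - u m)) ?ls)" by force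
    then show ?thesis using False by (simp only: prod_list_zero_iff if_False)
  qed
  ultimately show ?thesis by simp
qed

private definition weight :: "(nat \<Rightarrow> nat) \<Rightarrow> ('b \<Rightarrow> complex) \<Rightarrow> bool" where
  "weight c \<theta> \<longleftrightarrow> lin \<theta> \<and> (\<forall>j\<in>{1..n}. c j \<in> {1..r} \<and> evaluates \<theta> (\<Xi> j) (u (c j)))"

private lemma weightD:
  assumes "weight c \<theta>"
  shows "lin \<theta>" "\<And>j. j \<in> {1..n} \<Longrightarrow> c j \<in> {1..r}"
    "\<And>j. j \<in> {1..n} \<Longrightarrow> evaluates \<theta> (\<Xi> j) (u (c j))"
    "\<And>j x. j \<in> {1..n} \<Longrightarrow> x \<in> carrier M \<Longrightarrow> \<theta> (act (\<Xi> j) x) = u (c j) * \<theta> x"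
  using assms by (auto simp: weight_def evaluates_def)

text \<open>Of the correction sum only the term for the pair \<open>(c i, c (i+1))\<close> can
  survive the interpolation, and this pair lies in the index set exactly when
  \<open>c i < c (i+1)\<close>.\<close>

private lemma T_Xi_weight:
  assumes \<theta>: "weight c \<theta>" and i: "i \<in> {1..<n}" and x: "x \<in> carrier M"
  shows "\<theta> (act (T i) (act (\<Xi> i) x)) = u (c (i+1)) * \<theta> (act (T i) x) +
    (if c i < c (i+1) then (u (c (i+1)) - u (c i)) * \<theta> x else 0)"
proof -
  note W = weightD[OF \<theta>]
  let ?A = "{(a, b). 1 \<le> a \<and> a < b \<and> b \<le> r}"
  let ?g = "\<lambda>(a, b). scal (u b - u a) * lagrange r u a (\<Xi> i) * lagrange r u b (\<Xi> (i+1))"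
  let ?z = "\<lambda>(a, b). (u b - u a) * (if a = c i then 1 else 0) * (if b = c (i+1) then 1 else 0)"
  have ij: "i \<in> {1..n}" "i + 1 \<in> {1..n}" using i by auto
  have X: "T i \<in> FA" "\<Xi> i \<in> FA" "\<Xi> (i+1) \<in> FA" using i by (intro FA; simp)+
  have "evaluates \<theta> (sum ?g ?A) (sum ?z ?A)"
  proof (rule evaluates_sum[OF W(1)])
    fix p assume "p \<in> ?A"
    then obtain a b where p: "p = (a, b)" "a \<in> {1..r}" "b \<in> {1..r}" by auto
    show "evaluates \<theta> (?g p) (?z p)"
      unfolding p(1) prod.case
      by (intro evaluates_mult evaluates_scal evaluates_lagrange W p ij)
  qed
  moreover have "sum ?z ?A = (if c i < c (i+1) then u (c (i+1)) - u (c i) else 0)"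
  proof -
    have fin: "finite ?A" by (rule finite_subset[of _ "{..r} \<times> {..r}"]) auto
    have "sum ?z ?A = (\<Sum>p\<in>?A. if p = (c i, c (i+1)) then u (c (i+1)) - u (c i) else 0)"
      by (intro sum.cong) (auto split: if_splits)
    also have "\<dots> = (if (c i, c (i+1)) \<in> ?A then u (c (i+1)) - u (c i) else 0)"
      using fin by (simp only: sum.delta)
    finally show ?thesis using W(2)[OF ij(1)] W(2)[OF ij(2)] by auto
  qed
  ultimately have S: "evaluates \<theta> (sum ?g ?A) (if c i < c (i+1) then u (c (i+1)) - u (c i) else 0)"
    by simp
  then have SF: "sum ?g ?A \<in> FA" by (simp only: evaluates_def)
  have "T i * \<Xi> i - (\<Xi> (i+1) * T i + sum ?g ?A) \<in> aks_relators n r u"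
    using i unfolding aks_relators_def by blast
  then have "act (T i * \<Xi> i) x = act (\<Xi> (i+1) * T i + sum ?g ?A) x"
    by (rule act_relator) (intro FA X SF)
  then have "\<theta> (act (T i) (act (\<Xi> i) x)) = \<theta> (act (\<Xi> (i+1)) (act (T i) x)) + \<theta> (act (sum ?g ?A) x)"
    using lin_add[OF W(1) free_alg_mult_closed[OF X(3,1)] SF x] act_mult[OF X(1,2) x] act_mult[OF X(3,1) x]
    by simp
  then show ?thesis
    using W(4)[OF ij(2) act_closed[OF X(1) x]] S x by (simp add: evaluates_def)
qed

text \<open>This is the action of \<open>\<tau>\<^sub>i\<close>, with the weight recorded alongside the functional.\<close>

private definition step :: "nat \<Rightarrow> (nat \<Rightarrow> nat) \<times> ('b \<Rightarrow> complex) \<Rightarrow> (nat \<Rightarrow> nat) \<times> ('b \<Rightarrow> complex)" where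
  "step i = (\<lambda>(c, \<theta>). (swap_color i c, twist (T i) (if c i < c (i+1) then 1 else 0) \<theta>))"

private lemma twist_apply: "x \<in> carrier M \<Longrightarrow> twist f z \<theta> x = \<theta> (act f x) + z * \<theta> x"
  by (simp add: twist_def)

text \<open>For \<open>\<Xi> i\<close> the part of the new functional coming from \<open>T i\<close>
  has eigenvalue \<open>u (c (i+1))\<close> up to the correction term. When the added constant is 1,
  the correction changes the eigenvalue \<open>u (c i)\<close> of the constant part into the same
  \<open>u (c (i+1))\<close>; otherwise both are absent.\<close>

private lemma weight_step:
  assumes \<theta>: "weight c \<theta>" and i: "i \<in> {1..<n}"
  shows "weight (fst (step i (c, \<theta>))) (snd (step i (c, \<theta>)))"
proof -
  note W = weightD[OF \<theta>]
  let ?\<gamma> = "if c i < c (i+1) then 1 else 0 :: complex"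
  let ?\<theta> = "twist (T i) ?\<gamma> \<theta>"
  have ij: "i \<in> {1..n}" "i + 1 \<in> {1..n}" and T: "T i \<in> FA" using i by (auto intro: FA)
  have "?\<theta> (act (\<Xi> j) x) = u (swap_color i c j) * ?\<theta> x" if j: "j \<in> {1..n}" and x: "x \<in> carrier M" for j x
  proof -
    have Xx: "act (\<Xi> j) x \<in> carrier M" using j x by (intro act_closed FA)
    have Tx: "act (T i) x \<in> carrier M" using T x by (intro act_closed)
    consider "j = i" | "j = i + 1" | "j \<noteq> i" "j \<noteq> i + 1" by blast
    then show ?thesis
    proof cases
      case 1
      show ?thesis
        unfolding twist_apply[OF Xx] twist_apply[OF x]
        using T_Xi_weight[OF \<theta> i x] W(4)[OF ij(1) x]
        by (simp add: 1 swap_color_def algebra_simps)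
    next
      case 2
      \<comment> \<open>The eigenvalue for \<open>i + 1\<close> follows from the one for
        \<open>i\<close>, because \<open>T i\<close> commutes with the sum of the two
        \<open>\<Xi>\<close>.\<close>
      have "\<theta> (act (T i) (act (\<Xi> (i+1)) x)) = u (c i) * \<theta> (act (T i) x) -
          (if c i < c (i+1) then (u (c (i+1)) - u (c i)) * \<theta> x else 0)"
        using T_Xi_sum[OF W(1) i x] T_Xi_weight[OF \<theta> i x] W(4)[OF ij(1) Tx] W(4)[OF ij(2) Tx]
        by (simp add: algebra_simps)
      then show ?thesis
        unfolding twist_apply[OF Xx] twist_apply[OF x]
        using W(4)[OF ij(2) x]
        by (cases "c i < c (i+1)") (simp_all add: 2 swap_color_def algebra_simps)
    next
      case 3
      then show ?thesis
        using T_Xi_commute[OF i j 3 x] W(4)[OF j x] W(4)[OF j Tx]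
        by (simp add: twist_apply[OF Xx] twist_apply[OF x] swap_color_def algebra_simps)
    qed
  qed
  moreover have "swap_color i c j \<in> {1..r}" if "j \<in> {1..n}" for j
    using W(2)[OF that] W(2)[OF ij(1)] W(2)[OF ij(2)] by (auto simp: swap_color_def)
  ultimately show ?thesis
    using lin_twist[OF W(1) T] by (auto simp: weight_def evaluates_def step_def FA)
qed

private lemma step_commute:
  assumes ij: "i \<in> {1..<n}" "j \<in> {1..<n}" "i + 2 \<le> j"
  shows "step i (step j (c, \<theta>)) = step j (step i (c, \<theta>))"
proof -
  have T: "T i \<in> FA" "T j \<in> FA" using ij by (intro FA; simp)+
  have "swap_color i (swap_color j c) = swap_color j (swap_color i c)"
    using ij(3) by (auto simp: swap_color_def fun_eq_iff)
  moreover have "twist (T i) z (twist (T j) w \<theta>) = twist (T j) w (twist (T i) z \<theta>)" for z w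
    using T_commute[OF ij(1,2)] ij(3) T by (auto simp: twist_def act_closed algebra_simps fun_eq_iff)
  ultimately show ?thesis
    using ij(3) by (simp add: step_def) (simp add: swap_color_def)
qed

text \<open>Along the two words the constants are the comparisons of the three colors, met in
  opposite orders \<open>\<alpha>, \<beta>, \<gamma>\<close> and
  \<open>\<gamma>, \<beta>, \<alpha>\<close>. The cubic terms cancel by the braid relation of the
  \<open>T\<close>, the mixed quadratic ones agree, and with the squares reduced only
  \<open>\<alpha> * \<beta> + \<beta> * \<gamma> - \<alpha> * \<gamma> - \<beta>\<close> times a
  linear difference remains. This coefficient is zero by transitivity of the order on
  colors.\<close>

private lemma step_braid:
  assumes \<theta>: "weight c \<theta>" and i: "i \<in> {1..<n}" "i + 1 \<in> {1..<n}"
  shows "step i (step (i+1) (step i (c, \<theta>))) = step (i+1) (step i (step (i+1) (c, \<theta>)))"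
proof -
  have T: "T i \<in> FA" "T (i+1) \<in> FA" using i by (intro FA; simp)+
  note lin = weightD(1)[OF \<theta>]
  define \<alpha> where "\<alpha> = (if c i < c (i+1) then 1 else 0 :: complex)"
  define \<beta> where "\<beta> = (if c i < c (i+2) then 1 else 0 :: complex)"
  define \<gamma> where "\<gamma> = (if c (i+1) < c (i+2) then 1 else 0 :: complex)"
  have rel: "\<alpha> * \<beta> + \<beta> * \<gamma> - \<alpha> * \<gamma> = \<beta>"
    by (simp add: \<alpha>_def \<beta>_def \<gamma>_def)
  have "twist (T i) \<gamma> (twist (T (i+1)) \<beta> (twist (T i) \<alpha> \<theta>)) x =
      twist (T (i+1)) \<alpha> (twist (T i) \<beta> (twist (T (i+1)) \<gamma> \<theta>)) x" for x
  proof (cases "x \<in> carrier M")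
    case x: True
    note q = T_quadratic[OF lin i(1) x] T_quadratic[OF lin i(2) x]
    let ?a = "\<theta> (act (T i) x)" and ?b = "\<theta> (act (T (i+1)) x)"
    have "twist (T i) \<gamma> (twist (T (i+1)) \<beta> (twist (T i) \<alpha> \<theta>)) x -
      twist (T (i+1)) \<alpha> (twist (T i) \<beta> (twist (T (i+1)) \<gamma> \<theta>)) x =
      (\<alpha> * \<beta> + \<beta> * \<gamma> - \<alpha> * \<gamma> - \<beta>) * (?a - ?b)"
      using x T T_braid[OF i x] q by (simp add: twist_apply act_closed algebra_simps)
    then show ?thesis using rel by simp
  qed (simp add: twist_def)
  then have "twist (T i) \<gamma> (twist (T (i+1)) \<beta> (twist (T i) \<alpha> \<theta>)) =
      twist (T (i+1)) \<alpha> (twist (T i) \<beta> (twist (T (i+1)) \<gamma> \<theta>))" by blast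
  moreover have "swap_color i (swap_color (i+1) (swap_color i c)) =
      swap_color (i+1) (swap_color i (swap_color (i+1) c))"
    by (auto simp: swap_color_def fun_eq_iff)
  moreover have "step i (step (i+1) (step i (c, \<theta>))) = (swap_color i (swap_color (i+1) (swap_color i c)),
      twist (T i) \<gamma> (twist (T (i+1)) \<beta> (twist (T i) \<alpha> \<theta>)))"
    "step (i+1) (step i (step (i+1) (c, \<theta>))) = (swap_color (i+1) (swap_color i (swap_color (i+1) c)),
      twist (T (i+1)) \<alpha> (twist (T i) \<beta> (twist (T (i+1)) \<gamma> \<theta>)))"
    by (simp_all add: step_def swap_color_def \<alpha>_def \<beta>_def \<gamma>_def)
  ultimately show ?thesis by simp
qed

text \<open>The first step exchanges the colors, so the two constants are the indicators of
  \<open>c i < c (i+1)\<close> and of \<open>c (i+1) < c i\<close>. For equal colors both are 0 and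
  the square of \<open>T i\<close> is its negative; otherwise exactly one is 1, and the product of
  \<open>T i\<close> and \<open>T i + 1\<close> is zero.\<close>

private lemma step_step:
  assumes \<theta>: "weight c \<theta>" and i: "i \<in> {1..<n}"
  shows "snd (step i (step i (c, \<theta>))) x = (if c i = c (i+1) then - snd (step i (c, \<theta>)) x else 0)"
proof (cases "x \<in> carrier M")
  case x: True
  have T: "T i \<in> FA" using i by (intro FA)
  show ?thesis
    using x T_quadratic[OF weightD(1)[OF \<theta>] i x] T
    by (auto simp: step_def twist_apply act_closed swap_color_def algebra_simps)
qed (simp add: step_def twist_def)

text \<open>Functionals carry a right action, so the first letter of a word is applied
  first.\<close>

private definition run :: "(nat \<Rightarrow> nat) \<times> ('b \<Rightarrow> complex) \<Rightarrow> nat list \<Rightarrow> (nat \<Rightarrow> nat) \<times> ('b \<Rightarrow> complex)" where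
  "run = foldl (\<lambda>p i. step i p)"

private abbreviation (input) "wt p \<equiv> weight (fst p) (snd p)"

private lemma run_append: "run p (v @ w) = run (run p v) w"
  by (simp add: run_def)

private lemma weight_run: "wt p \<Longrightarrow> set w \<subseteq> {1..<n} \<Longrightarrow> wt (run p w)"
proof (induction w rule: rev_induct)
  case (snoc i w)
  then show ?case
    using weight_step[of "fst (run p w)" "snd (run p w)" i] by (simp add: run_def)
qed (simp add: run_def)

private lemma run_braid_eq:
  assumes "braid_eq v w" "wt p" "set v \<subseteq> {1..<n}"
  shows "run p v = run p w"
  using assms
proof (induction arbitrary: p rule: braid_eq.induct)
  case (braid_eq_sym v w)
  then show ?case using braid_eq_set[OF braid_eq_sym.hyps] by simp
next
  case (braid_eq_trans v w x)
  then show ?case using braid_eq_set[OF braid_eq_trans.hyps(1)] by simp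
next
  case (braid_eq_context v w a b)
  have "run (run p a) v = run (run p a) w"
    using braid_eq_context.prems by (intro braid_eq_context.IH weight_run) auto
  then show ?case by (simp add: run_append)
next
  case (braid_eq_commute i j)
  then show ?case using step_commute[of i j "fst p" "snd p"] by (simp add: run_def)
next
  case (braid_eq_braid i)
  then show ?case using step_braid[of "fst p" "snd p" i] by (simp add: run_def)
qed simp

section \<open>Existence of joint eigenvectors\<close>

private definition nonzero :: "('b \<Rightarrow> complex) \<Rightarrow> bool" where
  "nonzero \<theta> \<longleftrightarrow> (\<exists>x. \<theta> x \<noteq> 0)"

text \<open>Factors of the relation for \<open>\<xi>\<^sub>j\<close> are applied as long as the result is nonzero.\<close>

private lemma weight_extend:
  assumes "lin \<theta>" "nonzero \<theta>" "j \<in> {1..n}" "J \<subseteq> {1..n}"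
    and "\<And>k. k \<in> J \<Longrightarrow> evaluates \<theta> (\<Xi> k) (z k)"
    and "set ls \<subseteq> {1..r}" "\<And>x. x \<in> carrier M \<Longrightarrow> \<theta> (act (\<Prod>l\<leftarrow>ls. \<Xi> j - scal (u l)) x) = 0"
  shows "\<exists>\<eta> l. lin \<eta> \<and> nonzero \<eta> \<and> l \<in> {1..r} \<and> evaluates \<eta> (\<Xi> j) (u l) \<and>
    (\<forall>k\<in>J. evaluates \<eta> (\<Xi> k) (z k))"
  using assms
proof (induction ls arbitrary: \<theta>)
  case Nil
  then have "\<theta> x = 0" for x
    by (cases "x \<in> carrier M") (auto simp: act_one lin_def)
  then show ?case using Nil.prems(2) by (simp add: nonzero_def)
next
  case (Cons l ls)
  let ?\<eta> = "twist (\<Xi> j) (- u l) \<theta>"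
  have X: "\<Xi> j \<in> FA" using Cons.prems by (intro FA)
  have Xl: "\<Xi> j - scal (u l) \<in> FA" by (intro FA X)
  have act_l: "?\<eta> x = \<theta> (act (\<Xi> j - scal (u l)) x)" if "x \<in> carrier M" for x
    using lin_diff[OF Cons.prems(1) X free_alg_basic(3) that] lin_scal[OF Cons.prems(1) that]
    by (simp add: twist_apply[OF that])
  show ?case
  proof (cases "nonzero ?\<eta>")
    case True
    have P: "(\<Prod>l\<leftarrow>ls. \<Xi> j - scal (u l)) \<in> FA" by (intro free_alg_prod_list FA X)
    show ?thesis
    proof (rule Cons.IH[OF lin_twist[OF Cons.prems(1) X] True Cons.prems(3,4)])
      fix k assume k: "k \<in> J"
      then have kn: "k \<in> {1..n}" using Cons.prems(4) by blast
      then have Xk: "\<Xi> k \<in> FA" by (intro FA)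
      have e: "\<theta> (act (\<Xi> k) y) = z k * \<theta> y" if "y \<in> carrier M" for y
        using Cons.prems(5)[OF k] that by (simp add: evaluates_def)
      show "evaluates ?\<eta> (\<Xi> k) (z k)"
        using e Xi_commute[OF \<open>j \<in> {1..n}\<close> kn] Xk X
        by (auto simp: evaluates_def twist_apply act_closed algebra_simps)
    next
      fix x assume x: "x \<in> carrier M"
      have "act (\<Xi> j - scal (u l)) (act (\<Prod>l\<leftarrow>ls. \<Xi> j - scal (u l)) x) =
          act (\<Prod>l\<leftarrow>l # ls. \<Xi> j - scal (u l)) x"
        using act_mult[OF Xl P x] by simp
      then show "?\<eta> (act (\<Prod>l\<leftarrow>ls. \<Xi> j - scal (u l)) x) = 0"
        using act_l[OF act_closed[OF P x]] Cons.prems(7)[OF x] by simp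
    qed (use Cons.prems(6) in auto)
  next
    case False
    then have "\<theta> (act (\<Xi> j) x) = u l * \<theta> x" if "x \<in> carrier M" for x
      using twist_apply[OF that, of "\<Xi> j" "- u l" \<theta>] by (simp add: nonzero_def)
    then show ?thesis
      using Cons.prems X by (intro exI[of _ \<theta>] exI[of _ l]) (auto simp: evaluates_def)
  qed
qed

text \<open>The \<open>\<Xi>\<close> are treated one after another: they commute, so making the
  functional an eigenvector for the next one keeps the eigenvalues already found.\<close>

private lemma weight_exists:
  assumes "lin \<theta>" "nonzero \<theta>"
  shows "\<exists>c \<eta>. weight c \<eta> \<and> nonzero \<eta>"
proof -
  have "\<exists>c \<eta>. lin \<eta> \<and> nonzero \<eta> \<and> (\<forall>k\<in>{1..m}. c k \<in> {1..r} \<and> evaluates \<eta> (\<Xi> k) (u (c k)))" if "m \<le> n" for m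
    using that
  proof (induction m)
    case 0
    then show ?case using assms by auto
  next
    case (Suc m)
    then have "\<exists>c \<eta>. lin \<eta> \<and> nonzero \<eta> \<and> (\<forall>k\<in>{1..m}. c k \<in> {1..r} \<and> evaluates \<eta> (\<Xi> k) (u (c k)))"
      by simp
    then obtain c \<eta> where \<eta>: "lin \<eta>" "nonzero \<eta>"
      "\<forall>k\<in>{1..m}. c k \<in> {1..r} \<and> evaluates \<eta> (\<Xi> k) (u (c k))"
      by blast
    have j: "Suc m \<in> {1..n}" using Suc.prems by simp
    have "(\<Prod>l\<leftarrow>[1..<Suc r]. \<Xi> (Suc m) - scal (u l)) - 0 \<in> aks_relators n r u"
      unfolding aks_relators_def diff_zero using j by blast
    then have "act (\<Prod>l\<leftarrow>[1..<Suc r]. \<Xi> (Suc m) - scal (u l)) x = act 0 x" for x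
      by (rule act_relator) (rule FA)
    then have "\<exists>\<eta>' l. lin \<eta>' \<and> nonzero \<eta>' \<and> l \<in> {1..r} \<and> evaluates \<eta>' (\<Xi> (Suc m)) (u l) \<and>
        (\<forall>k\<in>{1..m}. evaluates \<eta>' (\<Xi> k) (u (c k)))"
      using \<eta> Suc.prems lin_zero[OF \<eta>(1)]
      by (intro weight_extend[where ls = "[1..<Suc r]" and \<theta> = \<eta>]) auto
    then obtain \<eta>' l where "lin \<eta>'" "nonzero \<eta>'" "l \<in> {1..r}" "evaluates \<eta>' (\<Xi> (Suc m)) (u l)"
      "\<forall>k\<in>{1..m}. evaluates \<eta>' (\<Xi> k) (u (c k))" by blast
    then show ?case
      using \<eta>(3) by (intro exI[of _ "c(Suc m := l)"] exI[of _ \<eta>']) (auto simp: le_Suc_eq)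
  qed
  from this[of n] show ?thesis by (auto simp: weight_def)
qed

text \<open>Let \<open>\<eta>\<close> be the nonzero result of a longest normal word
  \<open>w\<close> that does not kill every weight functional. Appending \<open>i\<close> gives, up
  to braid relations, either a longer normal word, which kills by maximality, so that
  \<open>\<tau>_i\<close> kills \<open>\<eta>\<close>; or \<open>w\<close> can be rewritten to end
  in \<open>i\<close>, so that \<open>\<eta>\<close> lies in the image of \<open>\<tau>_i\<close>.
  In both cases \<open>\<tau>_i\<close>, and hence \<open>T_i\<close>, acts on \<open>\<eta>\<close>
  by a scalar.\<close>

lemma eigen_functional_of_linear_functional:
  assumes \<theta>: "linear_functional n r u M \<theta>" "\<forall>x\<in>Y. \<theta> x = 0" and nz: "\<exists>x\<in>carrier M. \<theta> x \<noteq> 0"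
  obtains D c \<eta> where "D \<subseteq> {1..<n}" "c \<in> {1..n} \<rightarrow>\<^sub>E {1..r}"
    "\<And>i. i \<in> {1..<n} \<Longrightarrow> (i \<notin> D \<longrightarrow> c i \<ge> c (i+1)) \<and> (i \<in> D \<longrightarrow> c i \<le> c (i+1))"
    "eigen_functional (aks_weight n r u D c) M \<eta>" "\<And>x. x \<in> Y \<Longrightarrow> \<eta> x = 0" "\<exists>x\<in>carrier M. \<eta> x \<noteq> 0"
proof -
  let ?\<theta> = "\<lambda>x. if x \<in> carrier M then \<theta> x else 0"
  have "lin ?\<theta>"
    using \<theta> Y_M act_closed[OF free_alg_basic(3)]
    by (auto simp: lin_def linear_functional_def additive_functional_def)
  moreover have "nonzero ?\<theta>" using nz by (auto simp: nonzero_def)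
  ultimately obtain c0 \<eta>0 where w0: "weight c0 \<eta>0" "nonzero \<eta>0" using weight_exists by blast
  define S where "S = {w \<in> normal_words (n - 1). \<exists>p. wt p \<and> nonzero (snd (run p w))}"
  have "finite S" using finite_normal_words[of "n - 1"] by (simp add: S_def)
  moreover have "[] \<in> S"
    using w0 Nil_normal by (auto simp: S_def run_def intro!: exI[of _ "(c0, \<eta>0)"])
  ultimately have "\<exists>w\<in>S. \<forall>v\<in>S. length v \<le> length w"
    using Max_in[of "length ` S"] Max_ge[of "length ` S"] by (metis (no_types, lifting) empty_iff finite_imageI image_iff image_is_empty)
  then obtain w where w: "w \<in> S" "\<And>v. v \<in> S \<Longrightarrow> length v \<le> length w" by blast
  then obtain p where p: "wt p" "nonzero (snd (run p w))" and wn: "w \<in> normal_words (n - 1)"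
    by (auto simp: S_def)
  have "{1..n - 1} \<subseteq> {1..<n}" by auto
  then have wset: "set w \<subseteq> {1..<n}" using set_normal_words[OF wn] by blast
  define c \<eta> where "c = fst (run p w)" and "\<eta> = snd (run p w)"
  have run_w: "run p w = (c, \<eta>)" by (simp add: c_def \<eta>_def)
  have W: "weight c \<eta>" using weight_run[OF p(1) wset] by (simp add: c_def \<eta>_def)
  \<comment> \<open>\<open>b\<close> records whether \<open>\<eta>\<close> is an image under
    \<open>\<tau>_i\<close> or is killed by it. For different colors \<open>\<tau>_i\<close> kills
    \<open>\<eta>\<close> either way, and \<open>T_i\<close> acts by minus the constant. For equal
    colors the constant is 0, and the eigenvalue is \<open>-1\<close> on an image and
    \<open>0\<close> otherwise.\<close>
  have key: "\<eta> (act (T i) x) = (if c i < c (i+1) then - 1 else if c i = c (i+1) \<and> b then - 1 else 0) * \<eta> x"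
    if cases: "(b \<and> (\<exists>c' \<theta>'. weight c' \<theta>' \<and> (c, \<eta>) = step i (c', \<theta>'))) \<or>
      (\<not> b \<and> \<not> nonzero (snd (step i (c, \<eta>))))" and i: "i \<in> {1..<n}" and x: "x \<in> carrier M" for i b x
    using cases
  proof (elim disjE conjE exE)
    fix c' \<theta>' assume b: "b" and "weight c' \<theta>'" "(c, \<eta>) = step i (c', \<theta>')"
    then have "snd (step i (c, \<eta>)) x = (if c' i = c' (i+1) then - \<eta> x else 0)"
      using step_step[OF \<open>weight c' \<theta>'\<close> i, of x] by (metis snd_conv)
    moreover have "c' i = c' (i+1) \<longleftrightarrow> c i = c (i+1)"
      using \<open>(c, \<eta>) = _\<close> by (auto simp: step_def swap_color_def)
    ultimately show ?thesis
      using b by (auto simp: step_def twist_apply[OF x] add_eq_0_iff split: if_splits)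
  next
    assume "\<not> b" "\<not> nonzero (snd (step i (c, \<eta>)))"
    then show ?thesis
      by (auto simp: step_def nonzero_def twist_apply[OF x] add_eq_0_iff dest!: spec[of _ x] split: if_splits)
  qed
  have cases: "\<exists>b. (b \<and> (\<exists>c' \<theta>'. weight c' \<theta>' \<and> (c, \<eta>) = step i (c', \<theta>'))) \<or>
      (\<not> b \<and> \<not> nonzero (snd (step i (c, \<eta>))))" if i: "i \<in> {1..<n}" for i
  proof -
    have "1 \<le> i" "i \<le> n - 1" using i by auto
    from normal_words_step[OF wn this] show ?thesis
    proof (elim disjE bexE exE conjE)
      fix v assume v: "v \<in> normal_words (n - 1)" "length v = Suc (length w)" "braid_eq (w @ [i]) v"
      then have "run p v = step i (c, \<eta>)"
        using run_braid_eq[OF v(3) p(1)] wset i run_w by (simp add: run_append) (simp add: run_def)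
      moreover have "v \<notin> S" using w(2)[of v] v(2) by auto
      then have "\<not> nonzero (snd (run p v))" using p(1) v(1) unfolding S_def by blast
      ultimately show ?thesis by (intro exI[of _ False]) simp
    next
      fix v assume v: "braid_eq w (v @ [i])"
      then have "set v \<subseteq> {1..<n}" using braid_eq_set[OF v] wset by auto
      then have "wt (run p v)" using weight_run[OF p(1)] by blast
      moreover have "(c, \<eta>) = step i (run p v)"
        using run_braid_eq[OF v p(1) wset] run_w by (simp add: run_append) (simp add: run_def)
      ultimately show ?thesis by (intro exI[of _ True]) (metis prod.collapse)
    qed
  qed
  have "\<exists>b. \<forall>x\<in>carrier M. \<eta> (act (T i) x) = (if c i < c (i+1) then - 1 else if c i = c (i+1) \<and> b then - 1 else 0) * \<eta> x"
    if i: "i \<in> {1..<n}" for i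
    using cases[OF i] key[OF _ i] by blast
  then obtain b where b: "\<And>i x. i \<in> {1..<n} \<Longrightarrow> x \<in> carrier M \<Longrightarrow>
      \<eta> (act (T i) x) = (if c i < c (i+1) then - 1 else if c i = c (i+1) \<and> b i then - 1 else 0) * \<eta> x"
    by metis
  \<comment> \<open>A strict rise of the colors is always a descent and a strict fall never is;
    \<open>b\<close> decides only between equal colors. This gives the inequalities of an
    anticycloribbon.\<close>
  define D where "D = {i \<in> {1..<n}. c i < c (i+1) \<or> (c i = c (i+1) \<and> b i)}"
  \<comment> \<open>Colorings are extensional, whereas \<open>c\<close> is unrestricted outside the
    positions from 1 to \<open>n\<close>.\<close>
  define c' where "c' = restrict c {1..n}"
  note WD = weightD[OF W]
  have "eigen_functional (aks_weight n r u D c') M \<eta>"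
    unfolding eigen_functional_def
  proof (intro conjI allI impI ballI)
    show "additive_functional M \<eta>" using WD(1) by (simp add: lin_def linear_functional_def)
    fix a z x assume az: "aks_weight n r u D c' a z" and x: "x \<in> carrier M"
    then show "\<eta> (a \<odot>\<^bsub>M\<^esub> x) = z * \<eta> x"
      using lin_scal[OF WD(1) x] b[OF _ x] WD(4)[OF _ x]
      by (auto simp: aks_weight_def hecke_weight_def D_def c'_def)
  qed
  moreover have "\<exists>x\<in>carrier M. \<eta> x \<noteq> 0"
    using p(2) WD(1) by (auto simp: nonzero_def \<eta>_def[symmetric] lin_def)
  moreover have "c' \<in> {1..n} \<rightarrow>\<^sub>E {1..r}" using WD(2) by (auto simp: c'_def)
  moreover have "(i \<notin> D \<longrightarrow> c' i \<ge> c' (i+1)) \<and> (i \<in> D \<longrightarrow> c' i \<le> c' (i+1))" if "i \<in> {1..<n}" for i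
    using that by (auto simp: D_def c'_def)
  moreover have "\<eta> x = 0" if "x \<in> Y" for x using WD(1) that by (simp add: lin_def)
  moreover have "D \<subseteq> {1..<n}" by (auto simp: D_def)
  ultimately show thesis by (intro that[of D c' \<eta>]) auto
qed

end

text \<open>Applied to the image of a homomorphism, this Nakayama lemma reduces surjectivity to a
  check on weight functionals. A linear functional that separates \<open>Y\<close> from a vector is
  the starting point for the search of an eigenvector.\<close>

lemma proper_submodule_in_kernel:
  assumes M: "left_module (AKS n r u) M" and Y: "submodule Y (AKS n r u) M" and u: "inj_on u {1..r}"
    and proper: "Y \<noteq> carrier M"
  obtains D c \<eta> where "D \<subseteq> {1..<n}" "c \<in> {1..n} \<rightarrow>\<^sub>E {1..r}"
    "\<And>i. i \<in> {1..<n} \<Longrightarrow> (i \<notin> D \<longrightarrow> c i \<ge> c (i+1)) \<and> (i \<in> D \<longrightarrow> c i \<le> c (i+1))"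
    "eigen_functional (aks_weight n r u D c) M \<eta>" "\<And>x. x \<in> Y \<Longrightarrow> \<eta> x = 0" "\<exists>x\<in>carrier M. \<eta> x \<noteq> 0"
proof -
  obtain v where v: "v \<in> carrier M" "v \<notin> Y"
    using proper left_module.submoduleD(1)[OF M Y] by blast
  obtain \<theta> where \<theta>: "additive_functional M \<theta>"
    "\<And>z x. x \<in> carrier M \<Longrightarrow> \<theta> (aks_class n r u (scal z) \<odot>\<^bsub>M\<^esub> x) = z * \<theta> x"
    "\<forall>x\<in>Y. \<theta> x = 0" "\<theta> v = 1"
    by (rule functional_extension[OF M aks_scal Y v]) blast
  have "linear_functional n r u M \<theta>" using \<theta> by (simp add: linear_functional_def)
  moreover have "\<exists>x\<in>carrier M. \<theta> x \<noteq> 0" using \<theta>(4) v(1) by (intro bexI[of _ v]) auto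
  ultimately obtain D c \<eta> where "D \<subseteq> {1..<n}" "c \<in> {1..n} \<rightarrow>\<^sub>E {1..r}"
    "\<forall>i\<in>{1..<n}. (i \<notin> D \<longrightarrow> c i \<ge> c (i+1)) \<and> (i \<in> D \<longrightarrow> c i \<le> c (i+1))"
    "eigen_functional (aks_weight n r u D c) M \<eta>" "\<forall>x\<in>Y. \<eta> x = 0" "\<exists>x\<in>carrier M. \<eta> x \<noteq> 0"
    by (rule eigen_functional_of_linear_functional[OF M Y u _ \<theta>(3)]) blast
  then show thesis by (intro that[of D c \<eta>]) auto
qed

section \<open>The induced module\<close>

lemma finite_ribbons_of_shape: "finite {K. anticycloribbon n r K \<and> fst K = I}"
proof (rule finite_subset)
  show "{K. anticycloribbon n r K \<and> fst K = I} \<subseteq> {I} \<times> ({1..n} \<rightarrow>\<^sub>E {1..r})"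
    by (auto simp: anticycloribbon_def colored_ribbon_def)
  show "finite ({I} \<times> ({1..n} \<rightarrow>\<^sub>E {1..r}))" by (intro finite_cartesian_product finite_PiE) auto
qed

lemma lmod_hom_to_direct_sum:
  assumes "finite A" "\<And>i. i \<in> A \<Longrightarrow> f i \<in> lmod_hom R N (M i)"
  shows "(\<lambda>x. \<lambda>i\<in>A. f i x) \<in> lmod_hom R N (direct_sum A M)"
  using assms(1) lmod_homD[OF assms(2)]
  by (auto simp: lmod_hom_def carrier_direct_sum direct_sum_simps intro!: restrict_ext)

text \<open>Balancedness moves an element of the subalgebra from \<open>p\<close> across the tensor
  sign, where it acts on the induced module by its eigenvalue. The coloring is forgotten.\<close>

lemma eigen_functional_tensor:
  assumes P: "left_module (Hecke0 n r u) P"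
    and \<theta>: "eigen_functional (aks_weight n r u D c) (induced_module (AKS n r u) (carrier (Hecke0 n r u)) P) \<theta>"
  shows "eigen_functional (hecke_weight n r u D) P
    (\<lambda>p. \<theta> (tensor (AKS n r u) (carrier (Hecke0 n r u)) P \<one>\<^bsub>AKS n r u\<^esub> p))"
proof -
  let ?R = "AKS n r u" and ?A = "carrier (Hecke0 n r u)"
  let ?N = "induced_module ?R ?A P" and ?t = "tensor ?R ?A P"
  interpret R: ring ?R by (rule ring_AKS)
  have P': "left_module (?R\<lparr>carrier := ?A\<rparr>) P" using P Hecke0_restrict by metis
  note sub = subring_Hecke0[of n r u]
  note \<theta>D = eigen_functionalD[OF \<theta>]
  have add: "\<theta> (x \<oplus>\<^bsub>?N\<^esub> y) = \<theta> x + \<theta> y" if "x \<in> carrier ?N" "y \<in> carrier ?N" for x y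
    using \<theta>D(1) that by (simp add: additive_functional_def)
  note t = tensor_closed[OF R.ring_axioms sub P' R.one_closed]
  show ?thesis
    unfolding eigen_functional_def additive_functional_def
  proof (intro conjI ballI allI impI)
    fix p q assume "p \<in> carrier P" "q \<in> carrier P"
    then show "\<theta> (?t \<one>\<^bsub>?R\<^esub> (p \<oplus>\<^bsub>P\<^esub> q)) = \<theta> (?t \<one>\<^bsub>?R\<^esub> p) + \<theta> (?t \<one>\<^bsub>?R\<^esub> q)"
      using tensor_add[OF R.ring_axioms sub P' R.one_closed] add t by simp
  next
    fix a z p assume az: "hecke_weight n r u D a z" and p: "p \<in> carrier P"
    have a: "a \<in> ?A" "a \<in> carrier ?R" using hecke_weight_closed[OF az] Hecke0_AKS by auto
    have "?t \<one>\<^bsub>?R\<^esub> (a \<odot>\<^bsub>P\<^esub> p) = ?t (\<one>\<^bsub>?R\<^esub> \<otimes>\<^bsub>?R\<^esub> a) p"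
      using tensor_balanced[OF R.ring_axioms sub P' R.one_closed a(1) p] by simp
    also have "\<dots> = a \<odot>\<^bsub>?N\<^esub> ?t \<one>\<^bsub>?R\<^esub> p"
      using smult_tensor[OF R.ring_axioms sub P' a(2) R.one_closed p] a(2) by simp
    finally show "\<theta> (?t \<one>\<^bsub>?R\<^esub> (a \<odot>\<^bsub>P\<^esub> p)) = z * \<theta> (?t \<one>\<^bsub>?R\<^esub> p)"
      using \<theta>D(2)[of a z "?t \<one>\<^bsub>?R\<^esub> p"] az t[OF p] by (simp add: aks_weight_def)
  qed
qed

text \<open>Over the subalgebra \<open>\<psi>\<close> and \<open>\<phi>\<close> have the same
  weight, so projectivity of \<open>P\<close> lifts \<open>\<phi>\<close> along
  \<open>\<psi>\<close> to a map from \<open>P\<close> to the restriction of \<open>Q\<close>.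
  Frobenius reciprocity extends this map to the induced module.\<close>

lemma hecke_functional_lift:
  assumes P: "is_P_Hecke0 n r u I P" and Q: "left_module (AKS n r u) Q"
    and \<phi>: "eigen_functional (hecke_weight n r u D) P \<phi>"
    and \<psi>: "eigen_functional (aks_weight n r u D c) Q \<psi>" "\<exists>x\<in>carrier Q. \<psi> x = 1"
  obtains f where "f \<in> lmod_hom (AKS n r u) (induced_module (AKS n r u) (carrier (Hecke0 n r u)) P) Q"
    "\<And>p. p \<in> carrier P \<Longrightarrow>
      \<psi> (f (tensor (AKS n r u) (carrier (Hecke0 n r u)) P \<one>\<^bsub>AKS n r u\<^esub> p)) = \<phi> p"
proof -
  let ?R = "AKS n r u" and ?H = "Hecke0 n r u"
  let ?A = "carrier ?H"
  have proj: "projective_module ?H P" and lP: "left_module ?H P"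
    using P by (auto simp: is_P_Hecke0_def indec_projective_with_simple_quotient_def)
  have lP': "left_module (?R\<lparr>carrier := ?A\<rparr>) P" using lP Hecke0_restrict by metis
  have lQ: "left_module ?H Q"
    using left_module.left_module_restrict[OF Q subring_Hecke0] Hecke0_restrict by metis
  have \<psi>H: "eigen_functional (hecke_weight n r u D) Q \<psi>"
    using \<psi>(1) by (rule eigen_functional_mono) (simp add: aks_weight_def)
  have eig: "\<exists>z. (\<forall>x\<in>carrier Q. \<psi> (a \<odot>\<^bsub>Q\<^esub> x) = z * \<psi> x) \<and> (\<forall>x\<in>carrier P. \<phi> (a \<odot>\<^bsub>P\<^esub> x) = z * \<phi> x)"
    if "a \<in> ?A" for a
    using eigen_functional_generate[OF lQ lP hecke_gens_Hecke0 \<psi>H \<phi> hecke_weight_gens] that Hecke0_generated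
    by blast
  have all: "\<exists>a\<in>?A. \<forall>x\<in>carrier Q. \<psi> (a \<odot>\<^bsub>Q\<^esub> x) = z * \<psi> x" for z
    using eigen_functionalD(2)[OF \<psi>H hecke_weight_scal] Hecke0_scal(1) by blast
  obtain g where g: "g \<in> lmod_hom ?H P Q" "\<And>x. x \<in> carrier P \<Longrightarrow> \<psi> (g x) = \<phi> x"
    by (rule projective_lift_functional[OF proj lQ eigen_functionalD(1)[OF \<psi>H] \<psi>(2)
          eigen_functionalD(1)[OF \<phi>] eig all]) blast+
  have "g \<in> lmod_hom (?R\<lparr>carrier := ?A\<rparr>) P Q" using g(1) Hecke0_restrict by metis
  then obtain f where "f \<in> lmod_hom ?R (induced_module ?R ?A P) Q"
    "\<And>p. p \<in> carrier P \<Longrightarrow> f (tensor ?R ?A P \<one>\<^bsub>?R\<^esub> p) = g p"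
    by (rule induced_universal[OF ring_AKS subring_Hecke0 lP' Q]) blast
  then show thesis using that g(2) by simp
qed

lemma eigen_functional_zero_if_generators:
  assumes P: "left_module (Hecke0 n r u) P"
    and \<theta>: "eigen_functional (aks_weight n r u D c) (induced_module (AKS n r u) (carrier (Hecke0 n r u)) P) \<theta>"
    and zero: "\<And>p. p \<in> carrier P \<Longrightarrow>
      \<theta> (tensor (AKS n r u) (carrier (Hecke0 n r u)) P \<one>\<^bsub>AKS n r u\<^esub> p) = 0"
    and x: "x \<in> carrier (induced_module (AKS n r u) (carrier (Hecke0 n r u)) P)"
  shows "\<theta> x = 0"
proof -
  let ?R = "AKS n r u" and ?A = "carrier (Hecke0 n r u)"
  let ?N = "induced_module ?R ?A P"
  have P': "left_module (?R\<lparr>carrier := ?A\<rparr>) P" using P Hecke0_restrict by metis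
  note ctx = ring_AKS subring_Hecke0 P'
  have "{x \<in> carrier ?N. \<theta> x = 0} = carrier ?N"
  proof (rule induced_generated[OF ctx])
    show "submodule {x \<in> carrier ?N. \<theta> x = 0} ?R ?N"
      by (rule eigen_kernel_submodule[OF left_module_induced[OF ctx] AKS_generated aks_gens_closed \<theta> aks_weight_gens])
  qed (use zero tensor_closed[OF ctx ring.ring_simprules(6)[OF ring_AKS]] in auto)
  then show ?thesis using x by blast
qed

section \<open>The isomorphism between the induced module and the direct sum\<close>

theorem theorem4p3:
  fixes n r :: nat and u :: "nat \<Rightarrow> complex" and I :: "nat list"
    and P :: "(aks_elem, 'p) module"
    and Q :: "ribbon \<Rightarrow> (aks_elem, 'q) module"
  assumes "n \<ge> 1" and "r \<ge> 1" and "inj_on u {1..r}"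
    and "composition n I"
    and "is_P_Hecke0 n r u I P"
    and "\<And>K. anticycloribbon n r K \<Longrightarrow> fst K = I \<Longrightarrow> is_P_AKS n r u K (Q K)"
  shows "lmod_iso (AKS n r u)
           (induced_module (AKS n r u) (carrier (Hecke0 n r u)) P)
           (direct_sum {K. anticycloribbon n r K \<and> fst K = I} Q)"
proof -
  let ?R = "AKS n r u" and ?A = "carrier (Hecke0 n r u)"
  define N where "N = induced_module ?R ?A P"
  define L where "L = {K. anticycloribbon n r K \<and> fst K = I}"
  define S where "S = direct_sum L Q"
  define t where "t = tensor ?R ?A P \<one>\<^bsub>?R\<^esub>"
  interpret R: ring ?R by (rule ring_AKS)
  have u: "inj_on u {1..r}" by fact
  have lP: "left_module (Hecke0 n r u) P"
    using assms(5) by (auto simp: is_P_Hecke0_def indec_projective_with_simple_quotient_def)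
  have lP': "left_module (?R\<lparr>carrier := ?A\<rparr>) P" using lP Hecke0_restrict by metis
  note ctx = R.ring_axioms subring_Hecke0 lP'
  have lN: "left_module ?R N" unfolding N_def by (rule left_module_induced[OF ctx])
  have Q: "left_module ?R (Q K)" "projective_module ?R (Q K)" if "K \<in> L" for K
    using assms(6) that by (auto simp: L_def is_P_AKS_def indec_projective_with_simple_quotient_def)
  have lS: "left_module ?R S" unfolding S_def by (rule left_module_direct_sum[OF R.ring_axioms Q(1)])
  have finL: "finite L" unfolding L_def by (rule finite_ribbons_of_shape)
  have DI: "Des I \<subseteq> {1..<n}" using Des_subset[of I] assms(4) by (auto simp: composition_def)
  have color: "snd K \<in> {1..n} \<rightarrow>\<^sub>E {1..r}" if "K \<in> L" for K
    using that by (auto simp: L_def anticycloribbon_def colored_ribbon_def)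
  have tN: "t p \<in> carrier N" if "p \<in> carrier P" for p
    unfolding t_def N_def using tensor_closed[OF ctx R.one_closed that] .

  obtain \<phi> where \<phi>: "eigen_functional (hecke_weight n r u (Des I)) P \<phi>" "\<exists>p\<in>carrier P. \<phi> p = 1"
    and \<phi>_unique: "\<And>D \<theta>. eigen_functional (hecke_weight n r u D) P \<theta> \<Longrightarrow> \<exists>z. \<forall>x\<in>carrier P. \<theta> x = z * \<phi> x"
    by (rule functional_of_P_Hecke0[OF assms(5)]) blast
  obtain p0 where p0: "p0 \<in> carrier P" "\<phi> p0 = 1" using \<phi>(2) by blast
  have "\<exists>\<psi>. eigen_functional (aks_weight n r u (Des I) (snd K)) (Q K) \<psi> \<and> (\<exists>x\<in>carrier (Q K). \<psi> x = 1) \<and>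
      (\<forall>D c \<theta>. eigen_functional (aks_weight n r u D c) (Q K) \<theta> \<longrightarrow> (\<exists>z. \<forall>x\<in>carrier (Q K). \<theta> x = z * \<psi> x))"
    if K: "K \<in> L" for K
  proof -
    have "is_P_AKS n r u (I, snd K) (Q K)" using assms(6)[of K] K by (auto simp: L_def)
    then obtain \<psi> where "eigen_functional (aks_weight n r u (Des I) (snd K)) (Q K) \<psi>"
      "\<exists>x\<in>carrier (Q K). \<psi> x = 1"
      "\<And>D c' \<theta>. eigen_functional (aks_weight n r u D c') (Q K) \<theta> \<Longrightarrow> \<exists>z. \<forall>x\<in>carrier (Q K). \<theta> x = z * \<psi> x"
      by (rule functional_of_P_AKS[OF _ assms(1,4)]) blast
    then show ?thesis by blast
  qed
  then obtain \<psi> where \<psi>: "\<And>K. K \<in> L \<Longrightarrow> eigen_functional (aks_weight n r u (Des I) (snd K)) (Q K) (\<psi> K)"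
    "\<And>K. K \<in> L \<Longrightarrow> \<exists>x\<in>carrier (Q K). \<psi> K x = 1"
    and \<psi>_unique: "\<And>K D c \<theta>. K \<in> L \<Longrightarrow> eigen_functional (aks_weight n r u D c) (Q K) \<theta> \<Longrightarrow>
      \<exists>z. \<forall>x\<in>carrier (Q K). \<theta> x = z * \<psi> K x"
    by metis

  \<comment> \<open>Every component restricts to the same functional \<open>\<phi>\<close> on
    \<open>P\<close>: the summands differ only in the coloring, which the weight over the subalgebra
    does not record.\<close>
  have "\<exists>f. f \<in> lmod_hom ?R N (Q K) \<and> (\<forall>p\<in>carrier P. \<psi> K (f (t p)) = \<phi> p)" if "K \<in> L" for K
    unfolding N_def t_def
    by (rule hecke_functional_lift[OF assms(5) Q(1)[OF that] \<phi>(1) \<psi>(1)[OF that] \<psi>(2)[OF that]]) blast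
  then obtain fK where fK: "\<And>K. K \<in> L \<Longrightarrow> fK K \<in> lmod_hom ?R N (Q K)"
    "\<And>K p. K \<in> L \<Longrightarrow> p \<in> carrier P \<Longrightarrow> \<psi> K (fK K (t p)) = \<phi> p"
    by metis
  define f where "f = (\<lambda>x. \<lambda>K\<in>L. fK K x)"
  have f: "f \<in> lmod_hom ?R N S"
    unfolding f_def S_def using lmod_hom_to_direct_sum[OF finL fK(1)] .
  have inj: "direct_sum_inj L Q K \<in> lmod_hom ?R (Q K) S" if "K \<in> L" for K
    unfolding S_def by (rule direct_sum_inj_hom) (use Q(1) R.ring_axioms that in auto)
  have proj: "(\<lambda>y. y K) \<in> lmod_hom ?R S (Q K)" if "K \<in> L" for K
    unfolding S_def by (rule direct_sum_proj_hom) (use Q(1) R.ring_axioms that in auto)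

  have f_surj: "f ` carrier N = carrier S"
  proof (rule ccontr)
    assume "f ` carrier N \<noteq> carrier S"
    then obtain D c \<theta> where D: "D \<subseteq> {1..<n}" and c: "c \<in> {1..n} \<rightarrow>\<^sub>E {1..r}"
      and \<theta>: "eigen_functional (aks_weight n r u D c) S \<theta>"
      and kill: "\<And>y. y \<in> f ` carrier N \<Longrightarrow> \<theta> y = 0" and nz: "\<exists>y\<in>carrier S. \<theta> y \<noteq> 0"
      by (rule proper_submodule_in_kernel[OF lS lmod_hom_image_submodule[OF f lN lS] u]) blast
    have \<theta>i: "eigen_functional (aks_weight n r u D c) (Q K) (\<lambda>x. \<theta> (direct_sum_inj L Q K x))" if "K \<in> L" for K
      by (rule eigen_functional_comp[OF inj[OF that] \<theta> aks_weight_closed])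
    then have "\<exists>z. \<forall>x\<in>carrier (Q K). \<theta> (direct_sum_inj L Q K x) = z * \<psi> K x" if "K \<in> L" for K
      using \<psi>_unique that by blast
    then obtain z where z: "\<And>K x. K \<in> L \<Longrightarrow> x \<in> carrier (Q K) \<Longrightarrow> \<theta> (direct_sum_inj L Q K x) = z K * \<psi> K x"
      by metis
    \<comment> \<open>The weight of \<open>\<theta>\<close> can be read off any summand on which it
      does not vanish. All summands have shape \<open>I\<close> and their colorings differ, so
      \<open>\<theta>\<close> lives on a single \<open>Q K\<close>.\<close>
    have weight: "D = Des I \<and> c = snd K" if K: "K \<in> L" "z K \<noteq> 0" for K
    proof -
      obtain x where x: "x \<in> carrier (Q K)" "\<psi> K x = 1" using \<psi>(2)[OF K(1)] by blast
      show ?thesis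
        using aks_weight_unique[OF \<theta>i[OF K(1)] \<psi>(1)[OF K(1)] z[OF K(1)] K(2) x Q(1)[OF K(1)] u D DI c color[OF K(1)]]
        by blast
    qed
    have "\<exists>K\<in>L. z K \<noteq> 0"
    proof (rule ccontr)
      assume "\<not> ?thesis"
      then have "\<theta> y = 0" if "y \<in> carrier S" for y
        using direct_sum_functional_eqI[OF R.ring_axioms Q(1), where A = L and \<theta> = \<theta> and \<eta> = "\<lambda>_. 0" and f = y] z that eigen_functionalD(1)[OF \<theta>]
        by (auto simp: S_def additive_functional_def)
      then show False using nz by blast
    qed
    then obtain K where K: "K \<in> L" "z K \<noteq> 0" by blast
    have other: "z K' = 0" if "K' \<in> L" "K' \<noteq> K" for K'
      using weight[OF K] weight[OF that(1)] that K(1) by (auto simp: L_def prod_eq_iff)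
    \<comment> \<open>Thus \<open>\<theta>\<close> is a nonzero multiple of \<open>\<psi> K\<close>
      after the projection to \<open>Q K\<close>. Its value at the image of \<open>t p0\<close> is
      \<open>z K\<close>, although it was supposed to kill the image of \<open>f\<close>.\<close>
    have "\<theta> y = z K * \<psi> K (y K)" if "y \<in> carrier S" for y
    proof (rule direct_sum_functional_eqI[OF R.ring_axioms Q(1), where A = L])
      show "additive_functional (direct_sum L Q) \<theta>" using eigen_functionalD(1)[OF \<theta>] by (simp add: S_def)
      show "additive_functional (direct_sum L Q) (\<lambda>y. z K * \<psi> K (y K))"
        using lmod_homD[OF proj[OF K(1)]] eigen_functionalD(1)[OF \<psi>(1)[OF K(1)]]
        by (auto simp: S_def additive_functional_def distrib_left)
      fix K' x assume K': "K' \<in> L" and x: "x \<in> carrier (Q K')"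
      have "\<psi> K \<zero>\<^bsub>Q K\<^esub> = 0"
        using additive_functionalD(2)[OF eigen_functionalD(1)[OF \<psi>(1)[OF K(1)]] left_moduleD(2)[OF Q(1)[OF K(1)]]] .
      then show "\<theta> (direct_sum_inj L Q K' x) = z K * \<psi> K (direct_sum_inj L Q K' x K)"
        using z[OF K' x] other[OF K'] K(1) by (auto simp: direct_sum_inj_def)
    qed (use that S_def in auto)
    from this[of "f (t p0)"] have "\<theta> (f (t p0)) = z K"
      using lmod_homD(1)[OF f tN[OF p0(1)]] fK(2)[OF K(1) p0(1)] p0(2) K(1) by (simp add: f_def)
    then show False using kill tN[OF p0(1)] K(2) by simp
  qed

  \<comment> \<open>Surjectivity of \<open>f\<close> is used here: each summand is projective, so
    its inclusion lifts through \<open>f\<close>, and the lifts assemble to a section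
    \<open>s\<close>.\<close>
  have "\<exists>s. s \<in> lmod_hom ?R (Q K) N \<and> (\<forall>x\<in>carrier (Q K). f (s x) = direct_sum_inj L Q K x)" if "K \<in> L" for K
    by (rule projective_lift[OF Q(2)[OF that] lN f f_surj lS inj[OF that]]) blast
  then obtain sK where sK: "\<And>K. K \<in> L \<Longrightarrow> sK K \<in> lmod_hom ?R (Q K) N"
    "\<And>K x. K \<in> L \<Longrightarrow> x \<in> carrier (Q K) \<Longrightarrow> f (sK K x) = direct_sum_inj L Q K x"
    by metis
  obtain s where s: "s \<in> lmod_hom ?R S N"
    "\<And>K x. K \<in> L \<Longrightarrow> x \<in> carrier (Q K) \<Longrightarrow> s (direct_sum_inj L Q K x) = sK K x"
    unfolding S_def by (rule direct_sum_universal[OF Q(1) R.ring_axioms lN sK(1)]) blast+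
  have fs: "f (s y) = y" if "y \<in> carrier S" for y
  proof (rule direct_sum_hom_eqI[OF Q(1) R.ring_axioms lS, where A = L and h = "\<lambda>y. f (s y)" and h' = "\<lambda>y. y"])
    show "(\<lambda>y. f (s y)) \<in> lmod_hom ?R (direct_sum L Q) S"
      using lmod_hom_comp[OF s(1) f] by (simp add: S_def)
    show "(\<lambda>y. y) \<in> lmod_hom ?R (direct_sum L Q) S" by (auto simp: S_def lmod_hom_def)
  qed (use s(2) sK(2) that in \<open>auto simp: S_def\<close>)

  have s_surj: "s ` carrier S = carrier N"
  proof (rule ccontr)
    assume "s ` carrier S \<noteq> carrier N"
    then obtain D c \<theta> where D: "D \<subseteq> {1..<n}" and c: "c \<in> {1..n} \<rightarrow>\<^sub>E {1..r}"
      and Dc: "\<And>i. i \<in> {1..<n} \<Longrightarrow> (i \<notin> D \<longrightarrow> c i \<ge> c (i+1)) \<and> (i \<in> D \<longrightarrow> c i \<le> c (i+1))"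
      and \<theta>: "eigen_functional (aks_weight n r u D c) N \<theta>"
      and kill: "\<And>x. x \<in> s ` carrier S \<Longrightarrow> \<theta> x = 0" and nz: "\<exists>x\<in>carrier N. \<theta> x \<noteq> 0"
      by (rule proper_submodule_in_kernel[OF lN lmod_hom_image_submodule[OF s(1) lS lN] u]) blast
    have \<theta>t: "eigen_functional (hecke_weight n r u D) P (\<lambda>p. \<theta> (t p))"
      using eigen_functional_tensor[OF lP \<theta>[unfolded N_def]] by (simp add: t_def)
    then obtain z where z: "\<And>p. p \<in> carrier P \<Longrightarrow> \<theta> (t p) = z * \<phi> p" using \<phi>_unique by blast
    have "z \<noteq> 0"
    proof
      assume "z = 0"
      then have "\<theta> x = 0" if "x \<in> carrier N" for x
        using eigen_functional_zero_if_generators[OF lP \<theta>[unfolded N_def]] z that by (simp add: N_def t_def)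
      then show False using nz by blast
    qed
    have "aks_class n r u (T i) \<odot>\<^bsub>P\<^esub> p0 \<in> carrier P" if "i \<in> {1..<n}" for i
      using hecke_gens_Hecke0[of n r u] that
      by (intro left_module.smult_closed[OF lP _ p0(1)]) (auto simp: hecke_gens_def)
    then have "D = Des I"
      using hecke_weight_unique[OF \<theta>t \<phi>(1) z \<open>z \<noteq> 0\<close> p0 _ D DI] by simp
    define K where "K = (I, c)"
    \<comment> \<open>The inequalities supplied by the Nakayama lemma enter here: with
      \<open>D = Des I\<close> they say that \<open>(I, c)\<close> is an anticycloribbon, so that
      the direct sum has a summand of the weight of \<open>\<theta>\<close>.\<close>
    have K: "K \<in> L"
      using Dc c assms(4) \<open>D = Des I\<close>
      by (auto simp: K_def L_def anticycloribbon_def colored_ribbon_def)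
    have "eigen_functional (aks_weight n r u (Des I) (snd K)) N (\<lambda>x. \<psi> K (fK K x))"
      by (rule eigen_functional_comp[OF fK(1)[OF K] \<psi>(1)[OF K] aks_weight_closed])
    then have "eigen_functional (aks_weight n r u D c) N (\<lambda>x. \<psi> K (fK K x))"
      using \<open>D = Des I\<close> by (simp add: K_def)
    note diff = eigen_functional_lincomb[OF \<theta> this, of z]
    \<comment> \<open>Both sides have the same weight and both restrict to \<open>z\<close> times
      \<open>\<phi>\<close> on \<open>P\<close>. Their difference vanishes on the image of
      \<open>P\<close>, which generates \<open>N\<close>.\<close>
    have \<theta>_eq: "\<theta> x = z * \<psi> K (fK K x)" if "x \<in> carrier N" for x
      using eigen_functional_zero_if_generators[OF lP diff[unfolded N_def], of x] z fK(2)[OF K] that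
      by (simp add: N_def t_def)
    obtain q where q: "q \<in> carrier (Q K)" "\<psi> K q = 1" using \<psi>(2)[OF K] by blast
    \<comment> \<open>Since \<open>s\<close> is a section of \<open>f\<close>, the component at
      \<open>K\<close> recovers \<open>q\<close>; hence \<open>\<theta>\<close> takes the nonzero
      value \<open>z\<close> on the image of \<open>s\<close>.\<close>
    have "fK K (sK K q) = f (sK K q) K" using K by (simp add: f_def)
    also have "\<dots> = q" using sK(2)[OF K q(1)] K by (simp add: direct_sum_inj_def)
    finally have "\<theta> (sK K q) = z" using \<theta>_eq lmod_homD(1)[OF sK(1)[OF K] q(1)] q(2) by simp
    moreover have "sK K q \<in> s ` carrier S"
      using s(2)[OF K q(1)] lmod_homD(1)[OF inj[OF K] q(1)] by (metis imageI)
    ultimately show False using kill \<open>z \<noteq> 0\<close> by simp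
  qed

  \<comment> \<open>Every element of \<open>N\<close> has the form \<open>s y\<close>, and
    \<open>f\<close> returns \<open>y\<close> from it.\<close>
  have "inj_on f (carrier N)"
    using fs unfolding s_surj[symmetric] by (auto simp: inj_on_def)
  then have "bij_betw f (carrier N) (carrier S)" using f_surj by (simp add: bij_betw_def)
  then show ?thesis
    using f unfolding lmod_iso_def N_def S_def L_def by blast
qed

end
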